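(* Let $(X,T)$ be a topological dynamical system and let $\mathbf{F}=\{\mathbf{f}_n\}_{n=1}^\infty$ be a block sub-additive potential on $X$. Let $\mathcal{F}=\{f_n\}_{n=1}^\infty$, $f_n(x)=\mathbf{f}_n(x,Tx,\ldots,T^{n-1}x)$, be the sub-additive potential induced by $\mathbf{F}$, and assume $\mathcal{F}_*(\mu)>-\infty$ for all $\mu\in M(X,T)$. Then: (1) $$GP(T,\mathbf{F})=P(T,\mathcal{F})=\sup_{\mu\in M(X,T)}\big\{h_\mu(T)+\mathcal{F}_*(\mu)\big\}.$$ (2) For every $\mu\in M(X,T)$, $$GP_\mu(T,\mathbf{F})\le h_\mu(T)+\mathcal{F}_*(\mu),$$ and if $\mu$ is ergodic, then $$GP_\mu(T,\mathbf{F})=h_\mu(T)+\mathcal{F}_*(\mu).$$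
   Context: A topological dynamical system (TDS) $(X,T)$ is a compact metric space $X$ with metric $d$ together with a continuous surjective map $T:X\to X$. $C(Z)$ is the space of real-valued continuous functions on $Z$; $M(X,T)$ is the set of $T$-invariant Borel probability measures on $X$; $h_\mu(T)$ is the usual measure-theoretic (Kolmogorov–Sinai) entropy. A block sub-additive potential on $X$ is a sequence $\mathbf{F}=\{\mathbf{f}_n\}_{n=1}^\infty$ with $\mathbf{f}_n\in C(X^n)$ such that $\mathbf{f}_{n+m}(x_0,\ldots,x_{n+m-1})\le \mathbf{f}_n(x_0,\ldots,x_{n-1})+\mathbf{f}_m(x_n,\ldots,x_{n+m-1})$ for all $m,n\ge 1$ and all points. The induced sequence $f_n(x)=\mathbf{f}_n(x,Tx,\ldots,T^{n-1}x)$ satisfies $f_{m+n}(x)\le f_m(x)+f_n(T^mx)$, and $\mathcal{F}_*(\mu)=\lim_{n\to\infty}\frac1n\int f_n\,d\mu$ (the limit exists by sub-additivity). Pressure of the sub-additive potential: $E\subset X$ is an $(n,\epsilon)$-separated subset of $X$ with respect to $T$ if $\max_{0\le i\le n-1}d(T^ix,T^iy)>\epsilon$ for any two different $x,y\in E$. Put $P_n(T,\mathcal{F},\epsilon)=\sup\{\sum_{x\in E}e^{f_n(x)}:E\text{ is an }(n,\epsilon)\text{-separated subset of }X\}$, $P(T,\mathcal{F},\epsilon)=\limsup_{n\to\infty}\frac1n\log P_n(T,\mathcal{F},\epsilon)$, $P(T,\mathcal{F})=\lim_{\epsilon\to0}P(T,\mathcal{F},\epsilon)$. Average pseudo-orbits: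 for $\delta>0$ (and $n\ge2$), $X^n_\delta$ is the set of $(x_0,\ldots,x_{n-1})\in X^n$ with $\frac{1}{n-1}\sum_{i=0}^{n-2}d(Tx_i,x_{i+1})\le\delta$. For $\mu\in M(X,T)$ and a finite set $L\subset C(X)$, $X^n_{\delta,\mu,L}$ is the set of $(x_0,\ldots,x_{n-1})\in X^n_\delta$ with $\max_{g\in L}|\frac1n\sum_{i=0}^{n-1}g(x_i)-\int g\,d\mu|\le\delta$. Conventions: $\log0=-\infty$; an empty sum is $0$. Pressures of the block potential: a subset $E\subset X^n$ is $(n,\epsilon)$-separated if for any distinct $(x_i)_{i=0}^{n-1},(y_i)_{i=0}^{n-1}\in E$ there is $0\le i\le n-1$ with $d(x_i,y_i)>\epsilon$. Put $GP_{n,\delta}(T,\mathbf{F},\epsilon)=\sup\{\sum_{\mathbf{x}\in E}e^{\mathbf{f}_n(\mathbf{x})}: E\subset X^n_\delta \text{ is } (n,\epsilon)\text{-separated}\}$, $GP(T,\mathbf{F},\epsilon)=\inf_{\delta>0}\limsup_{n\to\infty}\frac1n\log GP_{n,\delta}(T,\mathbf{F},\epsilon)$ and $GP(T,\mathbf{F})=\lim_{\epsilon\to0}GP(T,\mathbf{F},\epsilon)$. Similarly $GP_{n,\delta,\mu,L}(T,\mathbf{F},\epsilon)=\sup\{\sum_{\mathbf{x}\in E}e^{\mathbf{f}_n(\mathbf{x})}: E\subset X^n_{\delta,\mu,L}\text{ is }(n,\epsilon)\text{-separated}\}$, $GP_\mu(T,\mathbf{F},\epsilon)=\inf_{L}\inf_{\delta>0}\limsup_{n\to\infty}\frac1n\log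 GP_{n,\delta,\mu,L}(T,\mathbf{F},\epsilon)$ ($L$ over finite subsets of $C(X)$) and $GP_\mu(T,\mathbf{F})=\lim_{\epsilon\to0}GP_\mu(T,\mathbf{F},\epsilon)$. *)

theory Defs
  imports "HOL-Probability.Probability"
begin

text \<open>The phase space \<open>X\<close> is the universe of a metric-space type, its metric is \<^const>\<open>dist\<close>.\<close>

definition tds :: "('a::metric_space \<Rightarrow> 'a) \<Rightarrow> bool" where
  "tds T \<longleftrightarrow> compact (UNIV :: 'a set) \<and> continuous_on UNIV T \<and> surj T"

definition invariant_measures :: "('a::metric_space \<Rightarrow> 'a) \<Rightarrow> 'a measure set" where
  "invariant_measures T = {\<mu>. prob_space \<mu> \<and> sets \<mu> = sets borel \<and> distr \<mu> \<mu> T = \<mu>}"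

definition ergodic :: "('a::metric_space \<Rightarrow> 'a) \<Rightarrow> 'a measure \<Rightarrow> bool" where
  "ergodic T \<mu> \<longleftrightarrow> \<mu> \<in> invariant_measures T \<and>
     (\<forall>A \<in> sets \<mu>. T -` A = A \<longrightarrow> measure \<mu> A = 0 \<or> measure \<mu> A = 1)"


subsection \<open>Kolmogorov--Sinai entropy\<close>

definition finite_borel_partition :: "'a::topological_space set set \<Rightarrow> bool" where
  "finite_borel_partition P \<longleftrightarrow> finite P \<and> partition_on UNIV P \<and> P \<subseteq> sets borel"

text \<open>Here \<open>0 \<cdot> ln 0 = 0\<close>.\<close>

definition partition_entropy :: "'a measure \<Rightarrow> 'a set set \<Rightarrow> real" where
  "partition_entropy \<mu> P = - (\<Sum>A\<in>P. measure \<mu> A * ln (measure \<mu> A))"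

text \<open>The join of the partitions \<open>T\<^sup>-\<^sup>i P\<close>, \<open>0 \<le> i < n\<close>.\<close>

definition iterated_join :: "('a \<Rightarrow> 'a) \<Rightarrow> 'a set set \<Rightarrow> nat \<Rightarrow> 'a set set" where
  "iterated_join T P n = common_refinement ((\<lambda>i. (\<lambda>A. (T ^^ i) -` A) ` P) ` {..<n})"

definition entropy_wrt :: "('a \<Rightarrow> 'a) \<Rightarrow> 'a measure \<Rightarrow> 'a set set \<Rightarrow> ereal" where
  "entropy_wrt T \<mu> P = lim (\<lambda>n. ereal (partition_entropy \<mu> (iterated_join T P n) / real n))"

definition ks_entropy :: "('a::metric_space \<Rightarrow> 'a) \<Rightarrow> 'a measure \<Rightarrow> ereal" where
  "ks_entropy T \<mu> = (SUP P \<in> {P. finite_borel_partition P}. entropy_wrt T \<mu> P)"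


subsection \<open>Block sub-additive potentials\<close>

text \<open>
  A point \<open>(x\<^sub>0, \<dots>, x\<^bsub>n-1\<^esub>)\<close> of \<open>X\<^sup>n\<close> is a function on \<open>nat\<close> that is extensional on \<open>{..<n}\<close>, so that
  \<open>X\<^sup>n\<close> is the topspace of the product topology below. The value of a potential at
  index \<open>0\<close> is unconstrained and irrelevant.
\<close>

abbreviation tuples :: "nat \<Rightarrow> (nat \<Rightarrow> 'a) set" where
  "tuples n \<equiv> {..<n} \<rightarrow>\<^sub>E UNIV"

definition block_subadditive :: "(nat \<Rightarrow> (nat \<Rightarrow> 'a::metric_space) \<Rightarrow> real) \<Rightarrow> bool" where
  "block_subadditive F \<longleftrightarrow>
     (\<forall>n\<ge>1. continuous_map (product_topology (\<lambda>_. euclidean) {..<n}) euclideanreal (F n)) \<and>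
     (\<forall>n\<ge>1. \<forall>m\<ge>1. \<forall>x \<in> tuples (n + m).
        F (n + m) x \<le> F n (\<lambda>i\<in>{..<n}. x i) + F m (\<lambda>i\<in>{..<m}. x (n + i)))"

definition induced_potential ::
    "('a \<Rightarrow> 'a) \<Rightarrow> (nat \<Rightarrow> (nat \<Rightarrow> 'a) \<Rightarrow> real) \<Rightarrow> nat \<Rightarrow> 'a \<Rightarrow> real" where
  "induced_potential T F n x = F n (\<lambda>i\<in>{..<n}. (T ^^ i) x)"

text \<open>
  The limit exists in \<open>[-\<infinity>, \<infinity>)\<close> for sub-additive potentials and invariant \<open>\<mu>\<close>.
\<close>

definition asymptotic_mean :: "(nat \<Rightarrow> 'a \<Rightarrow> real) \<Rightarrow> 'a measure \<Rightarrow> ereal" where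
  "asymptotic_mean f \<mu> = lim (\<lambda>n. ereal ((\<integral>x. f n x \<partial>\<mu>) / real n))"


subsection \<open>Pressure\<close>

definition ext_ln :: "ereal \<Rightarrow> ereal" where
  "ext_ln x = (if x \<le> 0 then - \<infinity> else if x = \<infinity> then \<infinity> else ereal (ln (real_of_ereal x)))"

definition exp_growth :: "(nat \<Rightarrow> ereal) \<Rightarrow> ereal" where
  "exp_growth a = limsup (\<lambda>n. ext_ln (a n) / ereal (real n))"

definition separated :: "('a::metric_space \<Rightarrow> 'a) \<Rightarrow> nat \<Rightarrow> real \<Rightarrow> 'a set \<Rightarrow> bool" where
  "separated T n \<epsilon> E \<longleftrightarrow>
     (\<forall>x\<in>E. \<forall>y\<in>E. x \<noteq> y \<longrightarrow> (MAX i\<in>{..<n}. dist ((T ^^ i) x) ((T ^^ i) y)) > \<epsilon>)"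

text \<open>
  In a compact space all separated sets are finite (for \<open>n \<ge> 1\<close> and \<open>\<epsilon> > 0\<close>); \<^term>\<open>finite E\<close> in the suprema
  below is stated only because a sum over an infinite set is \<open>0\<close> by convention.
\<close>

definition P_n :: "('a::metric_space \<Rightarrow> 'a) \<Rightarrow> (nat \<Rightarrow> 'a \<Rightarrow> real) \<Rightarrow> real \<Rightarrow> nat \<Rightarrow> ereal" where
  "P_n T f \<epsilon> n = (SUP E \<in> {E. finite E \<and> separated T n \<epsilon> E}. ereal (\<Sum>x\<in>E. exp (f n x)))"

definition P_eps :: "('a::metric_space \<Rightarrow> 'a) \<Rightarrow> (nat \<Rightarrow> 'a \<Rightarrow> real) \<Rightarrow> real \<Rightarrow> ereal" where
  "P_eps T f \<epsilon> = exp_growth (P_n T f \<epsilon>)"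

definition pressure :: "('a::metric_space \<Rightarrow> 'a) \<Rightarrow> (nat \<Rightarrow> 'a \<Rightarrow> real) \<Rightarrow> ereal" where
  "pressure T f = Lim (at_right 0) (P_eps T f)"


subsection \<open>Pressure over average pseudo-orbits\<close>

definition pseudo_orbits :: "('a::metric_space \<Rightarrow> 'a) \<Rightarrow> real \<Rightarrow> nat \<Rightarrow> (nat \<Rightarrow> 'a) set" where
  "pseudo_orbits T \<delta> n =
     {x \<in> tuples n. (\<Sum>i<n - 1. dist (T (x i)) (x (i + 1))) / real (n - 1) \<le> \<delta>}"

definition pseudo_orbits_at ::
    "('a::metric_space \<Rightarrow> 'a) \<Rightarrow> real \<Rightarrow> 'a measure \<Rightarrow> ('a \<Rightarrow> real) set \<Rightarrow> nat \<Rightarrow> (nat \<Rightarrow> 'a) set" where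
  "pseudo_orbits_at T \<delta> \<mu> L n =
     {x \<in> pseudo_orbits T \<delta> n. \<forall>g\<in>L. \<bar>(\<Sum>i<n. g (x i)) / real n - (\<integral>y. g y \<partial>\<mu>)\<bar> \<le> \<delta>}"

definition separated_tuples :: "nat \<Rightarrow> real \<Rightarrow> (nat \<Rightarrow> 'a::metric_space) set \<Rightarrow> bool" where
  "separated_tuples n \<epsilon> E \<longleftrightarrow>
     (\<forall>x\<in>E. \<forall>y\<in>E. x \<noteq> y \<longrightarrow> (\<exists>i<n. dist (x i) (y i) > \<epsilon>))"

definition sup_exp_sum ::
    "(nat \<Rightarrow> (nat \<Rightarrow> 'a::metric_space) \<Rightarrow> real) \<Rightarrow> real \<Rightarrow> nat \<Rightarrow> (nat \<Rightarrow> 'a) set \<Rightarrow> ereal" where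
  "sup_exp_sum F \<epsilon> n Y =
     (SUP E \<in> {E. finite E \<and> E \<subseteq> Y \<and> separated_tuples n \<epsilon> E}. ereal (\<Sum>x\<in>E. exp (F n x)))"

definition GP_eps ::
    "('a::metric_space \<Rightarrow> 'a) \<Rightarrow> (nat \<Rightarrow> (nat \<Rightarrow> 'a) \<Rightarrow> real) \<Rightarrow> real \<Rightarrow> ereal" where
  "GP_eps T F \<epsilon> =
     (INF \<delta>\<in>{0<..}. exp_growth (\<lambda>n. sup_exp_sum F \<epsilon> n (pseudo_orbits T \<delta> n)))"

definition GP :: "('a::metric_space \<Rightarrow> 'a) \<Rightarrow> (nat \<Rightarrow> (nat \<Rightarrow> 'a) \<Rightarrow> real) \<Rightarrow> ereal" where
  "GP T F = Lim (at_right 0) (GP_eps T F)"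

definition GP_at_eps ::
    "('a::metric_space \<Rightarrow> 'a) \<Rightarrow> (nat \<Rightarrow> (nat \<Rightarrow> 'a) \<Rightarrow> real) \<Rightarrow> 'a measure \<Rightarrow> real \<Rightarrow> ereal" where
  "GP_at_eps T F \<mu> \<epsilon> =
     (INF L \<in> {L. finite L \<and> (\<forall>g\<in>L. continuous_on UNIV g)}. INF \<delta>\<in>{0<..}.
        exp_growth (\<lambda>n. sup_exp_sum F \<epsilon> n (pseudo_orbits_at T \<delta> \<mu> L n)))"

definition GP_at ::
    "('a::metric_space \<Rightarrow> 'a) \<Rightarrow> (nat \<Rightarrow> (nat \<Rightarrow> 'a) \<Rightarrow> real) \<Rightarrow> 'a measure \<Rightarrow> ereal" where
  "GP_at T F \<mu> = Lim (at_right 0) (GP_at_eps T F \<mu>)"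

end

theory Submission
  imports Defs
begin

text \<open>
  Both bounds rest on the Gibbs inequality \<open>\<Sum> p (s - ln p) \<le> ln \<Sum> exp s\<close>, which is an equality
  for the Gibbs weights \<open>p \<propto> exp s\<close>.

  Upper bounds (Misiurewicz): put Gibbs weights on an \<open>\<epsilon>\<close>-separated set of average pseudo-orbits
  whose empirical measures converge to \<open>\<mu>\<close>. Since the pseudo-orbit error tends to \<open>0\<close>, the averaged
  distribution of \<open>q\<close>-blocks converges to the distribution of \<open>(x, T x, \<dots>, T\<^bsup>q-1\<^esup> x)\<close> under \<open>\<mu>\<close>; cutting
  long blocks into \<open>q\<close>-blocks bounds the growth rate by \<open>(H\<^sub>\<mu>(\<xi>\<^sup>q) + \<integral> f\<^sub>q d\<mu>) / q\<close> for a partition \<open>\<xi>\<close> into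
  small continuity sets. For \<open>GP\<^sub>\<mu>\<close> the convergence is forced by the definition; for \<open>GP\<close> it comes from
  weak compactness, and the limit is invariant because the error vanishes.

  Lower bounds: given sets \<open>G\<^sub>n\<close> with \<open>\<mu>(G\<^sub>n) \<rightarrow> 1\<close>, choose one point of \<open>G\<^sub>n\<close> in each cell of \<open>\<xi>\<^sup>n\<close>.
  Points whose orbits mostly stay in compact cores of the cells can fail to be separated only when
  their itineraries are Hamming-close, so a greedy choice loses only a factor of arbitrarily
  small exponential rate.
  With \<open>G\<^sub>n = X\<close> this bounds the pressure; with \<open>G\<^sub>n\<close> given by the ergodic theorem it bounds
  \<open>GP\<^sub>\<mu>\<close>, and neither the Shannon--McMillan--Breiman theorem nor passing to powers of \<open>T\<close> is needed.
\<close>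

subsection \<open>Subadditive sequences and arrays\<close>

text \<open>Under Gibbs weights a random pseudo-orbit is neither an orbit nor stationary, so no
  invariant quantity is at hand before the limit. Word entropy and expected potential are therefore
  joined in one array indexed by starting position and length, which is subadditive without
  stationarity. Weak convergence only tests continuous functions, so the cells must be continuity
  sets of \<mu>, and the partition can be chosen only once \<mu> is known. The infimum over finite
  sets of test functions in \<open>GP_at\<close> is directed but has no sequence built in; hence
  limits run along a filter.

  In the lower bounds the obstacle is that distinct cells may touch, so that different itineraries
  need not give separated points. Closed cores have a uniform distance, at the price of a small rate
  of uncontrolled times. The only lower input on entropy is that Fekete limits are infima: entropy
  and mean of length n are at least n times their rates, at every n. Finiteness of the mean keeps
  the sum of the two rates free of infinity minus infinity.\<close>

lemma fekete:
  fixes u :: "nat \<Rightarrow> real"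
  assumes sub: "\<And>m n. m \<ge> 1 \<Longrightarrow> n \<ge> 1 \<Longrightarrow> u (m + n) \<le> u m + u n"
  shows "(\<lambda>n. ereal (u n / real n)) \<longlonglongrightarrow> (INF n\<in>{1..}. ereal (u n / real n))" (is "?v \<longlonglongrightarrow> ?I")
proof -
  \<comment> \<open>The remainder is kept in \<open>1..q\<close> instead of \<open>0..q-1\<close>,
    since subadditivity is available only for positive arguments.\<close>
  have mult: "u (t * q + r) \<le> real t * u q + u r" if "q \<ge> 1" "r \<ge> 1" for t q r
  proof (induction t)
    case (Suc t)
    have "u (Suc t * q + r) = u (q + (t * q + r))" by (simp add: algebra_simps)
    also have "\<dots> \<le> u q + u (t * q + r)" using that by (intro sub) auto
    finally show ?case using Suc by (simp add: algebra_simps)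
  qed auto
  have ev: "eventually (\<lambda>n. ?v n < c) sequentially" if lt: "?I < c" for c
  proof -
    obtain q where q: "q \<ge> 1" "?v q < c" using lt unfolding INF_less_iff by auto
    obtain b where b: "?v q < ereal b" "ereal b < c" using ereal_dense2[OF q(2)] by auto
    \<comment> \<open>An upper bound, independent of \<open>n\<close>, for all values
      \<open>u r - r * (u q / q)\<close> with \<open>r\<close> in \<open>1..q\<close>.\<close>
    define C where "C = (MAX r\<in>{1..q}. u r) - (MIN r\<in>{1..q}. real r * (u q / q))"
    have bnd: "u n \<le> real n * (u q / q) + C" if "n \<ge> 1" for n
    proof -
      define t r where "t = (n - 1) div q" and "r = (n - 1) mod q + 1"
      have n: "n = t * q + r" using that div_mult_mod_eq[of "n - 1" q] by (simp add: t_def r_def)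
      have r: "r \<in> {1..q}" using q(1) by (simp add: r_def Suc_le_eq)
      have "u n \<le> real t * u q + u r" unfolding n using r q by (intro mult) auto
      also have "u r \<le> (MAX r\<in>{1..q}. u r)" using r by (intro Max_ge) auto
      also have "real t * u q = real n * (u q / q) - real r * (u q / q)"
        using q(1) by (simp add: n field_simps)
      also have "\<dots> \<le> real n * (u q / q) - (MIN r\<in>{1..q}. real r * (u q / q))"
        using r by (intro diff_left_mono Min_le) auto
      finally show ?thesis by (simp add: C_def)
    qed
    have "(\<lambda>n. u q / q + C / real n) \<longlonglongrightarrow> u q / q + 0"
      by (intro tendsto_add tendsto_const lim_const_over_n)
    then have "eventually (\<lambda>n. u q / q + C / real n < b) sequentially"
      using b(1) by (intro order_tendstoD(2)) auto
    then show ?thesis using eventually_ge_at_top[of 1]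
    proof eventually_elim
      case (elim n)
      have "u n / n \<le> u q / q + C / n" using bnd[OF elim(2)] elim(2) by (simp add: field_simps)
      then show ?case using elim(1) b(2) by (meson ereal_less_eq(3) le_less_trans less_ereal.simps(1) less_trans)
    qed
  qed
  show ?thesis
  proof (rule order_tendstoI)
    fix a assume "a < ?I"
    then have "a < ?v n" if "n \<ge> 1" for n using that by (meson INF_lower atLeast_iff less_le_trans)
    then show "eventually (\<lambda>n. a < ?v n) sequentially"
      unfolding eventually_sequentially by blast
  qed (use ev in auto)
qed

text \<open>
  Cut \<open>[0, n)\<close> into blocks of length \<open>q\<close> starting at \<open>r < q\<close>, and sum over the \<open>q\<close> offsets \<open>r\<close>:
  every block \<open>[j, j + q)\<close> occurs once.
\<close>

lemma subadditive_array_blocks: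
  fixes u :: "nat \<Rightarrow> nat \<Rightarrow> real"
  assumes sub: "\<And>j l l'. l \<ge> 1 \<Longrightarrow> l' \<ge> 1 \<Longrightarrow> u j (l + l') \<le> u j l + u (j + l) l'"
    and one: "\<And>j. u j 1 \<le> C" and C: "C \<ge> 0" and q: "q \<ge> 1" and n: "n \<ge> q"
  shows "real q * u 0 n \<le> (\<Sum>j<n - q + 1. u j q) + 2 * (real q)^2 * C"
proof -
  \<comment> \<open>Length 0 gets the value 0, so that an empty prefix or an empty remainder needs
    no separate case.\<close>
  define v where "v j l = (if l = 0 then 0 else u j l)" for j l
  have vsub: "v j (l + l') \<le> v j l + v (j + l) l'" for j l l' using sub by (auto simp: v_def)
  have vC: "v j l \<le> real l * C" for j l
  proof (induction l)
    case (Suc l)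
    have "v j (Suc l) \<le> v j l + v (j + l) 1" using vsub[of j l 1] by simp
    then show ?case using Suc one[of "j + l"] by (auto simp: v_def algebra_simps)
  qed (simp add: v_def)
  define B where "B r = {j. j < n - q + 1 \<and> j mod q = r}" for r
  have main: "v 0 n \<le> (\<Sum>j\<in>B r. v j q) + 2 * real q * C" if r: "r < q" for r
  proof -
    define m where "m = (n - r) div q"
    define s where "s = (n - r) mod q"
    have nn: "n = r + m * q + s" using n r div_mult_mod_eq[of "n - r" q] by (simp add: m_def s_def)
    have s: "s < q" using q by (simp add: s_def)
    have "v 0 (r + m' * q) \<le> real r * C + (\<Sum>t<m'. v (r + t * q) q)" for m'
    proof (induction m')
      case (Suc m')
      have "v 0 (r + Suc m' * q) \<le> v 0 (r + m' * q) + v (r + m' * q) q"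
        using vsub[of 0 "r + m' * q" q] by (simp add: algebra_simps)
      then show ?case using Suc by simp
    qed (use vC[of 0 r] in simp)
    from this[of m] have "v 0 n \<le> real r * C + (\<Sum>t<m. v (r + t * q) q) + real s * C"
      using vsub[of 0 "r + m * q" s] vC[of "r + m * q" s] by (simp add: nn)
    moreover have "(\<Sum>t<m. v (r + t * q) q) = (\<Sum>j\<in>B r. v j q)"
    proof (rule sum.reindex_bij_witness[of _ "\<lambda>j. j div q" "\<lambda>t. r + t * q"])
      fix j assume j: "j \<in> B r"
      then have je: "j = r + (j div q) * q"
        unfolding B_def using div_mult_mod_eq[of j q] by simp
      then show "r + j div q * q = j" by simp
      show "j div q \<in> {..<m}"
      proof (rule ccontr)
        assume "j div q \<notin> {..<m}"
        then have "m * q \<le> j div q * q" by simp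
        then have "j \<ge> r + m * q" using je by linarith
        moreover have "j + q < n + 1" using j n unfolding B_def by simp linarith
        ultimately show False using s nn by linarith
      qed
    next
      fix t assume t: "t \<in> {..<m}"
      show "(r + t * q) div q = t" using r by simp
      have "(t + 1) * q \<le> m * q" using t by (intro mult_right_mono) auto
      then have "r + t * q < n - q + 1" using nn n by (simp add: algebra_simps)
      then show "r + t * q \<in> B r" using r by (simp add: B_def)
    qed auto
    \<comment> \<open>Prefix and remainder are both shorter than \<open>q\<close> and cost at most
      \<open>C\<close> per position; summing over the offsets produces the square of
      \<open>q\<close>.\<close>
    moreover have "real r * C + real s * C \<le> 2 * real q * C"
      using mult_right_mono[of "real r + real s" "2 * real q" C] r s C by (simp add: algebra_simps)
    ultimately show ?thesis by linarith
  qed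
  have "real q * v 0 n = (\<Sum>r<q. v 0 n)" by simp
  also have "\<dots> \<le> (\<Sum>r<q. (\<Sum>j\<in>B r. v j q) + 2 * real q * C)" by (intro sum_mono main) auto
  also have "\<dots> = (\<Sum>r<q. \<Sum>j\<in>B r. v j q) + 2 * (real q)^2 * C"
    by (simp add: sum.distrib power2_eq_square)
  also have "(\<Sum>r<q. \<Sum>j\<in>B r. v j q) = (\<Sum>j<n - q + 1. v j q)"
    unfolding B_def using sum.group[of "{..<n - q + 1}" "{..<q}" "\<lambda>j. j mod q" "\<lambda>j. v j q"] q
    by (simp add: image_subset_iff)
  finally show ?thesis using q n by (simp add: v_def)
qed

subsection \<open>Entropy of finite-valued functions\<close>

definition eta :: "real \<Rightarrow> real" where "eta x = - x * ln x"

lemma eta_0 [simp]: "eta 0 = 0" and eta_1 [simp]: "eta 1 = 0"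
  by (simp_all add: eta_def)

text \<open>Concavity: the right side is the tangent of \<open>eta\<close> at \<open>y\<close>.
  Jensen's inequality, the Gibbs inequality and the subadditivity of entropy each come from a
  particular choice of \<open>y\<close>.\<close>

lemma eta_le_tangent:
  assumes "x \<ge> 0" "y > 0"
  shows "eta x \<le> - x * ln y + (y - x)"
proof (cases "x = 0")
  case False
  then have "x > 0" using assms by simp
  have "ln (y / x) \<le> y / x - 1" using \<open>x > 0\<close> assms by (intro ln_le_minus_one) auto
  then have "x * (ln y - ln x) \<le> x * (y / x - 1)"
    using \<open>x > 0\<close> assms by (intro mult_left_mono) (auto simp: ln_div)
  then show ?thesis using \<open>x > 0\<close> by (simp add: eta_def algebra_simps)
qed (use assms in auto)

lemma eta_le_1: "x \<ge> 0 \<Longrightarrow> eta x \<le> 1 - x"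
  using eta_le_tangent[of x 1] by simp

lemma eta_nonneg: "0 \<le> x \<Longrightarrow> x \<le> 1 \<Longrightarrow> eta x \<ge> 0"
  by (cases "x = 0") (auto simp: eta_def mult_nonneg_nonpos)

text \<open>Cutting an atom in two does not lower the entropy, because the logarithm is increasing.
  It later splits each cell along a set \<open>G\<close> of large measure.\<close>

lemma eta_add_le:
  assumes "x \<ge> 0" "y \<ge> 0" shows "eta (x + y) \<le> eta x + eta y"
proof -
  have *: "a * ln a \<le> a * ln (a + b)" if "a \<ge> 0" "b \<ge> 0" for a b :: real
    using that by (cases "a = 0") (auto intro!: mult_left_mono)
  have "x * ln x \<le> x * ln (x + y)" "y * ln y \<le> y * ln (x + y)"
    using *[of x y] *[of y x] assms by (simp_all add: add.commute)
  then show ?thesis by (simp add: eta_def algebra_simps)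
qed

lemma continuous_on_eta: "continuous_on {0..} eta"
proof -
  have *: "((\<lambda>x. eta x) \<longlongrightarrow> 0) (at_right (0::real))"
  proof (rule tendsto_sandwich[where f = "\<lambda>_. 0" and h = "\<lambda>x. 2 * sqrt x"])
    show "eventually (\<lambda>x. 0 \<le> eta x) (at_right 0)"
      by (intro eventually_at_rightI[of 0 1]) (auto intro: eta_nonneg)
    show "eventually (\<lambda>x. eta x \<le> 2 * sqrt x) (at_right 0)"
    proof (intro eventually_at_rightI[of 0 1])
      fix x :: real assume x: "x \<in> {0<..<1}"
      \<comment> \<open>The logarithmic bound at \<open>1 / sqrt x\<close> instead of
        \<open>1 / x\<close> gives growth of order \<open>1 / sqrt x\<close> only, which the factor
        \<open>x\<close> still beats.\<close>
      have "ln (1 / sqrt x) \<le> 1 / sqrt x - 1" using x by (intro ln_le_minus_one) auto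
      then have "- ln x \<le> 2 / sqrt x" using x by (simp add: ln_div ln_sqrt)
      then have "x * (- ln x) \<le> x * (2 / sqrt x)" using x by (intro mult_left_mono) auto
      also have "\<dots> = 2 * sqrt x" using x by (simp add: field_simps)
      finally show "eta x \<le> 2 * sqrt x" by (simp add: eta_def)
    qed auto
    show "((\<lambda>x. 2 * sqrt x) \<longlongrightarrow> 0) (at_right 0)"
      by (rule tendsto_eq_intros refl | simp)+
  qed auto
  show ?thesis unfolding continuous_on_def
  proof
    fix x :: real assume "x \<in> {0..}"
    show "(eta \<longlongrightarrow> eta x) (at x within {0..})"
    proof (cases "x = 0")
      case True
      then show ?thesis using * by (simp add: at_within_Ici_at_right)
    next
      case False
      then have "x > 0" using \<open>x \<in> {0..}\<close> by simp
      have "isCont (\<lambda>x. - x * ln x) x" using \<open>x > 0\<close> by (intro continuous_intros) auto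
      then show ?thesis unfolding eta_def[abs_def] isCont_def
        by (rule tendsto_within_subset) auto
    qed
  qed
qed

lemma eta_tendsto:
  assumes "(p \<longlongrightarrow> x) K" "eventually (\<lambda>i. p i \<ge> 0) K" "x \<ge> 0"
  shows "((\<lambda>i. eta (p i)) \<longlongrightarrow> eta x) K"
  by (rule continuous_on_tendsto_compose[OF continuous_on_eta assms(1)]) (use assms in auto)

text \<open>Tangents at the mean \<open>A\<close>, whose linear terms cancel in the sum; at 0 there
  is no tangent, so \<open>A = 0\<close> is treated apart. It serves to pass from an average of
  block entropies over positions to the entropy of the averaged block law.\<close>

lemma eta_jensen:
  assumes "finite J" "J \<noteq> {}" "\<And>j. j \<in> J \<Longrightarrow> a j \<ge> 0"
  shows "(\<Sum>j\<in>J. eta (a j)) \<le> real (card J) * eta ((\<Sum>j\<in>J. a j) / real (card J))"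
proof -
  define A where "A = (\<Sum>j\<in>J. a j) / card J"
  have c: "real (card J) > 0" using assms by (simp add: card_gt_0_iff)
  have "A \<ge> 0" using assms(3) by (auto simp: A_def intro!: divide_nonneg_nonneg sum_nonneg)
  show ?thesis
  proof (cases "A = 0")
    case True
    then have "(\<Sum>j\<in>J. a j) = 0" using c by (simp add: A_def)
    then have "\<forall>j\<in>J. a j = 0" using assms by (simp add: sum_nonneg_eq_0_iff)
    then show ?thesis using True by (simp add: A_def[symmetric])
  next
    case False
    then have "A > 0" using \<open>A \<ge> 0\<close> by simp
    have "(\<Sum>j\<in>J. eta (a j)) \<le> (\<Sum>j\<in>J. - a j * ln A + (A - a j))"
      using assms \<open>A > 0\<close> by (intro sum_mono eta_le_tangent) auto
    also have "\<dots> = - (\<Sum>j\<in>J. a j) * ln A + (card J * A - (\<Sum>j\<in>J. a j))"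
      by (simp add: sum.distrib sum_subtractf sum_distrib_right sum_negf)
    also have "(\<Sum>j\<in>J. a j) = card J * A" using c by (simp add: A_def)
    finally show ?thesis by (simp add: A_def[symmetric] eta_def)
  qed
qed

text \<open>The weights may have any total mass \<open>g\<close>: comparison with
  \<open>g * exp (s i) / Z\<close>, of the same mass, cancels the linear terms and leaves
  \<open>eta g\<close>. Weights of mass below 1 occur when a measure is restricted to a set;
  \<open>s = 0\<close> bounds entropy by the logarithm of the number of values.\<close>

lemma gibbs_inequality:
  assumes "finite I" "\<And>i. i \<in> I \<Longrightarrow> p i \<ge> 0"
  shows "(\<Sum>i\<in>I. eta (p i) + p i * s i) \<le> eta (\<Sum>i\<in>I. p i) + (\<Sum>i\<in>I. p i) * ln (\<Sum>i\<in>I. exp (s i))"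
proof (cases "(\<Sum>i\<in>I. p i) = 0")
  case True
  then have "\<forall>i\<in>I. p i = 0" using assms by (simp add: sum_nonneg_eq_0_iff)
  then show ?thesis by simp
next
  case False
  define g where "g = (\<Sum>i\<in>I. p i)"
  have g: "g > 0" using False sum_nonneg[of I p] assms by (simp add: g_def less_le)
  have "I \<noteq> {}" using False by auto
  define Z where "Z = (\<Sum>i\<in>I. exp (s i))"
  have Z: "Z > 0" using assms \<open>I \<noteq> {}\<close> by (auto simp: Z_def intro!: sum_pos)
  have "(\<Sum>i\<in>I. eta (p i) + p i * s i) \<le> (\<Sum>i\<in>I. - p i * ln (g * exp (s i) / Z) + (g * exp (s i) / Z - p i) + p i * s i)"
    using assms g Z by (intro sum_mono add_right_mono eta_le_tangent) auto
  also have "\<dots> = (\<Sum>i\<in>I. p i * (ln Z - ln g) + (g / Z * exp (s i) - p i))"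
    using g Z by (intro sum.cong) (auto simp: ln_div ln_mult algebra_simps)
  also have "\<dots> = g * (ln Z - ln g) + (g / Z * Z - g)"
    unfolding sum.distrib sum_subtractf sum_distrib_right[symmetric] sum_distrib_left[symmetric]
    by (simp add: g_def Z_def)
  also have "\<dots> = eta g + g * ln Z" using Z by (simp add: eta_def algebra_simps)
  finally show ?thesis by (simp add: g_def Z_def)
qed

section \<open>Shannon entropy of finite-valued maps and of words\<close>

definition Hent :: "'m measure \<Rightarrow> 'c set \<Rightarrow> ('m \<Rightarrow> 'c) \<Rightarrow> real" where
  "Hent M C \<phi> = (\<Sum>c\<in>C. eta (measure M {\<omega>. \<phi> \<omega> = c}))"

text \<open>The symbols may form a non-stationary process, so that one theory serves both for the
  cells met by a random tuple and for itineraries under an invariant measure.\<close>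

definition word :: "(nat \<Rightarrow> 'm \<Rightarrow> 's) \<Rightarrow> nat \<Rightarrow> nat \<Rightarrow> 'm \<Rightarrow> nat \<Rightarrow> 's" where
  "word c j l \<omega> = (\<lambda>i\<in>{..<l}. c (j + i) \<omega>)"

abbreviation words :: "nat \<Rightarrow> 's set \<Rightarrow> (nat \<Rightarrow> 's) set" where
  "words l S \<equiv> {..<l} \<rightarrow>\<^sub>E S"

definition word_entropy :: "'m measure \<Rightarrow> 's set \<Rightarrow> (nat \<Rightarrow> 'm \<Rightarrow> 's) \<Rightarrow> nat \<Rightarrow> nat \<Rightarrow> real" where
  "word_entropy M S c j l = Hent M (words l S) (word c j l)"

lemma word_in_words: "(\<And>i. range (c i) \<subseteq> S) \<Longrightarrow> word c j l \<omega> \<in> words l S"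
  by (auto simp: word_def)

lemma word_eq_iff: "w \<in> words l S \<Longrightarrow> word c j l \<omega> = w \<longleftrightarrow> (\<forall>i<l. c (j + i) \<omega> = w i)"
  by (auto simp: word_def PiE_def extensional_def fun_eq_iff restrict_def)

locale full_prob_space = prob_space M for M :: "'m measure" +
  assumes space_UNIV [simp]: "space M = UNIV"
begin

lemma sum_fibres:
  assumes "finite C" "range \<phi> \<subseteq> C" "\<And>c. c \<in> C \<Longrightarrow> {\<omega>. \<phi> \<omega> = c} \<in> sets M" "A \<in> sets M"
  shows "(\<Sum>c\<in>C. measure M (A \<inter> {\<omega>. \<phi> \<omega> = c})) = measure M A"
proof -
  have "A = (\<Union>c\<in>C. A \<inter> {\<omega>. \<phi> \<omega> = c})" using assms(2) by auto
  then have "measure M A = measure M (\<Union>c\<in>C. A \<inter> {\<omega>. \<phi> \<omega> = c})" by simp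
  also have "\<dots> = (\<Sum>c\<in>C. measure M (A \<inter> {\<omega>. \<phi> \<omega> = c}))"
    using assms by (intro finite_measure_finite_Union) (auto simp: disjoint_family_on_def)
  finally show ?thesis by simp
qed

lemma sum_fibres_UNIV:
  assumes "finite C" "range \<phi> \<subseteq> C" "\<And>c. c \<in> C \<Longrightarrow> {\<omega>. \<phi> \<omega> = c} \<in> sets M"
  shows "(\<Sum>c\<in>C. measure M {\<omega>. \<phi> \<omega> = c}) = 1"
  using sum_fibres[OF assms, of UNIV] sets.top[of M] prob_space by simp

lemma Hent_le_ln_card:
  assumes "finite C" "range \<phi> \<subseteq> C" "\<And>c. c \<in> C \<Longrightarrow> {\<omega>. \<phi> \<omega> = c} \<in> sets M"
  shows "Hent M C \<phi> \<le> ln (card C)"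
  using gibbs_inequality[of C "\<lambda>c. measure M {\<omega>. \<phi> \<omega> = c}" "\<lambda>_. 0"] assms sum_fibres_UNIV[OF assms]
  by (simp add: Hent_def)

lemma Hent_nonneg: "Hent M C \<phi> \<ge> 0"
  unfolding Hent_def by (intro sum_nonneg eta_nonneg) auto

lemma fibre_of_image:
  assumes "finite C" "range \<phi> \<subseteq> C" "\<And>c. c \<in> C \<Longrightarrow> {\<omega>. \<phi> \<omega> = c} \<in> sets M"
  shows "{\<omega>. h (\<phi> \<omega>) = x} \<in> sets M"
    and "measure M {\<omega>. h (\<phi> \<omega>) = x} = (\<Sum>c\<in>{c\<in>C. h c = x}. measure M {\<omega>. \<phi> \<omega> = c})"
proof -
  have *: "{\<omega>. h (\<phi> \<omega>) = x} = (\<Union>c\<in>{c\<in>C. h c = x}. {\<omega>. \<phi> \<omega> = c})" using assms(2) by auto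
  show "{\<omega>. h (\<phi> \<omega>) = x} \<in> sets M" unfolding * using assms by (intro sets.finite_UN) auto
  show "measure M {\<omega>. h (\<phi> \<omega>) = x} = (\<Sum>c\<in>{c\<in>C. h c = x}. measure M {\<omega>. \<phi> \<omega> = c})"
    unfolding * using assms by (intro finite_measure_finite_Union) (auto simp: disjoint_family_on_def)
qed

text \<open>The law \<open>p\<close> is compared with the product \<open>q\<close> of its two
  marginals, by tangents of \<open>eta\<close> at \<open>q c\<close>. Injectivity of the pair of
  maps makes the total mass of \<open>q\<close> over \<open>C\<close> at most 1, so the linear terms
  contribute nothing positive.\<close>

lemma Hent_subadditive:
  assumes C: "finite C" "range \<phi> \<subseteq> C" "\<And>c. c \<in> C \<Longrightarrow> {\<omega>. \<phi> \<omega> = c} \<in> sets M"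
    and A: "finite A" "a ` C \<subseteq> A" and B: "finite B" "b ` C \<subseteq> B"
    and inj: "inj_on (\<lambda>c. (a c, b c)) C"
  shows "Hent M C \<phi> \<le> Hent M A (\<lambda>\<omega>. a (\<phi> \<omega>)) + Hent M B (\<lambda>\<omega>. b (\<phi> \<omega>))"
proof -
  define p where "p c = measure M {\<omega>. \<phi> \<omega> = c}" for c
  note meas = fibre_of_image(1)[OF C] and marg = fibre_of_image(2)[OF C, folded p_def]
  define pa where "pa x = measure M {\<omega>. a (\<phi> \<omega>) = x}" for x
  define pb where "pb x = measure M {\<omega>. b (\<phi> \<omega>) = x}" for x
  have p0: "p c \<ge> 0" for c by (simp add: p_def)
  have pap: "p c \<le> pa (a c)" "p c \<le> pb (b c)" if "c \<in> C" for c
    unfolding pa_def pb_def p_def by (intro finite_measure_mono meas; auto)+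
  define q where "q c = pa (a c) * pb (b c)" for c
  have q0: "q c \<ge> 0" for c by (simp add: q_def pa_def pb_def)
  have "(\<Sum>c\<in>C. q c) = (\<Sum>z\<in>(\<lambda>c. (a c, b c)) ` C. pa (fst z) * pb (snd z))"
    using inj by (subst sum.reindex) (auto simp: q_def)
  also have "\<dots> \<le> (\<Sum>z\<in>A \<times> B. pa (fst z) * pb (snd z))"
    using A B by (intro sum_mono2) (auto simp: pa_def pb_def)
  also have "\<dots> = (\<Sum>x\<in>A. pa x) * (\<Sum>y\<in>B. pb y)"
    by (simp add: sum_product sum.cartesian_product case_prod_beta)
  also have "(\<Sum>x\<in>A. pa x) = 1" unfolding pa_def using A C(2) by (intro sum_fibres_UNIV meas) auto
  also have "(\<Sum>x\<in>B. pb x) = 1" unfolding pb_def using B C(2) by (intro sum_fibres_UNIV meas) auto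
  finally have q1: "(\<Sum>c\<in>C. q c) \<le> 1" by simp
  \<comment> \<open>Where \<open>p c\<close> is positive, so are both marginals, which dominate it;
    there the logarithm of the product splits.\<close>
  have "eta (p c) \<le> - p c * ln (pa (a c)) - p c * ln (pb (b c)) + (q c - p c)" if "c \<in> C" for c
  proof (cases "p c = 0")
    case False
    then have "p c > 0" using p0[of c] by linarith
    then have "pa (a c) > 0" "pb (b c) > 0" using pap[OF that] by linarith+
    then show ?thesis using eta_le_tangent[of "p c" "q c"] p0 by (simp add: q_def ln_mult algebra_simps)
  qed (use q0 in simp)
  then have "Hent M C \<phi> \<le> (\<Sum>c\<in>C. - p c * ln (pa (a c)) - p c * ln (pb (b c)) + (q c - p c))"
    unfolding Hent_def p_def[symmetric] by (intro sum_mono) auto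
  also have "\<dots> = (\<Sum>c\<in>C. - p c * ln (pa (a c))) + (\<Sum>c\<in>C. - p c * ln (pb (b c))) + ((\<Sum>c\<in>C. q c) - (\<Sum>c\<in>C. p c))"
    by (simp add: sum.distrib sum_subtractf sum_negf)
  also have "(\<Sum>c\<in>C. p c) = 1" unfolding p_def using C by (rule sum_fibres_UNIV)
  also have "(\<Sum>c\<in>C. - p c * ln (pa (a c))) = (\<Sum>x\<in>A. \<Sum>c\<in>{c\<in>C. a c = x}. - p c * ln (pa (a c)))"
    using A C by (subst sum.group) auto
  also have "\<dots> = Hent M A (\<lambda>\<omega>. a (\<phi> \<omega>))"
    unfolding Hent_def pa_def[symmetric]
    by (intro sum.cong refl) (simp add: eta_def pa_def marg sum_distrib_right sum_negf)
  also have "(\<Sum>c\<in>C. - p c * ln (pb (b c))) = (\<Sum>x\<in>B. \<Sum>c\<in>{c\<in>C. b c = x}. - p c * ln (pb (b c)))"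
    using B C by (subst sum.group) auto
  also have "\<dots> = Hent M B (\<lambda>\<omega>. b (\<phi> \<omega>))"
    unfolding Hent_def pb_def[symmetric]
    by (intro sum.cong refl) (simp add: eta_def pb_def marg sum_distrib_right sum_negf)
  finally show ?thesis using q1 by simp
qed

end

locale symbolic_process = full_prob_space M for M :: "'m measure" +
  fixes S :: "'s set" and c :: "nat \<Rightarrow> 'm \<Rightarrow> 's"
  assumes finite_S: "finite S" and range_c: "range (c i) \<subseteq> S"
    and measurable_c: "s \<in> S \<Longrightarrow> {\<omega>. c i \<omega> = s} \<in> sets M"
begin

lemma finite_words [simp]: "finite (words l S)"
  using finite_S by (intro finite_PiE) auto

lemma S_nonempty: "S \<noteq> {}" using range_c by fastforce

lemma word_range: "range (word c j l) \<subseteq> words l S"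
  using word_in_words[of c S, OF range_c] by auto

lemma measurable_word:
  assumes "w \<in> words l S" shows "{\<omega>. word c j l \<omega> = w} \<in> sets M"
proof -
  have "{\<omega>. word c j l \<omega> = w} = (\<Inter>i\<in>{..<l}. {\<omega>. c (j + i) \<omega> = w i}) \<inter> space M"
    by (auto simp: word_eq_iff[OF assms] set_eq_iff)
  moreover have "{\<omega>. c (j + i) \<omega> = w i} \<in> sets M" if "i < l" for i
    using measurable_c[of "w i" "j + i"] PiE_mem[OF assms, of i] that by simp
  ultimately show ?thesis
    by (cases "l = 0") (use sets.top[of M] in \<open>auto intro!: sets.Int sets.finite_INT\<close>)
qed

text \<open>A word is determined by its prefix and its suffix. Without stationarity the starting
  time \<open>j + l\<close> of the suffix cannot be dropped.\<close>

lemma word_entropy_subadditive: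
  "word_entropy M S c j (l + l') \<le> word_entropy M S c j l + word_entropy M S c (j + l) l'"
proof -
  define a :: "(nat \<Rightarrow> 's) \<Rightarrow> nat \<Rightarrow> 's" where "a w = (\<lambda>i\<in>{..<l}. w i)" for w
  define b :: "(nat \<Rightarrow> 's) \<Rightarrow> nat \<Rightarrow> 's" where "b w = (\<lambda>i\<in>{..<l'}. w (l + i))" for w
  have "inj_on (\<lambda>w. (a w, b w)) (words (l + l') S)"
  proof (rule inj_onI)
    fix w v assume w: "w \<in> words (l + l') S" and v: "v \<in> words (l + l') S"
      and eq: "(a w, b w) = (a v, b v)"
    show "w = v"
    proof (rule PiE_ext[OF w v])
      fix i assume i: "i \<in> {..<l + l'}"
      have "a w i = a v i" "b w (i - l) = b v (i - l)" using eq by simp_all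
      moreover have "i - l < l'" "l + (i - l) = i" if "\<not> i < l" using i that by auto
      ultimately show "w i = v i" by (cases "i < l") (simp_all add: a_def b_def)
    qed
  qed
  then have "Hent M (words (l + l') S) (word c j (l + l')) \<le>
      Hent M (words l S) (\<lambda>\<omega>. a (word c j (l + l') \<omega>)) + Hent M (words l' S) (\<lambda>\<omega>. b (word c j (l + l') \<omega>))"
  proof (intro Hent_subadditive)
    show "a ` words (l + l') S \<subseteq> words l S" "b ` words (l + l') S \<subseteq> words l' S"
      unfolding a_def b_def by (force intro!: restrict_PiE_iff[THEN iffD2] dest: PiE_mem)+
    show "inj_on (\<lambda>w. (a w, b w)) (words (l + l') S)" by fact
    show "finite (words (l + l') S)" "finite (words l S)" "finite (words l' S)" by simp_all
  qed (use word_range measurable_word in \<open>blast+\<close>)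
  also have "(\<lambda>\<omega>. a (word c j (l + l') \<omega>)) = word c j l"
    by (auto simp: a_def word_def fun_eq_iff)
  also have "(\<lambda>\<omega>. b (word c j (l + l') \<omega>)) = word c (j + l) l'"
    by (auto simp: b_def word_def fun_eq_iff add.assoc)
  finally show ?thesis by (simp add: word_entropy_def)
qed

lemma word_entropy_le: "word_entropy M S c j l \<le> real l * ln (card S)"
  using Hent_le_ln_card[of "words l S" "word c j l"] word_range measurable_word S_nonempty finite_S
  by (simp add: word_entropy_def card_PiE ln_realpow card_gt_0_iff)

lemma word_entropy_nonneg: "word_entropy M S c j l \<ge> 0"
  unfolding word_entropy_def by (rule Hent_nonneg)

end

subsection \<open>Invariant measures and partitions\<close>

definition cell :: "'a set set \<Rightarrow> 'a \<Rightarrow> 'a set" where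
  "cell P x = (THE A. A \<in> P \<and> x \<in> A)"

lemma cell_eq:
  assumes "partition_on UNIV P" "A \<in> P" "x \<in> A" shows "cell P x = A"
  unfolding cell_def using assms
  by (intro the_equality) (auto simp: partition_on_def disjoint_def)

lemma cell_in:
  assumes "partition_on UNIV P" shows "cell P x \<in> P" "x \<in> cell P x"
proof -
  obtain A where "A \<in> P" "x \<in> A" using assms by (auto simp: partition_on_def)
  then show "cell P x \<in> P" "x \<in> cell P x" using cell_eq[OF assms] by auto
qed

lemma cell_eq_iff: "partition_on UNIV P \<Longrightarrow> A \<in> P \<Longrightarrow> cell P x = A \<longleftrightarrow> x \<in> A"
  using cell_eq cell_in by metis

definition itinerary :: "('a \<Rightarrow> 'a) \<Rightarrow> 'a set set \<Rightarrow> nat \<Rightarrow> 'a \<Rightarrow> 'a set" where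
  "itinerary T P i x = cell P ((T ^^ i) x)"

text \<open>Any point of a nonempty intersection of cells determines all the cells involved. The
  refinement chooses one cell per member of the set of pulled-back partitions, so times whose
  pull-backs coincide share a choice; this is consistent because the point forces the
  choice.\<close>

lemma iterated_join_eq:
  assumes P: "partition_on UNIV P" and n: "n \<ge> 1"
  shows "iterated_join T P n = (\<lambda>x. {y. word (itinerary T P) 0 n y = word (itinerary T P) 0 n x}) ` UNIV"
    (is "_ = ?C ` UNIV")
proof -
  define R where "R i = (\<lambda>A. (T ^^ i) -` A) ` P" for i
  have J: "iterated_join T P n = common_refinement (R ` {..<n})"
    by (simp add: iterated_join_def R_def)
  have C: "?C x = {y. \<forall>i<n. (T ^^ i) y \<in> cell P ((T ^^ i) x)}" for x
    using cell_eq_iff[OF P cell_in(1)[OF P]]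
    by (auto simp: word_def itinerary_def fun_eq_iff restrict_def)
  have *: "X = ?C x" if X: "X \<in> common_refinement (R ` {..<n})" "x \<in> X" for X x
  proof -
    obtain f where f: "\<And>i. i < n \<Longrightarrow> f (R i) \<in> R i" "X = \<Inter> (f ` R ` {..<n})"
      using X(1) by (auto simp: common_refinement_def PiE_def)
    have "f (R i) = (T ^^ i) -` cell P ((T ^^ i) x)" if "i < n" for i
    proof -
      obtain A where A: "A \<in> P" "f (R i) = (T ^^ i) -` A" using f(1)[of i] \<open>i < n\<close> by (auto simp: R_def)
      have "x \<in> f (R i)" using X(2) f(2) that by auto
      then show ?thesis using A cell_eq[OF P] by auto
    qed
    then show ?thesis unfolding C f(2) by auto
  qed
  have cover: "x \<in> \<Union> (common_refinement (R ` {..<n}))" for x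
    unfolding Union_common_refinement using P by (auto simp: R_def partition_on_def)
  show ?thesis unfolding J
  proof (intro set_eqI iffI)
    fix X assume X: "X \<in> common_refinement (R ` {..<n})"
    then have "X \<noteq> {}" unfolding common_refinement_def by blast
    then show "X \<in> ?C ` UNIV" using *[OF X] by blast
  next
    fix X assume "X \<in> ?C ` UNIV"
    then obtain x where x: "X = ?C x" by blast
    obtain Y where Y: "Y \<in> common_refinement (R ` {..<n})" "x \<in> Y" using cover[of x] by blast
    show "X \<in> common_refinement (R ` {..<n})" using Y *[OF Y] x by simp
  qed
qed

locale invariant_measure =
  fixes T :: "'a::metric_space \<Rightarrow> 'a" and \<mu> :: "'a measure"
  assumes tds: "tds T" and inv: "\<mu> \<in> invariant_measures T"
begin

lemma prob_space_mu: "prob_space \<mu>" and sets_mu [simp, measurable_cong]: "sets \<mu> = sets borel"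
  and distr_mu: "distr \<mu> \<mu> T = \<mu>"
  using inv by (auto simp: invariant_measures_def)

lemma space_mu [simp]: "space \<mu> = UNIV"
  using sets_eq_imp_space_eq[OF sets_mu] by simp

sublocale full_prob_space \<mu>
  using prob_space_mu by unfold_locales (auto simp: prob_space_def finite_measure_def
      sigma_finite_measure_def prob_space_axioms_def finite_measure_axioms_def)

lemma measurable_T [measurable]: "T \<in> borel_measurable borel"
  using tds by (auto simp: tds_def intro: borel_measurable_continuous_onI)

lemma measurable_Tn [measurable]: "(T ^^ n) \<in> borel_measurable borel"
  by (induction n) (auto simp: comp_def)

lemma distr_Tn: "distr \<mu> \<mu> (T ^^ n) = \<mu>"
proof (induction n)
  case 0
  show ?case by (simp add: distr_id id_def)
next
  case (Suc n)
  have "distr \<mu> \<mu> (T ^^ Suc n) = distr (distr \<mu> \<mu> (T ^^ n)) \<mu> T"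
    by (subst distr_distr) auto
  then show ?case using Suc distr_mu by (simp add: comp_def)
qed

lemma measure_Tn:
  assumes "A \<in> sets borel" shows "measure \<mu> ((T ^^ n) -` A) = measure \<mu> A"
proof -
  have "measure (distr \<mu> \<mu> (T ^^ n)) A = measure \<mu> ((T ^^ n) -` A \<inter> space \<mu>)"
    using assms by (intro measure_distr) auto
  then show ?thesis by (simp add: distr_Tn)
qed

lemma integral_Tn:
  fixes g :: "'a \<Rightarrow> real"
  assumes "g \<in> borel_measurable borel" shows "(\<integral>x. g ((T ^^ n) x) \<partial>\<mu>) = (\<integral>x. g x \<partial>\<mu>)"
proof -
  have "(\<integral>x. g x \<partial>distr \<mu> \<mu> (T ^^ n)) = (\<integral>x. g ((T ^^ n) x) \<partial>\<mu>)"
    using assms by (intro integral_distr) auto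
  then show ?thesis by (simp add: distr_Tn)
qed

context
  fixes P :: "'a set set" assumes P: "finite_borel_partition P"
begin

lemma partition_P: "finite P" "partition_on UNIV P" "A \<in> P \<Longrightarrow> A \<in> sets borel"
  using P by (auto simp: finite_borel_partition_def)

lemma symbolic_process_itinerary: "symbolic_process \<mu> P (itinerary T P)"
proof
  show "finite P" by (rule partition_P)
  show "range (itinerary T P i) \<subseteq> P" for i
    using cell_in(1)[OF partition_P(2)] by (auto simp: itinerary_def)
  fix A i assume A: "A \<in> P"
  have "{x. itinerary T P i x = A} = (T ^^ i) -` A"
    using cell_eq_iff[OF partition_P(2) A] by (auto simp: itinerary_def)
  also have "\<dots> \<in> sets borel" using measurable_sets[OF measurable_Tn partition_P(3)[OF A], of i] by simp
  finally show "{x. itinerary T P i x = A} \<in> sets \<mu>" by simp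
qed

interpretation symbolic_process \<mu> P "itinerary T P"
  by (rule symbolic_process_itinerary)

lemma word_entropy_shift: "word_entropy \<mu> P (itinerary T P) j l = word_entropy \<mu> P (itinerary T P) 0 l"
proof -
  have "measure \<mu> {x. word (itinerary T P) j l x = w} = measure \<mu> {x. word (itinerary T P) 0 l x = w}"
    if w: "w \<in> words l P" for w
  proof -
    have "word (itinerary T P) j l x = word (itinerary T P) 0 l ((T ^^ j) x)" for x
      by (auto simp: word_def itinerary_def fun_eq_iff funpow_add add.commute[of j] comp_def)
    then have "{x. word (itinerary T P) j l x = w} = (T ^^ j) -` {x. word (itinerary T P) 0 l x = w}"
      by auto
    then show ?thesis using measure_Tn[OF measurable_word[OF w, of 0, simplified], of j] by simp
  qed
  then show ?thesis by (simp add: word_entropy_def Hent_def)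
qed

text \<open>Atoms of the join correspond to the words that occur; the other words have an empty
  fibre and contribute \<open>eta 0 = 0\<close>.\<close>

lemma partition_entropy_join:
  assumes n: "n \<ge> 1"
  shows "partition_entropy \<mu> (iterated_join T P n) = word_entropy \<mu> P (itinerary T P) 0 n"
proof -
  let ?w = "word (itinerary T P) 0 n"
  let ?D = "\<lambda>w. {y. ?w y = w}"
  have "iterated_join T P n = ?D ` range ?w"
    unfolding iterated_join_eq[OF partition_P(2) n] by auto
  then have "partition_entropy \<mu> (iterated_join T P n) = (\<Sum>A\<in>?D ` range ?w. eta (measure \<mu> A))"
    by (simp add: partition_entropy_def eta_def sum_negf)
  also have "\<dots> = (\<Sum>w\<in>range ?w. eta (measure \<mu> (?D w)))"
    by (subst sum.reindex) (auto simp: inj_on_def)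
  also have "\<dots> = (\<Sum>w\<in>words n P. eta (measure \<mu> (?D w)))"
  proof (rule sum.mono_neutral_left)
    show "\<forall>w\<in>words n P - range ?w. eta (measure \<mu> (?D w)) = 0"
    proof
      fix w assume "w \<in> words n P - range ?w"
      then have "?D w = {}" by auto
      then show "eta (measure \<mu> (?D w)) = 0" by (metis eta_0 measure_empty)
    qed
  qed (use word_range in auto)
  finally show ?thesis by (simp add: word_entropy_def Hent_def)
qed

abbreviation "wH n \<equiv> word_entropy \<mu> P (itinerary T P) 0 n"

lemma entropy_wrt_limit:
  "(\<lambda>n. ereal (wH n / real n)) \<longlonglongrightarrow> entropy_wrt T \<mu> P"
  "entropy_wrt T \<mu> P = (INF n\<in>{1..}. ereal (wH n / real n))"
proof -
  have lim: "(\<lambda>n. ereal (wH n / real n)) \<longlonglongrightarrow> (INF n\<in>{1..}. ereal (wH n / real n))"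
  proof (intro fekete)
    show "wH (m + n) \<le> wH m + wH n" for m n
      using word_entropy_subadditive[of 0 m n] word_entropy_shift[of "0 + m" n] by simp
  qed
  \<comment> \<open>The identification with words is made for positive lengths, so the two sequences
    are compared from \<open>n = 1\<close> on.\<close>
  have "eventually (\<lambda>n. ereal (wH n / real n) = ereal (partition_entropy \<mu> (iterated_join T P n) / real n)) sequentially"
    using eventually_ge_at_top[of 1] by eventually_elim (simp add: partition_entropy_join)
  then have "(\<lambda>n. ereal (partition_entropy \<mu> (iterated_join T P n) / real n)) \<longlonglongrightarrow> (INF n\<in>{1..}. ereal (wH n / real n))"
    by (rule Lim_transform_eventually[OF lim])
  then show e: "entropy_wrt T \<mu> P = (INF n\<in>{1..}. ereal (wH n / real n))"
    unfolding entropy_wrt_def by (rule limI)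
  show "(\<lambda>n. ereal (wH n / real n)) \<longlonglongrightarrow> entropy_wrt T \<mu> P" unfolding e by (rule lim)
qed

lemma entropy_wrt_finite: "\<bar>entropy_wrt T \<mu> P\<bar> \<noteq> \<infinity>"
proof -
  have "entropy_wrt T \<mu> P \<le> ereal (wH 1 / real 1)"
    unfolding entropy_wrt_limit(2) by (rule INF_lower) simp
  moreover have "entropy_wrt T \<mu> P \<ge> ereal 0"
    unfolding entropy_wrt_limit(2) using word_entropy_nonneg by (intro INF_greatest) auto
  ultimately show ?thesis by auto
qed

text \<open>The entropy is an infimum over all lengths and not just a limit, so the bound holds at
  each \<open>n\<close> without an error term.\<close>

lemma wH_ge: "n \<ge> 1 \<Longrightarrow> wH n \<ge> real n * real_of_ereal (entropy_wrt T \<mu> P)"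
proof -
  assume n: "n \<ge> 1"
  have "entropy_wrt T \<mu> P \<le> ereal (wH n / real n)"
    unfolding entropy_wrt_limit(2) using n by (intro INF_lower) simp
  then have "real_of_ereal (entropy_wrt T \<mu> P) \<le> wH n / n"
    using entropy_wrt_finite by (metis ereal_real ereal_less_eq(3))
  then show ?thesis using n by (simp add: field_simps)
qed

end

end

subsection \<open>Compactness\<close>

text \<open>Tychonoff. Block functions are treated as functions of infinite sequences that depend on
  finitely many coordinates, which gives one compact space for all block lengths.\<close>

lemma compact_UNIV_sequences:
  assumes "compact (UNIV :: 'a::topological_space set)"
  shows "compact (UNIV :: (nat \<Rightarrow> 'a) set)"
proof -
  have "compact_space (euclidean :: 'a topology)" using assms by (simp add: compact_space_def)
  then have "compact_space (product_topology (\<lambda>_::nat. euclidean :: 'a topology) UNIV)"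
    by (simp add: compact_space_product_topology)
  then show ?thesis unfolding euclidean_product_topology by (simp add: compact_space_def)
qed

lemma continuous_on_coordinate: "continuous_on A (\<lambda>y::nat \<Rightarrow> 'a::topological_space. y i)"
  by (rule continuous_on_subset[OF continuous_on_product_coordinates subset_UNIV])

lemma compact_bounded_function:
  fixes g :: "'a::topological_space \<Rightarrow> real"
  assumes "compact (UNIV :: 'a set)" "continuous_on UNIV g"
  obtains B where "B \<ge> 0" "\<And>x. \<bar>g x\<bar> \<le> B"
proof -
  have "bounded (range g)" using assms by (intro compact_imp_bounded compact_continuous_image)
  then obtain B where "\<And>x. \<bar>g x\<bar> \<le> B" by (auto simp: bounded_iff)
  then show ?thesis using that[of B] by (meson abs_ge_zero order_trans)
qed

abbreviation orbit :: "('a \<Rightarrow> 'a) \<Rightarrow> 'a \<Rightarrow> nat \<Rightarrow> 'a" where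
  "orbit T x \<equiv> (\<lambda>i. (T ^^ i) x)"

lemma tds_compact: "tds (T :: 'a \<Rightarrow> 'a) \<Longrightarrow> compact (UNIV :: 'a::metric_space set)"
  and tds_continuous: "tds T \<Longrightarrow> continuous_on UNIV T"
  by (auto simp: tds_def)

lemma continuous_on_iterate:
  fixes T :: "'a::topological_space \<Rightarrow> 'a"
  shows "continuous_on UNIV T \<Longrightarrow> continuous_on UNIV (T ^^ n)"
proof (induction n)
  case (Suc n)
  then show ?case using continuous_on_compose[of UNIV "T ^^ n" T] continuous_on_subset
    by (auto simp: comp_def)
qed (simp add: id_def)

lemma continuous_on_orbit:
  fixes T :: "'a::topological_space \<Rightarrow> 'a"
  shows "continuous_on UNIV T \<Longrightarrow> continuous_on UNIV (orbit T)"
  by (intro continuous_on_coordinatewise_then_product continuous_on_iterate)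

text \<open>
  On the compact set of tuples where the two sides differ by at least \<open>\<eta>\<close>, the continuous function
  \<open>\<Sum>d(T y\<^sub>i, y\<^bsub>i+1\<^esub>)\<close> does not vanish, hence is bounded away from \<open>0\<close>.
\<close>

lemma pseudo_orbit_approximation:
  fixes g :: "(nat \<Rightarrow> 'a::metric_space) \<Rightarrow> real"
  assumes T: "tds T" and g: "continuous_on UNIV g" and "\<eta> > 0"
    and dep: "\<And>y z. (\<And>i. i < q \<Longrightarrow> y i = z i) \<Longrightarrow> g y = g z"
  obtains K where "K \<ge> 0"
    "\<And>y. \<bar>g y - g (orbit T (y 0))\<bar> \<le> \<eta> + K * (\<Sum>i<q - 1. dist (T (y i)) (y (i + 1)))"
proof -
  note comp = compact_UNIV_sequences[OF tds_compact[OF T]] and Tc = tds_continuous[OF T]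
  define h where "h y = \<bar>g y - g (orbit T (y 0))\<bar>" for y
  define s where "s y = (\<Sum>i<q - 1. dist (T (y i)) (y (i + 1)))" for y
  have "continuous_on UNIV (\<lambda>y::nat \<Rightarrow> 'a. g (orbit T (y 0)))"
    using continuous_on_compose2[OF continuous_on_compose2[OF g continuous_on_orbit[OF Tc]] continuous_on_coordinate[of UNIV 0]]
    by simp
  then have hc: "continuous_on UNIV h"
    unfolding h_def[abs_def] by (intro continuous_intros g)
  have sc: "continuous_on UNIV s"
    unfolding s_def[abs_def]
    by (intro continuous_intros continuous_on_coordinate continuous_on_compose2[OF Tc continuous_on_coordinate]) auto
  have s0: "s y \<ge> 0" for y by (auto simp: s_def intro: sum_nonneg)
  define D where "D = {y. h y \<ge> \<eta>}"
  have "closed D"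
    using continuous_closed_vimage[of "{\<eta>..}" h] hc by (simp add: D_def vimage_def continuous_on_eq_continuous_at)
  then have "compact D" using comp compact_Int_closed[of UNIV D] by simp
  show ?thesis
  proof (cases "D = {}")
    case True
    then have "h y \<le> \<eta>" for y by (auto simp: D_def not_le less_imp_le)
    then show ?thesis using that[of 0] by (simp add: h_def)
  next
    case False
    obtain z where z: "z \<in> D" "\<And>y. y \<in> D \<Longrightarrow> s z \<le> s y"
      using continuous_attains_inf[OF \<open>compact D\<close> False continuous_on_subset[OF sc]] by auto
    \<comment> \<open>If all errors vanish, the first \<open>q\<close> coordinates form an exact
      orbit segment, and \<open>g\<close> sees no others.\<close>
    have "s z \<noteq> 0"
    proof
      assume "s z = 0"
      then have *: "\<forall>i<q - 1. T (z i) = z (i + 1)"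
        by (simp add: s_def sum_nonneg_eq_0_iff)
      have "i < q \<Longrightarrow> z i = (T ^^ i) (z 0)" for i
      proof (induction i)
        case (Suc i)
        then have "i < q - 1" by simp
        then have "z (i + 1) = T (z i)" using * by simp
        then show ?case using Suc by simp
      qed simp
      then have "g z = g (orbit T (z 0))" by (rule dep)
      then show False using z(1) \<open>\<eta> > 0\<close> by (simp add: D_def h_def)
    qed
    then have sz: "s z > 0" using s0[of z] by simp
    obtain B where B: "B \<ge> 0" "\<And>y. \<bar>h y\<bar> \<le> B" using compact_bounded_function[OF comp hc] by blast
    \<comment> \<open>Off \<open>D\<close> the first term suffices; on \<open>D\<close> the factor
      \<open>s y / s z\<close> is at least 1 and \<open>B\<close> bounds \<open>h\<close>
      everywhere.\<close>
    have "h y \<le> \<eta> + B / s z * s y" for y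
    proof (cases "y \<in> D")
      case True
      have "h y \<le> B" using B(2)[of y] by simp
      also have "B = B / s z * s z" using sz by simp
      also have "\<dots> \<le> B / s z * s y" using z(2)[OF True] sz B by (intro mult_left_mono) auto
      finally show ?thesis using \<open>\<eta> > 0\<close> by simp
    next
      case False
      then have "h y \<le> \<eta>" by (simp add: D_def)
      moreover have "B / s z * s y \<ge> 0" using B sz s0[of y] by simp
      ultimately show ?thesis by simp
    qed
    then show ?thesis using that[of "B / s z"] B sz by (simp add: h_def s_def)
  qed
qed

subsection \<open>Block potentials\<close>

locale block_potential =
  fixes T :: "'a::metric_space \<Rightarrow> 'a" and F :: "nat \<Rightarrow> (nat \<Rightarrow> 'a) \<Rightarrow> real"
  assumes tds_T: "tds T" and F: "block_subadditive F"
begin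

text \<open>Reading the first \<open>l\<close> coordinates of an infinite sequence puts orbits and
  all windows of a tuple into one type, without domain conditions.\<close>

definition bF :: "nat \<Rightarrow> (nat \<Rightarrow> 'a) \<Rightarrow> real" where
  "bF l y = F l (restrict y {..<l})"

lemma induced_eq: "induced_potential T F n x = bF n (orbit T x)"
  by (simp add: induced_potential_def bF_def)

lemma bF_eq: "x \<in> tuples n \<Longrightarrow> bF n x = F n x"
  by (simp add: bF_def PiE_restrict)

lemma bF_dep: "(\<And>i. i < l \<Longrightarrow> y i = z i) \<Longrightarrow> bF l y = bF l z"
  unfolding bF_def by (metis lessThan_iff restrict_ext)

lemma continuous_bF:
  assumes "l \<ge> 1" shows "continuous_on UNIV (bF l)"
proof -
  have "continuous_map euclidean (product_topology (\<lambda>_. euclidean) {..<l}) (\<lambda>y::nat \<Rightarrow> 'a. restrict y {..<l})"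
    unfolding continuous_map_componentwise using continuous_on_coordinate[of UNIV] by auto
  moreover have "continuous_map (product_topology (\<lambda>_. euclidean) {..<l}) euclideanreal (F l)"
    using F assms by (auto simp: block_subadditive_def)
  ultimately have "continuous_map euclidean euclideanreal (F l \<circ> (\<lambda>y. restrict y {..<l}))"
    by (rule continuous_map_compose)
  then show ?thesis by (simp add: bF_def[abs_def] comp_def)
qed

lemma bF_subadditive:
  assumes "l \<ge> 1" "l' \<ge> 1" shows "bF (l + l') y \<le> bF l y + bF l' (\<lambda>i. y (l + i))"
proof -
  define x where "x = restrict y {..<l + l'}"
  have "x \<in> tuples (l + l')" by (simp add: x_def)
  then have "F (l + l') x \<le> F l (\<lambda>i\<in>{..<l}. x i) + F l' (\<lambda>i\<in>{..<l'}. x (l + i))"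
    using F assms unfolding block_subadditive_def by blast
  also have "(\<lambda>i\<in>{..<l}. x i) = restrict y {..<l}" by (auto simp: x_def)
  also have "(\<lambda>i\<in>{..<l'}. x (l + i)) = (\<lambda>i\<in>{..<l'}. y (l + i))" by (auto simp: x_def)
  finally show ?thesis unfolding bF_def x_def .
qed

lemma bF_1_bounded: obtains C where "C \<ge> 0" "\<And>y. bF 1 y \<le> C"
  using compact_bounded_function[OF compact_UNIV_sequences[OF tds_compact[OF tds_T]] continuous_bF[of 1]]
  by (metis abs_le_D1 order_refl)

lemma bF_le:
  assumes "\<And>y. bF 1 y \<le> C" "n \<ge> 1" shows "bF n y \<le> real n * C"
  using assms(2)
proof (induction n arbitrary: y rule: dec_induct)
  case (step n)
  have "bF (Suc n) y \<le> bF n y + bF 1 (\<lambda>i. y (n + i))" using bF_subadditive[of n 1] step by simp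
  then show ?case using step(3)[of y] assms(1)[of "\<lambda>i. y (n + i)"] by (simp add: algebra_simps)
qed (use assms in simp)

lemma continuous_induced: "n \<ge> 1 \<Longrightarrow> continuous_on UNIV (induced_potential T F n)"
  unfolding induced_eq[abs_def]
  by (rule continuous_on_compose2[OF continuous_bF continuous_on_orbit[OF tds_continuous[OF tds_T]]]) auto

end

context invariant_measure
begin

lemma integrable_continuous [intro]: "continuous_on UNIV g \<Longrightarrow> integrable \<mu> (g :: 'a \<Rightarrow> real)"
  using compact_bounded_function[OF tds_compact[OF tds], of g]
  by (metis (no_types, lifting) AE_I2 borel_measurable_continuous_onI integrable_const_bound
      measurable_cong_sets real_norm_def sets_mu)

end

locale invariant_potential = block_potential T F + invariant_measure T \<mu>
  for T :: "'a::metric_space \<Rightarrow> 'a" and F \<mu>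
begin

abbreviation "f \<equiv> induced_potential T F"

definition If :: "nat \<Rightarrow> real" where "If n = (\<integral>x. f n x \<partial>\<mu>)"

lemma integrable_f: "n \<ge> 1 \<Longrightarrow> integrable \<mu> (f n)"
  by (intro integrable_continuous continuous_induced)

lemma If_subadditive:
  assumes "m \<ge> 1" "n \<ge> 1" shows "If (m + n) \<le> If m + If n"
proof -
  have meas: "f n \<in> borel_measurable borel"
    using continuous_induced[OF assms(2)] by (rule borel_measurable_continuous_onI)
  have c: "continuous_on UNIV (\<lambda>x. f n ((T ^^ m) x))"
    by (rule continuous_on_compose2[OF continuous_induced[OF assms(2)] continuous_on_iterate[OF tds_continuous[OF tds]]]) auto
  have "f (m + n) x \<le> f m x + f n ((T ^^ m) x)" for x
    using bF_subadditive[OF assms, of "orbit T x"]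
    by (simp add: induced_eq funpow_add add.commute[of m] comp_def)
  then have "If (m + n) \<le> (\<integral>x. f m x + f n ((T ^^ m) x) \<partial>\<mu>)"
    unfolding If_def using assms c by (intro integral_mono integrable_f Bochner_Integration.integrable_add integrable_continuous) auto
  also have "\<dots> = If m + If n"
    unfolding If_def using assms c integral_Tn[OF meas]
    by (subst Bochner_Integration.integral_add) (auto intro: integrable_f)
  finally show ?thesis .
qed

lemma asymptotic_mean_limit:
  "(\<lambda>n. ereal (If n / real n)) \<longlonglongrightarrow> asymptotic_mean f \<mu>"
  "asymptotic_mean f \<mu> = (INF n\<in>{1..}. ereal (If n / real n))"
proof -
  have lim: "(\<lambda>n. ereal (If n / real n)) \<longlonglongrightarrow> (INF n\<in>{1..}. ereal (If n / real n))"
    by (intro fekete If_subadditive)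
  then show e: "asymptotic_mean f \<mu> = (INF n\<in>{1..}. ereal (If n / real n))"
    unfolding asymptotic_mean_def If_def by (rule limI)
  show "(\<lambda>n. ereal (If n / real n)) \<longlonglongrightarrow> asymptotic_mean f \<mu>" unfolding e by (rule lim)
qed

lemma asymptotic_mean_less_infinity: "asymptotic_mean f \<mu> < \<infinity>"
proof -
  have "asymptotic_mean f \<mu> \<le> ereal (If 1 / real 1)"
    unfolding asymptotic_mean_limit(2) by (rule INF_lower) simp
  then show ?thesis by auto
qed

lemma If_ge:
  assumes "asymptotic_mean f \<mu> = ereal r" "n \<ge> 1" shows "If n \<ge> real n * r"
proof -
  have "asymptotic_mean f \<mu> \<le> ereal (If n / real n)"
    unfolding asymptotic_mean_limit(2) using assms by (intro INF_lower) simp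
  then show ?thesis using assms by (simp add: field_simps)
qed

end

subsection \<open>Nets of average pseudo-orbits\<close>

lemma abs_sum_diff_le_card:
  fixes a :: "nat \<Rightarrow> real"
  assumes "finite B" "A \<subseteq> B" "\<And>t. \<bar>a t\<bar> \<le> b"
  shows "\<bar>sum a A - sum a B\<bar> \<le> real (card B - card A) * b"
proof -
  have "sum a B - sum a A = sum a (B - A)" using assms by (simp add: sum_diff)
  moreover have "\<bar>sum a (B - A)\<bar> \<le> (\<Sum>t\<in>B - A. b)"
    using assms(3) by (intro order_trans[OF sum_abs] sum_mono) auto
  moreover have "card (B - A) = card B - card A"
    using assms by (intro card_Diff_subset finite_subset[of A B]) auto
  ultimately show ?thesis by (simp add: abs_minus_commute)
qed

text \<open>The filter is arbitrary because the index is a natural number in one application and a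
  pair of a finite set of test functions and a tolerance in the other. Bounding the sum of errors by
  \<open>n k * d k\<close> avoids the normalisation by \<open>n k - 1\<close>, which is a division
  by 0 for tuples of length 1.\<close>

locale pseudo_orbit_net =
  fixes T :: "'a::metric_space \<Rightarrow> 'a" and K :: "'i filter"
    and n :: "'i \<Rightarrow> nat" and d :: "'i \<Rightarrow> real" and \<nu> :: "'i \<Rightarrow> (nat \<Rightarrow> 'a) pmf"
  assumes tds_T: "tds T"
    and n_lim: "filterlim n at_top K" and d_lim: "(d \<longlongrightarrow> 0) K"
    and finite_supp: "finite (set_pmf (\<nu> k))"
    and pseudo: "\<forall>\<^sub>F k in K. \<forall>x\<in>set_pmf (\<nu> k). (\<Sum>i<n k - 1. dist (T (x i)) (x (i + 1))) \<le> real (n k) * d k"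
begin

abbreviation ex :: "'i \<Rightarrow> ((nat \<Rightarrow> 'a) \<Rightarrow> real) \<Rightarrow> real" where
  "ex k g \<equiv> measure_pmf.expectation (\<nu> k) g"

lemma integrable_ex [simp]: "integrable (measure_pmf (\<nu> k)) (g :: _ \<Rightarrow> real)"
  by (rule integrable_measure_pmf_finite[OF finite_supp])

lemma ex_mono: "(\<And>x. x \<in> set_pmf (\<nu> k) \<Longrightarrow> g x \<le> h x) \<Longrightarrow> ex k g \<le> ex k h"
  by (rule integral_mono_AE) (auto simp: AE_measure_pmf_iff)

lemma ex_abs_le: "(\<And>x. x \<in> set_pmf (\<nu> k) \<Longrightarrow> \<bar>g x\<bar> \<le> b) \<Longrightarrow> \<bar>ex k g\<bar> \<le> b"
  using ex_mono[of k g "\<lambda>_. b"] ex_mono[of k "\<lambda>_. - b" g] by (force simp: abs_le_iff)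

text \<open>Integration against the expected empirical measure, kept as a functional so that no
  measure has to be built along a general filter.\<close>

definition emp :: "'i \<Rightarrow> ('a \<Rightarrow> real) \<Rightarrow> real" where
  "emp k g = ex k (\<lambda>x. (\<Sum>i<n k. g (x i)) / real (n k))"

text \<open>Integration against the averaged law of the windows of length \<open>q\<close>. There
  are \<open>n k - q + 1\<close> of them once \<open>n k\<close> is at least \<open>q\<close>;
  before that, truncated subtraction keeps the divisor positive.\<close>

definition avg :: "nat \<Rightarrow> 'i \<Rightarrow> ((nat \<Rightarrow> 'a) \<Rightarrow> real) \<Rightarrow> real" where
  "avg q k g = ex k (\<lambda>x. (\<Sum>j<n k - q + 1. g (\<lambda>i. x (j + i))) / real (n k - q + 1))"

lemma avg_diff: "avg q k (\<lambda>y. g y - h y) = avg q k g - avg q k h"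
  unfolding avg_def by (simp add: sum_subtractf diff_divide_distrib)

lemma avg_mono: "(\<And>y. g y \<le> h y) \<Longrightarrow> avg q k g \<le> avg q k h"
  unfolding avg_def by (intro ex_mono divide_right_mono sum_mono) auto

lemma avg_eq: "avg q k g = (\<Sum>j<n k - q + 1. ex k (\<lambda>x. g (\<lambda>i. x (j + i)))) / real (n k - q + 1)"
  unfolding avg_def by (simp add: Bochner_Integration.integral_sum)

lemma eventually_n_ge: "\<forall>\<^sub>F k in K. n k \<ge> c"
  using n_lim by (simp add: filterlim_at_top)

lemma real_block_count_at_top: "filterlim (\<lambda>k. real (n k - q + 1)) at_top K"
proof -
  have "filterlim (\<lambda>x. x - q + 1) at_top at_top"
    unfolding filterlim_at_top eventually_at_top_linorder
  proof
    fix Z show "\<exists>N. \<forall>l\<ge>N. Z \<le> l - q + 1" by (rule exI[of _ "Z + q"]) auto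
  qed
  then show ?thesis
    by (intro filterlim_compose[OF filterlim_real_sequentially] filterlim_compose[OF _ n_lim])
qed

text \<open>Each single error \<open>dist (T (x t)) (x (t + 1))\<close> enters fewer than
  \<open>q\<close> windows, so the mean error per window is at most
  \<open>q * n k * d k / m\<close>, where \<open>m\<close> is the number of windows. It vanishes
  with \<open>d k\<close>, because \<open>n k / m\<close> is at most \<open>q\<close>.\<close>

lemma avg_orbit:
  assumes q: "q \<ge> 1" and g: "continuous_on UNIV g"
    and dep: "\<And>y z. (\<And>i. i < q \<Longrightarrow> y i = z i) \<Longrightarrow> g y = g z"
  shows "((\<lambda>k. avg q k (\<lambda>y. g y - g (orbit T (y 0)))) \<longlongrightarrow> 0) K"
proof (rule tendstoI)
  fix e :: real assume "e > 0"
  obtain C where C: "C \<ge> 0"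
    "\<And>y. \<bar>g y - g (orbit T (y 0))\<bar> \<le> e / 2 + C * (\<Sum>i<q - 1. dist (T (y i)) (y (i + 1)))"
    using pseudo_orbit_approximation[OF tds_T g half_gt_zero[OF \<open>e > 0\<close>] dep] by blast
  have "((\<lambda>k. C * (real q)^2 * d k) \<longlongrightarrow> C * (real q)^2 * 0) K"
    by (intro tendsto_intros d_lim)
  then have "\<forall>\<^sub>F k in K. C * (real q)^2 * d k < e / 2"
    using \<open>e > 0\<close> by (intro order_tendstoD(2)) auto
  then show "\<forall>\<^sub>F k in K. dist (avg q k (\<lambda>y. g y - g (orbit T (y 0)))) 0 < e"
    using pseudo eventually_n_ge[of q]
  proof eventually_elim
    case (elim k)
    define m where "m = n k - q + 1"
    have nm: "n k = m + q - 1" "m \<ge> 1" using elim(3) q by (auto simp: m_def)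
    have "n k \<le> q * m"
    proof -
      have "(q - 1) * 1 \<le> (q - 1) * m" using nm by (intro mult_left_mono) auto
      then show ?thesis using nm q by (cases q) auto
    qed
    then have nqm: "real (n k) \<le> real q * real m" by (metis of_nat_le_iff of_nat_mult)
    have "\<bar>avg q k (\<lambda>y. g y - g (orbit T (y 0)))\<bar> \<le> e / 2 + C * (real q)^2 * d k"
      unfolding avg_def m_def[symmetric]
    proof (rule ex_abs_le)
      fix x assume x: "x \<in> set_pmf (\<nu> k)"
      define D where "D t = dist (T (x t)) (x (t + 1))" for t
      have sumD: "(\<Sum>t<n k - 1. D t) \<le> real (n k) * d k" using elim(2) x by (simp add: D_def)
      have "0 \<le> (\<Sum>t<n k - 1. D t)" by (auto simp: D_def intro: sum_nonneg)
      then have "0 \<le> real (n k) * d k" using sumD by linarith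
      then have d0: "d k \<ge> 0" using nm q by (simp add: zero_le_mult_iff)
      have "\<bar>\<Sum>j<m. g (\<lambda>i. x (j + i)) - g (orbit T (x (j + 0)))\<bar>
          \<le> (\<Sum>j<m. e / 2 + C * (\<Sum>i<q - 1. D (j + i)))"
        using C(2)[of "\<lambda>i. x (_ + i)"] by (intro order_trans[OF sum_abs] sum_mono) (simp add: D_def)
      also have "\<dots> = m * (e / 2) + C * (\<Sum>i<q - 1. \<Sum>j<m. D (j + i))"
        unfolding sum.swap[of _ "{..<m}" "{..<q-1}" for m] by (simp add: sum.distrib sum_distrib_left[symmetric])
      also have "(\<Sum>i<q - 1. \<Sum>j<m. D (j + i)) \<le> (\<Sum>i<q - 1. \<Sum>t<n k - 1. D t)"
      proof (rule sum_mono)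
        fix i assume i: "i \<in> {..<q - 1}"
        have "(\<Sum>j<m. D (j + i)) = sum D ((\<lambda>j. j + i) ` {..<m})"
          by (subst sum.reindex) auto
        also have "\<dots> \<le> (\<Sum>t<n k - 1. D t)"
          using i nm by (intro sum_mono2) (auto simp: D_def)
        finally show "(\<Sum>j<m. D (j + i)) \<le> (\<Sum>t<n k - 1. D t)" .
      qed
      also have "\<dots> \<le> (\<Sum>i<q - 1. real (n k) * d k)" by (intro sum_mono sumD)
      also have "\<dots> \<le> real q * (real q * real m * d k)"
        using d0 nqm by (auto intro!: mult_mono)
      finally have "\<bar>\<Sum>j<m. g (\<lambda>i. x (j + i)) - g (orbit T (x (j + 0)))\<bar>
          \<le> m * (e / 2) + C * (real q * (real q * real m * d k))"
        using C(1) by (simp add: mult_left_mono)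
      then show "\<bar>(\<Sum>j<m. g (\<lambda>i. x (j + i)) - g (orbit T (x (j + 0)))) / real m\<bar> \<le> e / 2 + C * (real q)^2 * d k"
        using nm by (simp add: field_simps power2_eq_square)
    qed
    then show ?case using elim(1) by simp
  qed
qed

text \<open>The \<open>i\<close>-th coordinates of the windows run through all but
  \<open>q - 1\<close> of the indices. Changing the range of the sum and changing the normalisation
  cost at most \<open>q * B\<close> divided by the number of windows each.\<close>

lemma avg_coordinate:
  assumes g: "continuous_on UNIV g" and i: "i < q"
  shows "((\<lambda>k. avg q k (\<lambda>y. g (y i)) - emp k g) \<longlongrightarrow> 0) K"
proof -
  obtain B where B: "B \<ge> 0" "\<And>x. \<bar>g x\<bar> \<le> B"
    using compact_bounded_function[OF tds_compact[OF tds_T] g] by blast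
  have "((\<lambda>k. (2 * real q * B) / real (n k - q + 1)) \<longlongrightarrow> 0) K"
    by (intro tendsto_divide_0[OF tendsto_const] filterlim_at_top_imp_at_infinity real_block_count_at_top)
  moreover have "\<forall>\<^sub>F k in K. norm (avg q k (\<lambda>y. g (y i)) - emp k g) \<le> (2 * real q * B) / real (n k - q + 1)"
    using eventually_n_ge[of q]
  proof eventually_elim
    case (elim k)
    define m where "m = n k - q + 1"
    have nm: "n k = m + q - 1" "m \<ge> 1" using elim i by (auto simp: m_def)
    have "\<bar>ex k (\<lambda>x. (\<Sum>j<m. g (x (j + i))) / real m - (\<Sum>t<n k. g (x t)) / real (n k))\<bar> \<le> 2 * real q * B / m"
    proof (rule ex_abs_le)
      fix x
      define S where "S = (\<Sum>t<n k. g (x t))"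
      define S' where "S' = (\<Sum>j<m. g (x (j + i)))"
      have "S' = (\<Sum>t\<in>(\<lambda>j. j + i) ` {..<m}. g (x t))" unfolding S'_def by (subst sum.reindex) auto
      moreover have "(\<lambda>j. j + i) ` {..<m} \<subseteq> {..<n k}" using nm i by auto
      moreover have "card ((\<lambda>j. j + i) ` {..<m}) = m" by (subst card_image) auto
      ultimately have "\<bar>S' - S\<bar> \<le> real (n k - m) * B"
        using abs_sum_diff_le_card[of "{..<n k}" "(\<lambda>j. j + i) ` {..<m}" "\<lambda>t. g (x t)" B] B(2) by (simp add: S_def)
      also have "\<dots> \<le> real q * B" using nm B by (intro mult_right_mono) auto
      finally have 1: "\<bar>S' - S\<bar> \<le> real q * B" .
      have S: "\<bar>S\<bar> \<le> real (n k) * B"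
        unfolding S_def using sum_mono[of "{..<n k}" "\<lambda>t. \<bar>g (x t)\<bar>" "\<lambda>_. B"] B(2)
        by (intro order_trans[OF sum_abs]) auto
      have n0: "real (n k) > 0" "real m > 0" using nm i by auto
      have "S' / m - S / n k = (S' - S) / m + S * (real (n k) - real m) / (m * n k)"
        using n0 by (simp add: field_simps)
      also have "\<bar>\<dots>\<bar> \<le> \<bar>S' - S\<bar> / m + \<bar>S\<bar> * (real (n k) - real m) / (m * n k)"
        using n0 nm i by (intro order_trans[OF abs_triangle_ineq]) (simp add: abs_mult abs_of_nonneg)
      also have "\<dots> \<le> real q * B / m + (real (n k) * B) * real q / (m * n k)"
        using 1 S nm B i by (intro add_mono divide_right_mono mult_mono) auto
      also have "\<dots> = 2 * real q * B / m" using n0 by (simp add: field_simps)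
      finally show "\<bar>(\<Sum>j<m. g (x (j + i))) / real m - (\<Sum>t<n k. g (x t)) / real (n k)\<bar> \<le> 2 * real q * B / m"
        by (simp add: S_def S'_def)
    qed
    then show ?case unfolding avg_def emp_def m_def[symmetric] by simp
  qed
  ultimately show ?thesis by (rule Lim_null_comparison[rotated])
qed

text \<open>Being an average pseudo-orbit of vanishing error makes limits of empirical measures invariant.\<close>

lemma emp_shift:
  assumes g: "continuous_on UNIV g"
  shows "((\<lambda>k. emp k (\<lambda>x. g (T x)) - emp k g) \<longlongrightarrow> 0) K"
proof -
  note Tc = tds_continuous[OF tds_T]
  have gT: "continuous_on UNIV (\<lambda>x. g (T x))" by (rule continuous_on_compose2[OF g Tc]) auto
  \<comment> \<open>In windows of length 2 the second coordinate may be replaced by the image of the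
    first; each of the two is then compared with the whole tuple.\<close>
  have "((\<lambda>k. avg 2 k (\<lambda>y. g (y 1) - g (orbit T (y 0) 1))) \<longlongrightarrow> 0) K"
    by (rule avg_orbit) (auto intro!: continuous_on_compose2[OF g continuous_on_coordinate])
  then have "((\<lambda>k. avg 2 k (\<lambda>y. g (y 1)) - avg 2 k (\<lambda>y. g (T (y 0)))) \<longlongrightarrow> 0) K"
    by (simp add: avg_diff)
  from tendsto_diff[OF tendsto_diff[OF avg_coordinate[OF g, of 1 2] avg_coordinate[OF gT, of 0 2]] this]
  show ?thesis by simp
qed

end

text \<open>For a Borel probability measure on a metric space this says that the boundary of
  \<open>A\<close> has measure 0. In terms of continuous minorants and majorants it meets
  convergence tested on continuous functions directly, and it passes easily to complements and
  intersections.\<close>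

definition jordan :: "'a::topological_space measure \<Rightarrow> 'a set \<Rightarrow> bool" where
  "jordan \<mu> A \<longleftrightarrow> (\<forall>e>0. \<exists>\<phi> \<psi>. continuous_on UNIV \<phi> \<and> continuous_on UNIV \<psi> \<and>
     (\<forall>x. 0 \<le> \<phi> x \<and> \<phi> x \<le> indicator A x \<and> indicator A x \<le> \<psi> x \<and> \<psi> x \<le> 1) \<and>
     (\<integral>x. \<psi> x - \<phi> x \<partial>\<mu>) < (e::real))"

locale invariant_net = pseudo_orbit_net T K n d \<nu> + invariant_measure T \<mu>
  for T :: "'a::metric_space \<Rightarrow> 'a" and K :: "'i filter" and n d \<nu> \<mu> +
  assumes emp_lim: "\<And>g. continuous_on UNIV g \<Longrightarrow> ((\<lambda>k. emp k g) \<longlongrightarrow> (\<integral>x. g x \<partial>\<mu>)) K"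
    and K_nontrivial: "K \<noteq> bot"
begin

text \<open>The window is replaced by the orbit of its first coordinate, and the average over first
  coordinates by \<open>emp\<close>, which converges by assumption.\<close>

lemma avg_lim:
  assumes q: "q \<ge> 1" and g: "continuous_on UNIV g"
    and dep: "\<And>y z. (\<And>i. i < q \<Longrightarrow> y i = z i) \<Longrightarrow> g y = g z"
  shows "((\<lambda>k. avg q k g) \<longlongrightarrow> (\<integral>x. g (orbit T x) \<partial>\<mu>)) K"
proof -
  have c: "continuous_on UNIV (\<lambda>x. g (orbit T x))"
    by (rule continuous_on_compose2[OF g continuous_on_orbit[OF tds_continuous[OF tds]]]) auto
  have "((\<lambda>k. avg q k (\<lambda>y. g (orbit T (y 0))) - emp k (\<lambda>x. g (orbit T x))) \<longlongrightarrow> 0) K"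
    using q by (intro avg_coordinate[OF c, of 0 q]) auto
  from tendsto_add[OF tendsto_add[OF avg_orbit[OF q g dep] this] emp_lim[OF c]]
  show ?thesis by (simp add: avg_diff)
qed

text \<open>A portmanteau argument for products. The indicator of the block lies between products of
  continuous functions; as all factors are in [0, 1], the gap of the products is at most the sum of
  the coordinate gaps, whose integrals do not depend on the time by invariance.\<close>

lemma avg_cell_lim:
  assumes q: "q \<ge> 1" and A: "\<And>i. i < q \<Longrightarrow> jordan \<mu> (A i)" "\<And>i. i < q \<Longrightarrow> A i \<in> sets borel"
  shows "((\<lambda>k. avg q k (\<lambda>y. of_bool (\<forall>i<q. y i \<in> A i))) \<longlongrightarrow> measure \<mu> {x. \<forall>i<q. (T ^^ i) x \<in> A i}) K"
proof (rule tendstoI)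
  fix e :: real assume "e > 0"
  \<comment> \<open>Half of \<open>e\<close> is shared by the \<open>q\<close> coordinates; the
    other half absorbs the convergence of the two bounds.\<close>
  define e' where "e' = e / (2 * real q)"
  have e': "e' > 0" using \<open>e > 0\<close> q by (simp add: e'_def)
  define good where "good i \<phi> \<psi> \<longleftrightarrow> continuous_on UNIV \<phi> \<and> continuous_on UNIV \<psi> \<and>
     (\<forall>x. 0 \<le> \<phi> x \<and> \<phi> x \<le> indicator (A i) x \<and> indicator (A i) x \<le> \<psi> x \<and> \<psi> x \<le> 1) \<and>
     (\<integral>x. \<psi> x - \<phi> x \<partial>\<mu>) < e'" for i \<phi> \<psi>
  have "\<exists>\<phi> \<psi>. good i \<phi> \<psi>" if "i < q" for i
    using A(1)[OF that] e' unfolding jordan_def good_def by blast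
  then obtain \<phi> \<psi> where "\<And>i. i < q \<Longrightarrow> good i (\<phi> i) (\<psi> i)" by metis
  then have c: "\<And>i. i < q \<Longrightarrow> continuous_on UNIV (\<phi> i)" "\<And>i. i < q \<Longrightarrow> continuous_on UNIV (\<psi> i)"
    and r: "\<And>i x. i < q \<Longrightarrow> 0 \<le> \<phi> i x" "\<And>i x. i < q \<Longrightarrow> \<phi> i x \<le> indicator (A i) x"
      "\<And>i x. i < q \<Longrightarrow> indicator (A i) x \<le> \<psi> i x" "\<And>i x. i < q \<Longrightarrow> \<psi> i x \<le> 1"
    and s: "\<And>i. i < q \<Longrightarrow> (\<integral>x. \<psi> i x - \<phi> i x \<partial>\<mu>) < e'" unfolding good_def by blast+
  define lo up ind where "lo y = (\<Prod>i<q. \<phi> i (y i))" and "up y = (\<Prod>i<q. \<psi> i (y i))"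
    and "ind y = (\<Prod>i<q. indicator (A i) (y i) :: real)" for y
  have ind: "ind y = of_bool (\<forall>i<q. y i \<in> A i)" for y
    by (auto simp: ind_def indicator_def intro!: prod_zero)
  have lo: "lo y \<le> ind y" for y unfolding lo_def ind_def using r(1,2) by (intro prod_mono) auto
  have up: "ind y \<le> up y" for y unfolding up_def ind_def using r(3) by (intro prod_mono) auto
  have gap: "up y - lo y \<le> (\<Sum>i<q. \<psi> i (y i) - \<phi> i (y i))" for y
  proof -
    have u: "0 \<le> \<phi> i x" "\<phi> i x \<le> 1" "0 \<le> \<psi> i x" "\<psi> i x \<le> 1" "\<phi> i x \<le> \<psi> i x" if "i < q" for i x
      using r[OF that, of x] by (auto simp: indicator_def split: if_splits)
    have "norm (up y - lo y) \<le> (\<Sum>i<q. norm (\<psi> i (y i) - \<phi> i (y i)))"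
      unfolding up_def lo_def using u by (intro norm_prod_diff) auto
    also have "\<dots> = (\<Sum>i<q. \<psi> i (y i) - \<phi> i (y i))" using u by (intro sum.cong) auto
    finally show ?thesis by simp
  qed
  have cl: "continuous_on UNIV lo" "continuous_on UNIV up"
    unfolding lo_def[abs_def] up_def[abs_def]
    by (intro continuous_on_prod continuous_on_compose2[OF c(1) continuous_on_coordinate]
         continuous_on_compose2[OF c(2) continuous_on_coordinate]; simp)+
  have dl: "lo y = lo z" "up y = up z" if "\<And>i. i < q \<Longrightarrow> y i = z i" for y z
    using that by (simp_all add: lo_def up_def)
  have L1: "((\<lambda>k. avg q k lo) \<longlongrightarrow> (\<integral>x. lo (orbit T x) \<partial>\<mu>)) K" by (rule avg_lim[OF q cl(1) dl(1)])
  have L2: "((\<lambda>k. avg q k up) \<longlongrightarrow> (\<integral>x. up (orbit T x) \<partial>\<mu>)) K" by (rule avg_lim[OF q cl(2) dl(2)])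
  note Tc = tds_continuous[OF tds]
  have i1: "integrable \<mu> (\<lambda>x. lo (orbit T x))" "integrable \<mu> (\<lambda>x. up (orbit T x))"
    by (intro integrable_continuous continuous_on_compose2[OF cl(1) continuous_on_orbit[OF Tc]]
        continuous_on_compose2[OF cl(2) continuous_on_orbit[OF Tc]]; simp)+
  define D where "D = {x. \<forall>i<q. (T ^^ i) x \<in> A i}"
  have "D = (\<Inter>i\<in>{..<q}. (T ^^ i) -` A i)" by (auto simp: D_def)
  moreover have "(T ^^ i) -` A i \<in> sets borel" if "i < q" for i
    using measurable_sets[OF measurable_Tn A(2)[OF that], of i] by simp
  ultimately have D: "D \<in> sets \<mu>" using q by (auto intro!: sets.finite_INT simp: lessThan_empty_iff)
  have iD: "ind (orbit T x) = indicator D x" for x by (simp add: ind D_def indicator_def)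
  have m1: "(\<integral>x. lo (orbit T x) \<partial>\<mu>) \<le> measure \<mu> D" "measure \<mu> D \<le> (\<integral>x. up (orbit T x) \<partial>\<mu>)"
  proof -
    have iI: "integrable \<mu> (indicator D :: 'a \<Rightarrow> real)" using D by (simp add: integrable_indicator_iff less_top[symmetric])
    have "(\<integral>x. lo (orbit T x) \<partial>\<mu>) \<le> (\<integral>x. indicator D x \<partial>\<mu>)"
      using lo iD by (intro integral_mono i1 iI) metis
    then show "(\<integral>x. lo (orbit T x) \<partial>\<mu>) \<le> measure \<mu> D" using D by simp
    have "(\<integral>x. indicator D x \<partial>\<mu>) \<le> (\<integral>x. up (orbit T x) \<partial>\<mu>)"
      using up iD by (intro integral_mono i1 iI) metis
    then show "measure \<mu> D \<le> (\<integral>x. up (orbit T x) \<partial>\<mu>)" using D by simp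
  qed
  have ci: "integrable \<mu> (\<lambda>x. \<psi> i ((T ^^ i) x) - \<phi> i ((T ^^ i) x))" if "i < q" for i
    by (intro integrable_continuous continuous_on_diff continuous_on_compose2[OF c(1)[OF that] continuous_on_iterate[OF Tc]]
        continuous_on_compose2[OF c(2)[OF that] continuous_on_iterate[OF Tc]]; simp)
  have "(\<integral>x. up (orbit T x) \<partial>\<mu>) - (\<integral>x. lo (orbit T x) \<partial>\<mu>) = (\<integral>x. up (orbit T x) - lo (orbit T x) \<partial>\<mu>)"
    using i1 by simp
  also have "\<dots> \<le> (\<integral>x. (\<Sum>i<q. \<psi> i ((T ^^ i) x) - \<phi> i ((T ^^ i) x)) \<partial>\<mu>)"
  proof (rule integral_mono)
    show "integrable \<mu> (\<lambda>x. up (orbit T x) - lo (orbit T x))"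
      by (intro Bochner_Integration.integrable_diff i1)
    show "integrable \<mu> (\<lambda>x. \<Sum>i<q. \<psi> i ((T ^^ i) x) - \<phi> i ((T ^^ i) x))"
      using ci by (intro Bochner_Integration.integrable_sum) auto
  qed (use gap in blast)
  also have "\<dots> = (\<Sum>i<q. \<integral>x. \<psi> i ((T ^^ i) x) - \<phi> i ((T ^^ i) x) \<partial>\<mu>)"
    using ci by (intro Bochner_Integration.integral_sum) auto
  also have "\<dots> = (\<Sum>i<q. \<integral>x. \<psi> i x - \<phi> i x \<partial>\<mu>)"
  proof (rule sum.cong[OF refl])
    fix i assume i: "i \<in> {..<q}"
    show "(\<integral>x. \<psi> i ((T ^^ i) x) - \<phi> i ((T ^^ i) x) \<partial>\<mu>) = (\<integral>x. \<psi> i x - \<phi> i x \<partial>\<mu>)"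
      using c i by (intro integral_Tn borel_measurable_continuous_onI continuous_on_diff) auto
  qed
  also have "\<dots> \<le> (\<Sum>i<q. e')" using s by (intro sum_mono less_imp_le) auto
  also have "\<dots> = e / 2" using q by (simp add: e'_def)
  finally have gapI: "(\<integral>x. up (orbit T x) \<partial>\<mu>) \<le> (\<integral>x. lo (orbit T x) \<partial>\<mu>) + e / 2" by simp
  have "\<forall>\<^sub>F k in K. (\<integral>x. lo (orbit T x) \<partial>\<mu>) - e / 2 < avg q k lo"
    using \<open>e > 0\<close> by (intro order_tendstoD(1)[OF L1]) simp
  moreover have "\<forall>\<^sub>F k in K. avg q k up < (\<integral>x. up (orbit T x) \<partial>\<mu>) + e / 2"
    using \<open>e > 0\<close> by (intro order_tendstoD(2)[OF L2]) simp
  ultimately show "\<forall>\<^sub>F k in K. dist (avg q k (\<lambda>y. of_bool (\<forall>i<q. y i \<in> A i))) (measure \<mu> {x. \<forall>i<q. (T ^^ i) x \<in> A i}) < e"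
  proof eventually_elim
    case (elim k)
    have "avg q k lo \<le> avg q k ind" "avg q k ind \<le> avg q k up" using lo up by (auto intro: avg_mono)
    then have "\<bar>avg q k ind - measure \<mu> D\<bar> < e" using elim m1 gapI by (simp add: abs_less_iff)
    then show ?case by (simp add: ind[abs_def] D_def dist_real_def)
  qed
qed

end

section \<open>Misiurewicz's estimate along a net\<close>

locale potential_net = invariant_net T K n d \<nu> \<mu> + invariant_potential T F \<mu>
  for T :: "'a::metric_space \<Rightarrow> 'a" and K :: "'i filter" and n d \<nu> \<mu> F
begin

text \<open>Word entropy and expected potential are added before cutting, since both are subadditive
  in position and length. Jensen's inequality replaces the mean over positions of the entropies of
  \<open>q\<close>-words by the entropy of their averaged law, and all that is left converges along
  the net.\<close>

lemma block_entropy_bound: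
  assumes P: "finite_borel_partition P" and jordan: "\<And>A. A \<in> P \<Longrightarrow> jordan \<mu> A"
    and big: "\<forall>\<^sub>F k in K. a * real (n k) \<le>
      word_entropy (measure_pmf (\<nu> k)) P (\<lambda>i x. cell P (x i)) 0 (n k) + ex k (bF (n k))"
    and q: "q \<ge> 1"
  shows "real q * a \<le> word_entropy \<mu> P (itinerary T P) 0 q + If q"
proof -
  note partition = partition_P[OF P]
  define c where "c i x = cell P (x i)" for i :: nat and x :: "nat \<Rightarrow> 'a"
  interpret sp: symbolic_process "measure_pmf (\<nu> k)" P c for k
    by unfold_locales (use partition cell_in(1)[OF partition(2)] in \<open>auto simp: c_def\<close>)
  obtain C where C: "C \<ge> 0" "\<And>y. bF 1 y \<le> C" using bF_1_bounded by blast
  define W where "W k j l = word_entropy (measure_pmf (\<nu> k)) P c j l" for k j l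
  define u where "u k j l = W k j l + ex k (\<lambda>x. bF l (\<lambda>i. x (j + i)))" for k j l
  define C' where "C' = ln (card P) + C"
  have "card P \<ge> 1" using sp.S_nonempty partition(1) by (simp add: card_gt_0_iff Suc_le_eq)
  then have C': "C' \<ge> 0" using C by (simp add: C'_def)
  have usub: "u k j (l + l') \<le> u k j l + u k (j + l) l'" if "l \<ge> 1" "l' \<ge> 1" for k j l l'
  proof -
    have "ex k (\<lambda>x. bF (l + l') (\<lambda>i. x (j + i))) \<le> ex k (\<lambda>x. bF l (\<lambda>i. x (j + i)) + bF l' (\<lambda>i. x (j + l + i)))"
      using bF_subadditive[OF that] by (intro ex_mono) (simp add: add.assoc)
    then show ?thesis using sp.word_entropy_subadditive[of k j l l'] by (simp add: u_def W_def)
  qed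
  have u1: "u k j 1 \<le> C'" for k j
  proof -
    have "ex k (\<lambda>x. bF 1 (\<lambda>i. x (j + i))) \<le> ex k (\<lambda>x. C)" using C by (intro ex_mono)
    then show ?thesis using sp.word_entropy_le[of k j 1] by (simp add: u_def W_def C'_def)
  qed
  define p where "p k w = avg q k (\<lambda>y. of_bool (\<forall>i<q. y i \<in> w i))" for k w
  have p0: "p k w \<ge> 0" for k w
    using avg_mono[of "\<lambda>_. 0" "\<lambda>y. of_bool (\<forall>i<q. y i \<in> w i)" q k] by (simp add: p_def avg_def)
  have pj: "measure (\<nu> k) {x. word c j q x = w} = ex k (\<lambda>x. of_bool (\<forall>i<q. x (j + i) \<in> w i))"
    if w: "w \<in> words q P" for w k j
  proof -
    have "word c j q x = w \<longleftrightarrow> (\<forall>i<q. x (j + i) \<in> w i)" for x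
      unfolding word_eq_iff[OF w] using cell_eq_iff[OF partition(2)] PiE_mem[OF w] by (auto simp: c_def)
    then have "(\<lambda>x. of_bool (\<forall>i<q. x (j + i) \<in> w i)) = (indicator {x. word c j q x = w} :: _ \<Rightarrow> real)"
      by (auto simp: fun_eq_iff indicator_def)
    then show ?thesis by simp
  qed
  \<comment> \<open>The factor on the left is \<open>n k\<close> divided by the number of windows.
    As \<open>a\<close> may be negative, this quotient is kept exact and sent to 1 in the
    limit.\<close>
  have ineq: "\<forall>\<^sub>F k in K. real q * a * (1 + (real q - 1) / real (n k - q + 1)) \<le>
      (\<Sum>w\<in>words q P. eta (p k w)) + avg q k (bF q) + 2 * (real q)^2 * C' / real (n k - q + 1)"
    using big eventually_n_ge[of q]
  proof eventually_elim
    case (elim k)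
    define m where "m = n k - q + 1"
    have nm: "real (n k) = real m + real q - 1" "real m > 0" using elim(2) q by (auto simp: m_def of_nat_diff)
    have "real q * a * real (n k) \<le> real q * u k 0 (n k)"
      using mult_left_mono[OF elim(1), of "real q"] by (simp add: u_def W_def c_def[abs_def] mult.assoc)
    also have "\<dots> \<le> (\<Sum>j<m. u k j q) + 2 * (real q)^2 * C'"
      using subadditive_array_blocks[of "u k" C' q "n k"] usub u1 C' q elim(2) by (simp add: m_def)
    also have "(\<Sum>j<m. u k j q) = (\<Sum>j<m. W k j q) + real m * avg q k (bF q)"
      unfolding avg_eq m_def[symmetric] u_def sum.distrib using nm(2) by simp
    also have "(\<Sum>j<m. W k j q) \<le> real m * (\<Sum>w\<in>words q P. eta (p k w))"
    proof -
      have "(\<Sum>j<m. W k j q) = (\<Sum>w\<in>words q P. \<Sum>j<m. eta (ex k (\<lambda>x. of_bool (\<forall>i<q. x (j + i) \<in> w i))))"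
        unfolding W_def word_entropy_def Hent_def by (subst sum.swap) (simp add: pj)
      also have "\<dots> \<le> (\<Sum>w\<in>words q P. real m * eta (p k w))"
      proof (rule sum_mono)
        fix w
        have "p k w = (\<Sum>j<m. ex k (\<lambda>x. of_bool (\<forall>i<q. x (j + i) \<in> w i))) / real m"
          unfolding p_def avg_eq m_def ..
        then show "(\<Sum>j<m. eta (ex k (\<lambda>x. of_bool (\<forall>i<q. x (j + i) \<in> w i)))) \<le> real m * eta (p k w)"
          using eta_jensen[of "{..<m}" "\<lambda>j. ex k (\<lambda>x. of_bool (\<forall>i<q. x (j + i) \<in> w i))"] nm
          by (auto simp: lessThan_empty_iff)
      qed
      finally show ?thesis by (simp add: sum_distrib_left)
    qed
    finally have "real q * a * real (n k) \<le> real m * ((\<Sum>w\<in>words q P. eta (p k w)) + avg q k (bF q)) + 2 * (real q)^2 * C'"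
      by (simp add: algebra_simps)
    then have "real q * a * real (n k) / m \<le>
        (real m * ((\<Sum>w\<in>words q P. eta (p k w)) + avg q k (bF q)) + 2 * (real q)^2 * C') / m"
      using nm by (intro divide_right_mono) auto
    also have "\<dots> = (\<Sum>w\<in>words q P. eta (p k w)) + avg q k (bF q) + 2 * (real q)^2 * C' / m"
      using nm(2) by (simp add: add_divide_distrib)
    also have "real q * a * real (n k) / m = real q * a * (1 + (real q - 1) / m)"
      using nm(2) unfolding nm(1) by (simp add: field_simps)
    finally show ?case by (simp add: m_def)
  qed
  have inv_m: "((\<lambda>k. b / real (n k - q + 1)) \<longlongrightarrow> 0) K" for b
    by (intro tendsto_divide_0[OF tendsto_const] filterlim_at_top_imp_at_infinity real_block_count_at_top)
  have "((\<lambda>k. real q * a * (1 + (real q - 1) / real (n k - q + 1))) \<longlongrightarrow> real q * a * (1 + 0)) K"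
    by (intro tendsto_intros inv_m)
  moreover have "((\<lambda>k. (\<Sum>w\<in>words q P. eta (p k w)) + avg q k (bF q) + 2 * (real q)^2 * C' / real (n k - q + 1))
     \<longlongrightarrow> word_entropy \<mu> P (itinerary T P) 0 q + If q + 0) K"
  proof (intro tendsto_add inv_m)
    show "((\<lambda>k. avg q k (bF q)) \<longlongrightarrow> If q) K"
      unfolding If_def induced_eq[abs_def] by (intro avg_lim q continuous_bF bF_dep)
    show "((\<lambda>k. \<Sum>w\<in>words q P. eta (p k w)) \<longlongrightarrow> word_entropy \<mu> P (itinerary T P) 0 q) K"
      unfolding word_entropy_def Hent_def
    proof (rule tendsto_sum)
      fix w assume w: "w \<in> words q P"
      have "word (itinerary T P) 0 q x = w \<longleftrightarrow> (\<forall>i<q. (T ^^ i) x \<in> w i)" for x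
        unfolding word_eq_iff[OF w] using cell_eq_iff[OF partition(2)] PiE_mem[OF w] by (auto simp: itinerary_def)
      then have "((\<lambda>k. p k w) \<longlongrightarrow> measure \<mu> {x. word (itinerary T P) 0 q x = w}) K"
        unfolding p_def using avg_cell_lim[OF q, of w] jordan partition(3) PiE_mem[OF w] by simp
      then show "((\<lambda>k. eta (p k w)) \<longlongrightarrow> eta (measure \<mu> {x. word (itinerary T P) 0 q x = w})) K"
        using p0 by (intro eta_tendsto) auto
    qed
  qed
  ultimately have "real q * a * (1 + 0) \<le> word_entropy \<mu> P (itinerary T P) 0 q + If q + 0"
    using ineq by (intro tendsto_le[OF K_nontrivial])
  then show ?thesis by simp
qed

lemma entropy_bound:
  assumes P: "finite_borel_partition P" and jordan: "\<And>A. A \<in> P \<Longrightarrow> jordan \<mu> A"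
    and big: "\<forall>\<^sub>F k in K. a * real (n k) \<le>
      word_entropy (measure_pmf (\<nu> k)) P (\<lambda>i x. cell P (x i)) 0 (n k) + ex k (bF (n k))"
    and fin: "asymptotic_mean f \<mu> > - \<infinity>"
  shows "ereal a \<le> ks_entropy T \<mu> + asymptotic_mean f \<mu>"
proof -
  let ?H = "\<lambda>q. word_entropy \<mu> P (itinerary T P) 0 q"
  obtain r where r: "asymptotic_mean f \<mu> = ereal r"
    using fin asymptotic_mean_less_infinity by (cases "asymptotic_mean f \<mu>") auto
  obtain h where h: "entropy_wrt T \<mu> P = ereal h"
    using entropy_wrt_finite[OF P] by (cases "entropy_wrt T \<mu> P") auto
  have "(\<lambda>q. ?H q / real q + If q / real q) \<longlonglongrightarrow> h + r"
    using entropy_wrt_limit(1)[OF P] asymptotic_mean_limit(1) unfolding r h by (intro tendsto_add) auto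
  moreover have "\<forall>\<^sub>F q in sequentially. a \<le> ?H q / real q + If q / real q"
    using eventually_ge_at_top[of 1]
  proof eventually_elim
    case (elim q)
    then show ?case using block_entropy_bound[OF P jordan big elim] by (simp add: field_simps)
  qed
  ultimately have "a \<le> h + r" by (rule tendsto_lowerbound) simp
  then have "ereal a \<le> entropy_wrt T \<mu> P + asymptotic_mean f \<mu>" by (simp add: r h)
  also have "\<dots> \<le> ks_entropy T \<mu> + asymptotic_mean f \<mu>"
    unfolding ks_entropy_def using P by (intro add_right_mono SUP_upper) auto
  finally show ?thesis .
qed

end

subsection \<open>Partitions into small continuity sets\<close>

lemma jordan_Compl:
  assumes "jordan \<mu> A" shows "jordan \<mu> (- A)"
  unfolding jordan_def
proof (intro allI impI)
  fix e :: real assume "e > 0"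
  then obtain \<phi> \<psi> where *: "continuous_on UNIV \<phi>" "continuous_on UNIV \<psi>"
     "\<And>x. 0 \<le> \<phi> x \<and> \<phi> x \<le> indicator A x \<and> indicator A x \<le> \<psi> x \<and> \<psi> x \<le> 1"
     "(\<integral>x. \<psi> x - \<phi> x \<partial>\<mu>) < e" using assms unfolding jordan_def by blast
  have **: "0 \<le> 1 - \<psi> x \<and> 1 - \<psi> x \<le> indicator (- A) x \<and> indicator (- A) x \<le> 1 - \<phi> x \<and> 1 - \<phi> x \<le> 1" for x
    using *(3)[of x] by (cases "x \<in> A") auto
  show "\<exists>\<phi> \<psi>. continuous_on UNIV \<phi> \<and> continuous_on UNIV \<psi> \<and>
     (\<forall>x. 0 \<le> \<phi> x \<and> \<phi> x \<le> indicator (- A) x \<and> indicator (- A) x \<le> \<psi> x \<and> \<psi> x \<le> 1) \<and>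
     (\<integral>x. \<psi> x - \<phi> x \<partial>\<mu>) < e"
    by (rule exI[of _ "\<lambda>x. 1 - \<psi> x"], rule exI[of _ "\<lambda>x. 1 - \<phi> x"])
      (use *(1,2,4) ** in \<open>auto intro!: continuous_intros\<close>)
qed

context invariant_measure
begin

lemma jordan_Int:
  assumes "jordan \<mu> A" "jordan \<mu> B" shows "jordan \<mu> (A \<inter> B)"
  unfolding jordan_def
proof (intro allI impI)
  fix e :: real assume "e > 0"
  then have "e / 2 > 0" by simp
  obtain \<phi> \<psi> where 1: "continuous_on UNIV \<phi>" "continuous_on UNIV \<psi>"
     "\<And>x. 0 \<le> \<phi> x \<and> \<phi> x \<le> indicator A x \<and> indicator A x \<le> \<psi> x \<and> \<psi> x \<le> 1"
     "(\<integral>x. \<psi> x - \<phi> x \<partial>\<mu>) < e / 2" using assms(1) \<open>e / 2 > 0\<close> unfolding jordan_def by blast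
  obtain \<phi>' \<psi>' where 2: "continuous_on UNIV \<phi>'" "continuous_on UNIV \<psi>'"
     "\<And>x. 0 \<le> \<phi>' x \<and> \<phi>' x \<le> indicator B x \<and> indicator B x \<le> \<psi>' x \<and> \<psi>' x \<le> 1"
     "(\<integral>x. \<psi>' x - \<phi>' x \<partial>\<mu>) < e / 2" using assms(2) \<open>e / 2 > 0\<close> unfolding jordan_def by blast
  have ge: "\<phi> x \<le> \<psi> x" "\<phi>' x \<le> \<psi>' x" "0 \<le> \<psi> x" "\<phi>' x \<le> 1" for x
    using 1(3)[of x] 2(3)[of x] by (auto simp: indicator_def split: if_splits)
  have b: "0 \<le> \<phi> x * \<phi>' x \<and> \<phi> x * \<phi>' x \<le> indicator (A \<inter> B) x \<and>
      indicator (A \<inter> B) x \<le> \<psi> x * \<psi>' x \<and> \<psi> x * \<psi>' x \<le> 1" for x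
    using 1(3)[of x] 2(3)[of x] mult_mono[of "\<phi> x" "indicator A x" "\<phi>' x" "indicator B x"]
      mult_mono[of "indicator A x" "\<psi> x" "indicator B x" "\<psi>' x"] mult_le_one[of "\<psi> x" "\<psi>' x"] ge[of x]
    by (auto simp: indicator_inter_arith)
  have c: "continuous_on UNIV (\<lambda>x. \<phi> x * \<phi>' x)" "continuous_on UNIV (\<lambda>x. \<psi> x * \<psi>' x)"
    "continuous_on UNIV (\<lambda>x. \<psi> x - \<phi> x)" "continuous_on UNIV (\<lambda>x. \<psi>' x - \<phi>' x)"
    using 1 2 by (auto intro!: continuous_intros)
  have "(\<integral>x. \<psi> x * \<psi>' x - \<phi> x * \<phi>' x \<partial>\<mu>) \<le> (\<integral>x. (\<psi> x - \<phi> x) + (\<psi>' x - \<phi>' x) \<partial>\<mu>)"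
  proof (rule integral_mono)
    fix x
    have "\<psi> x * \<psi>' x - \<phi> x * \<phi>' x = \<psi> x * (\<psi>' x - \<phi>' x) + \<phi>' x * (\<psi> x - \<phi> x)"
      by (simp add: algebra_simps)
    also have "\<dots> \<le> 1 * (\<psi>' x - \<phi>' x) + 1 * (\<psi> x - \<phi> x)"
      using ge[of x] 1(3)[of x] by (intro add_mono mult_right_mono) auto
    finally show "\<psi> x * \<psi>' x - \<phi> x * \<phi>' x \<le> (\<psi> x - \<phi> x) + (\<psi>' x - \<phi>' x)" by simp
  qed (use c in \<open>auto intro!: integrable_continuous continuous_intros\<close>)
  also have "\<dots> < e" using 1(4) 2(4) c by (subst Bochner_Integration.integral_add) auto
  finally show "\<exists>\<phi> \<psi>. continuous_on UNIV \<phi> \<and> continuous_on UNIV \<psi> \<and>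
     (\<forall>x. 0 \<le> \<phi> x \<and> \<phi> x \<le> indicator (A \<inter> B) x \<and> indicator (A \<inter> B) x \<le> \<psi> x \<and> \<psi> x \<le> 1) \<and>
     (\<integral>x. \<psi> x - \<phi> x \<partial>\<mu>) < e" using b c(1,2) by blast
qed

text \<open>Only countably many spheres around \<open>p\<close> have positive measure.\<close>

lemma jordan_ball:
  assumes "e > 0"
  obtains r where "r > 0" "r < e" "jordan \<mu> (ball p r)"
proof -
  define D where "D = distr \<mu> borel (dist p)"
  have md: "dist p \<in> borel_measurable \<mu>"
    using borel_measurable_continuous_onI[of "dist p"] by (simp add: continuous_on_dist)
  interpret D: prob_space D unfolding D_def by (rule prob_space_distr[OF md])
  have "uncountable {0<..<e}" using assms by (simp add: uncountable_open_interval)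
  then obtain r where r: "r \<in> {0<..<e}" "r \<notin> {x. measure D {x} \<noteq> 0}"
    using D.countable_support by (metis countable_subset subsetI)
  then have sphere: "measure \<mu> {x. dist p x = r} = 0"
    using measure_distr[OF md, of "{r}"] by (simp add: D_def vimage_def)
  have cd: "continuous_on UNIV (dist p)" by (intro continuous_intros)
  \<comment> \<open>Ramps of slope \<open>m\<close> on the two sides of the sphere. Both are 1, or
    both are 0, as soon as \<open>m\<close> times the difference of \<open>dist p x\<close> and
    \<open>r\<close> exceeds 1 in absolute value.\<close>
  define \<phi> where "\<phi> m x = max 0 (min 1 (real m * (r - dist p x)))" for m x
  define \<psi> where "\<psi> m x = max 0 (min 1 (1 - real m * (dist p x - r)))" for m x
  have c: "continuous_on UNIV (\<phi> m)" "continuous_on UNIV (\<psi> m)" for m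
    unfolding \<phi>_def[abs_def] \<psi>_def[abs_def] by (intro continuous_intros)+
  have b: "0 \<le> \<phi> m x \<and> \<phi> m x \<le> indicator (ball p r) x \<and> indicator (ball p r) x \<le> \<psi> m x \<and> \<psi> m x \<le> 1" for m x
  proof -
    have "real m * (r - dist p x) \<le> 0" if "\<not> dist p x < r" using that by (intro mult_nonneg_nonpos) auto
    moreover have "real m * (dist p x - r) \<le> 0" if "dist p x < r" using that by (intro mult_nonneg_nonpos) auto
    ultimately show ?thesis
      by (cases "dist p x < r") (auto simp: \<phi>_def \<psi>_def max_def)
  qed
  have ae: "AE x in \<mu>. (\<lambda>m. \<psi> m x - \<phi> m x) \<longlonglongrightarrow> 0"
  proof -
    have "{x. dist p x = r} = dist p -` {r} \<inter> space \<mu>" by auto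
    then have "{x. dist p x = r} \<in> sets \<mu>" using measurable_sets[OF md, of "{r}"] by simp
    then have "{x. dist p x = r} \<in> null_sets \<mu>" using sphere by (simp add: null_sets_def emeasure_eq_measure)
    then have "AE x in \<mu>. x \<notin> {x. dist p x = r}" by (rule AE_not_in)
    then have "AE x in \<mu>. dist p x \<noteq> r" by simp
    then show ?thesis
    proof eventually_elim
      fix x assume x: "dist p x \<noteq> r"
      obtain m0 :: nat where m0: "real m0 * \<bar>r - dist p x\<bar> > 1"
        using reals_Archimedean3[of "\<bar>r - dist p x\<bar>"] x by auto
      have "\<psi> m x - \<phi> m x = 0" if "m \<ge> m0" for m
      proof -
        have "real m * \<bar>r - dist p x\<bar> \<ge> real m0 * \<bar>r - dist p x\<bar>" using that by (intro mult_right_mono) auto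
        then have "real m * \<bar>r - dist p x\<bar> > 1" using m0 by linarith
        then show ?thesis by (auto simp: \<phi>_def \<psi>_def abs_if algebra_simps split: if_splits)
      qed
      then show "(\<lambda>m. \<psi> m x - \<phi> m x) \<longlonglongrightarrow> 0"
        by (intro tendsto_eventually eventually_sequentiallyI)
    qed
  qed
  have "(\<lambda>m. \<integral>x. \<psi> m x - \<phi> m x \<partial>\<mu>) \<longlonglongrightarrow> (\<integral>x. 0 \<partial>\<mu>)"
  proof (rule integral_dominated_convergence[where w = "\<lambda>_. 1"])
    show "AE x in \<mu>. norm (\<psi> m x - \<phi> m x) \<le> 1" for m
      using b[of m] by (auto simp: abs_le_iff indicator_def split: if_splits intro!: AE_I2) (smt (verit) b indicator_def)+
    show "(\<lambda>x. \<psi> m x - \<phi> m x) \<in> borel_measurable \<mu>" for m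
      unfolding measurable_cong_sets[OF sets_mu refl]
      by (intro borel_measurable_continuous_onI continuous_on_diff c)
  qed (use ae in auto)
  then have lim: "(\<lambda>m. \<integral>x. \<psi> m x - \<phi> m x \<partial>\<mu>) \<longlonglongrightarrow> 0" by simp
  have "jordan \<mu> (ball p r)" unfolding jordan_def
  proof (intro allI impI)
    fix e :: real assume "e > 0"
    then have "\<forall>\<^sub>F m in sequentially. (\<integral>x. \<psi> m x - \<phi> m x \<partial>\<mu>) < e" by (rule order_tendstoD(2)[OF lim])
    from eventually_happens'[OF sequentially_bot this] obtain m where "(\<integral>x. \<psi> m x - \<phi> m x \<partial>\<mu>) < e" ..
    then show "\<exists>\<phi> \<psi>. continuous_on UNIV \<phi> \<and> continuous_on UNIV \<psi> \<and>
     (\<forall>x. 0 \<le> \<phi> x \<and> \<phi> x \<le> indicator (ball p r) x \<and> indicator (ball p r) x \<le> \<psi> x \<and> \<psi> x \<le> 1) \<and>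
     (\<integral>x. \<psi> x - \<phi> x \<partial>\<mu>) < e"
      by (intro exI[of _ "\<phi> m"] exI[of _ "\<psi> m"]) (use b c in simp)
  qed
  then show ?thesis using that r by auto
qed

text \<open>The first ball of a finite cover that contains \<open>x\<close> labels the cell of \<open>x\<close>.\<close>

lemma small_jordan_partition:
  assumes "e > 0"
  obtains P where "finite_borel_partition P" "\<And>A. A \<in> P \<Longrightarrow> jordan \<mu> A"
    "\<And>A x y. A \<in> P \<Longrightarrow> x \<in> A \<Longrightarrow> y \<in> A \<Longrightarrow> dist x y \<le> e"
proof -
  have "\<exists>r. r > 0 \<and> r < e / 2 \<and> jordan \<mu> (ball p r)" for p
    using jordan_ball[of "e / 2" p] assms by (metis half_gt_zero)
  then obtain r where r: "\<And>p. r p > 0" "\<And>p. r p < e / 2" "\<And>p. jordan \<mu> (ball p (r p))" by metis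
  have "UNIV \<subseteq> (\<Union>p\<in>UNIV. ball p (r p))" using r(1) by auto
  then obtain Q where Q: "finite Q" "UNIV \<subseteq> (\<Union>p\<in>Q. ball p (r p))"
    using compactE_image[OF tds_compact[OF tds], of UNIV "\<lambda>p. ball p (r p)"] by auto
  obtain ps where ps: "set ps = Q" using finite_list[OF Q(1)] by blast
  define N where "N = length ps"
  define B where "B i = ball (ps ! i) (r (ps ! i))" for i
  have cover: "\<exists>i<N. x \<in> B i" for x
  proof -
    obtain p where "p \<in> set ps" "x \<in> ball p (r p)" using Q(2) ps by blast
    then show ?thesis unfolding B_def N_def in_set_conv_nth by blast
  qed
  define A where "A i = B i \<inter> (\<Inter>j<i. - B j)" for i
  \<comment> \<open>Empty differences are removed because a partition consists of nonempty
    sets.\<close>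
  define P where "P = A ` {..<N} - {{}}"
  have jA: "jordan \<mu> (A i)" for i
  proof -
    have "jordan \<mu> (B i \<inter> (\<Inter>j<l. - B j))" for l
    proof (induction l)
      case 0 then show ?case using r(3) by (simp add: B_def)
    next
      case (Suc l)
      have "B i \<inter> (\<Inter>j<Suc l. - B j) = (B i \<inter> (\<Inter>j<l. - B j)) \<inter> - B l" by (auto simp: lessThan_Suc)
      then show ?case using Suc jordan_Int jordan_Compl[of \<mu> "B l"] r(3) by (simp add: B_def)
    qed
    then show ?thesis by (simp add: A_def)
  qed
  have mA: "A i \<in> sets borel" for i
  proof -
    have "A i = B i - (\<Union>j<i. B j)" by (auto simp: A_def)
    moreover have "open (\<Union>j<i. B j)" "open (B i)" by (auto simp: B_def)
    ultimately show ?thesis by (simp add: borel_open sets.Diff)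
  qed
  show ?thesis
  proof
    have "disjoint (A ` {..<N})"
    proof (rule disjointI)
      fix a b assume "a \<in> A ` {..<N}" "b \<in> A ` {..<N}" "a \<noteq> b"
      then obtain i j where "a = A i" "b = A j" "i \<noteq> j" by auto
      then show "a \<inter> b = {}" by (cases "i < j") (auto simp: A_def)
    qed
    moreover have "\<Union> P = UNIV"
    proof -
      have "x \<in> \<Union> P" for x
      proof -
        define i where "i = (LEAST i. i < N \<and> x \<in> B i)"
        have i: "i < N" "x \<in> B i" using LeastI_ex[OF cover[of x, unfolded Bex_def]] by (auto simp: i_def)
        have "x \<notin> B j" if "j < i" for j
          using not_less_Least[of j "\<lambda>i. i < N \<and> x \<in> B i"] that i by (auto simp: i_def)
        then have "x \<in> A i" using i by (auto simp: A_def)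
        then show ?thesis using i by (auto simp: P_def)
      qed
      then show ?thesis by auto
    qed
    ultimately have "partition_on UNIV P"
      unfolding partition_on_def P_def by (auto simp: disjoint_def)
    then show "finite_borel_partition P" using mA by (auto simp: finite_borel_partition_def P_def)
    show "jordan \<mu> a" if "a \<in> P" for a using that jA by (auto simp: P_def)
    show "dist x y \<le> e" if "a \<in> P" "x \<in> a" "y \<in> a" for a x y
    proof -
      obtain i where "a = A i" using \<open>a \<in> P\<close> by (auto simp: P_def)
      then have "x \<in> B i" "y \<in> B i" using that by (auto simp: A_def)
      then have "dist (ps ! i) x < e / 2" "dist (ps ! i) y < e / 2" using r(2)[of "ps ! i"] by (auto simp: B_def)
      then show ?thesis using dist_triangle3[of x y "ps ! i"] by linarith
    qed
  qed
qed

end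

subsection \<open>Measures on compact metric spaces\<close>

text \<open>The functions are 1 on \<open>A\<close> and eventually 0 at each point off
  \<open>A\<close>. The empty set is excluded: \<open>infdist x {}\<close> is 0 by convention, which
  would make the functions constantly 1.\<close>

lemma closed_approximation:
  fixes A :: "'a::metric_space set"
  assumes "closed A" "A \<noteq> {}" "prob_space N" "sets N = sets borel"
  shows "(\<lambda>m. \<integral>x. max 0 (1 - real m * infdist x A) \<partial>N) \<longlonglongrightarrow> measure N A"
proof -
  interpret N: prob_space N by fact
  have A: "A \<in> sets N" using assms by simp
  have "(\<lambda>m. \<integral>x. max 0 (1 - real m * infdist x A) \<partial>N) \<longlonglongrightarrow> (\<integral>x. indicator A x \<partial>N)"
  proof (rule integral_dominated_convergence[where w = "\<lambda>_. 1"])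
    show "(\<lambda>x. max 0 (1 - real m * infdist x A)) \<in> borel_measurable N" for m
      unfolding measurable_cong_sets[OF assms(4) refl]
      by (intro borel_measurable_continuous_onI continuous_intros)
    show "AE x in N. (\<lambda>m. max 0 (1 - real m * infdist x A)) \<longlonglongrightarrow> indicator A x"
    proof (rule AE_I2)
      fix x
      show "(\<lambda>m. max 0 (1 - real m * infdist x A)) \<longlonglongrightarrow> indicator A x"
      proof (cases "x \<in> A")
        case True
        then show ?thesis by simp
      next
        case False
        then have "infdist x A > 0"
          using assms(1,2) in_closed_iff_infdist_zero infdist_nonneg[of x A] by (metis less_le)
        then obtain m0 :: nat where m0: "real m0 * infdist x A > 1" using reals_Archimedean3 by blast
        have "max 0 (1 - real m * infdist x A) = 0" if "m \<ge> m0" for m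
        proof -
          have "real m * infdist x A \<ge> real m0 * infdist x A"
            using that infdist_nonneg[of x A] by (intro mult_right_mono) auto
          then show ?thesis using m0 by simp
        qed
        then show ?thesis using False by (auto intro!: tendsto_eventually eventually_sequentiallyI)
      qed
    qed
    show "AE x in N. norm (max 0 (1 - real m * infdist x A)) \<le> 1" for m
    proof (rule AE_I2)
      fix x
      have "0 \<le> real m * infdist x A" using infdist_nonneg by (intro mult_nonneg_nonneg) auto
      then show "norm (max 0 (1 - real m * infdist x A)) \<le> 1" by simp
    qed
  qed (use A in auto)
  then show ?thesis using A by simp
qed

text \<open>Closed sets are stable under intersection and generate the Borel sets, and their
  measures are limits of integrals of continuous functions.\<close>

lemma prob_eqI_continuous:
  fixes M N :: "'a::metric_space measure"
  assumes "prob_space M" "prob_space N" and sets: "sets M = sets borel" "sets N = sets borel"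
    and eq: "\<And>g :: 'a \<Rightarrow> real. continuous_on UNIV g \<Longrightarrow> (\<integral>x. g x \<partial>M) = (\<integral>x. g x \<partial>N)"
  shows "M = N"
proof (rule measure_eqI_generator_eq[where \<Omega> = UNIV and E = "Collect closed" and A = "\<lambda>_. UNIV"])
  interpret M: prob_space M by fact
  interpret N: prob_space N by fact
  show "Int_stable (Collect closed :: 'a set set)" by (auto simp: Int_stable_def)
  show "sets M = sigma_sets UNIV (Collect closed)" "sets N = sigma_sets UNIV (Collect closed)"
    using sets unfolding borel_eq_closed by simp_all
  show "emeasure M UNIV \<noteq> \<infinity>" for i :: nat using M.emeasure_finite by simp
  fix A :: "'a set" assume "A \<in> Collect closed"
  then have A: "closed A" by simp
  show "emeasure M A = emeasure N A"
  proof (cases "A = {}")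
    case False
    have "(\<integral>x. max 0 (1 - real m * infdist x A) \<partial>M) = (\<integral>x. max 0 (1 - real m * infdist x A) \<partial>N)" for m
      by (intro eq continuous_intros)
    then have "measure M A = measure N A"
      using closed_approximation[OF A False assms(1) sets(1)] closed_approximation[OF A False assms(2) sets(2)]
        LIMSEQ_unique by auto
    then show ?thesis by (simp add: M.emeasure_eq_measure N.emeasure_eq_measure)
  qed simp
qed auto

lemma invariant_measure_I:
  fixes T :: "'a::metric_space \<Rightarrow> 'a"
  assumes "tds T" "prob_space \<mu>" "sets \<mu> = sets borel"
    and eq: "\<And>g :: 'a \<Rightarrow> real. continuous_on UNIV g \<Longrightarrow> (\<integral>x. g (T x) \<partial>\<mu>) = (\<integral>x. g x \<partial>\<mu>)"
  shows "\<mu> \<in> invariant_measures T"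
proof -
  interpret prob_space \<mu> by fact
  have T: "T \<in> measurable \<mu> \<mu>"
    using borel_measurable_continuous_onI[OF tds_continuous[OF assms(1)]] assms(3)
    by (simp cong: measurable_cong_sets)
  have "distr \<mu> \<mu> T = \<mu>"
  proof (rule prob_eqI_continuous)
    fix g :: "'a \<Rightarrow> real" assume g: "continuous_on UNIV g"
    have "g \<in> borel_measurable \<mu>"
      using borel_measurable_continuous_onI[OF g] assms(3) by (simp cong: measurable_cong_sets)
    then show "(\<integral>x. g x \<partial>distr \<mu> \<mu> T) = (\<integral>x. g x \<partial>\<mu>)" using T eq[OF g] by (simp add: integral_distr)
  qed (use assms prob_space_distr[OF T] in auto)
  then show ?thesis using assms by (simp add: invariant_measures_def)
qed

section \<open>Sequential compactness of probability measures through a coding by reals\<close>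

text \<open>
  The ternary digits of \<open>\<phi> x\<close> record which members of a countable family of small balls contain \<open>x\<close>,
  so \<open>\<phi>\<close> is an injection with uniformly continuous inverse (it need not be continuous itself).
\<close>

lemma ternary_coding:
  assumes comp: "compact (UNIV :: 'a::metric_space set)"
  obtains \<phi> :: "'a::metric_space \<Rightarrow> real" where "\<And>x. 0 \<le> \<phi> x" "\<And>x. \<phi> x \<le> 3 / 2"
    "\<And>e. e > 0 \<Longrightarrow> \<exists>\<delta>>0. \<forall>x y. \<bar>\<phi> x - \<phi> y\<bar> < \<delta> \<longrightarrow> dist x y < e"
proof -
  have "\<exists>Q. finite Q \<and> (UNIV :: 'a set) \<subseteq> (\<Union>p\<in>Q. ball p (1 / real (Suc m)))" for m
  proof -
    have "(UNIV :: 'a set) \<subseteq> (\<Union>p\<in>UNIV. ball p (1 / real (Suc m)))" by auto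
    then show ?thesis
      using compactE_image[OF comp, of UNIV "\<lambda>p. ball p (1 / real (Suc m))"] by (metis open_ball)
  qed
  then obtain Q :: "nat \<Rightarrow> 'a set" where Q: "\<And>m. finite (Q m)" "\<And>m. UNIV \<subseteq> (\<Union>p\<in>Q m. ball p (1 / real (Suc m)))"
    by metis
  define S where "S = (\<Union>m. (\<lambda>p. ball p (1 / real (Suc m))) ` Q m)"
  have cS: "countable S" unfolding S_def using Q(1) by (auto intro!: countable_UN intro: countable_finite)
  have "S \<noteq> {}"
  proof -
    have "Q 0 \<noteq> {}" using Q(2)[of 0] by auto
    then show ?thesis by (auto simp: S_def)
  qed
  define B where "B = from_nat_into S"
  define b :: "nat \<Rightarrow> 'a \<Rightarrow> real" where "b i x = (1/3) ^ i * indicator (B i) x" for i x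
  define \<phi> where "\<phi> x = (\<Sum>i. b i x)" for x
  have geo: "summable (\<lambda>i. (1/3::real) ^ (i + l))" for l by (subst power_add) (auto intro!: summable_mult2 summable_geometric)
  have geoS: "(\<Sum>i. (1/3::real) ^ (i + l)) = (1/3) ^ l * (3 / 2)" for l
    using suminf_geometric[of "1/3::real"] suminf_mult[OF summable_geometric[of "1/3::real"], of "(1/3) ^ l"]
    by (simp add: power_add mult.commute)
  have b0: "0 \<le> b i x" "b i x \<le> (1/3) ^ i" for i x by (auto simp: b_def indicator_def)
  have sb: "summable (\<lambda>i. b i x)" for x
    by (rule summable_comparison_test'[OF geo[of 0], of 0]) (use b0 in auto)
  show ?thesis
  proof
    show "0 \<le> \<phi> x" for x unfolding \<phi>_def by (intro suminf_nonneg sb b0)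
    show "\<phi> x \<le> 3 / 2" for x
      unfolding \<phi>_def using suminf_le[OF b0(2) sb, of x] geo[of 0] geoS[of 0] by simp
    fix e :: real assume "e > 0"
    obtain m where m: "2 / e < real m" using reals_Archimedean2 by blast
    have me: "2 / real (Suc m) < e"
    proof -
      have "2 / e < real (Suc m)" using m by simp
      then show ?thesis using \<open>e > 0\<close> by (simp add: field_simps)
    qed
    define Cm where "Cm = (\<lambda>p. ball p (1 / real (Suc m))) ` Q m"
    define J where "J = Max (to_nat_on S ` Cm)"
    have Cm: "finite Cm" "Cm \<subseteq> S" using Q(1) by (auto simp: Cm_def S_def)
    \<comment> \<open>Half the weight of the last digit needed to decide membership in all the balls
      of radius \<open>1 / (m + 1)\<close> centred in \<open>Q m\<close>.\<close>
    define \<delta> where "\<delta> = (1/3::real) ^ J / 2"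
    have "dist x y < e" if lt: "\<bar>\<phi> x - \<phi> y\<bar> < \<delta>" for x y
    proof -
      have same: "x \<in> B j \<longleftrightarrow> y \<in> B j" if "j \<le> J" for j
      proof (rule ccontr)
        assume diff: "\<not> ?thesis"
        \<comment> \<open>The first differing digit has weight \<open>3^-k\<close>, and all later
          digits together at most half of that. Base 2 would leave no margin.\<close>
        define k where "k = (LEAST j. (x \<in> B j) \<noteq> (y \<in> B j))"
        have k: "(x \<in> B k) \<noteq> (y \<in> B k)" unfolding k_def by (rule LeastI) (use diff in simp)
        have "k \<le> j" unfolding k_def by (rule Least_le) (use diff in simp)
        then have kJ: "k \<le> J" using that by simp
        have below: "(x \<in> B i) = (y \<in> B i)" if "i < k" for i
          using not_less_Least[of i "\<lambda>j. (x \<in> B j) \<noteq> (y \<in> B j)"] that by (simp add: k_def)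
        define a where "a i = b i x - b i y" for i
        have sa: "summable a" unfolding a_def[abs_def] by (intro summable_diff sb)
        have "\<phi> x - \<phi> y = suminf a" unfolding \<phi>_def a_def[abs_def] by (intro suminf_diff sb)
        also have "\<dots> = (\<Sum>i. a (i + Suc k)) + (\<Sum>i<Suc k. a i)"
          by (rule suminf_split_initial_segment[OF sa])
        also have "(\<Sum>i<Suc k. a i) = a k"
          using below by (simp add: a_def b_def indicator_def)
        finally have split: "\<phi> x - \<phi> y = (\<Sum>i. a (i + Suc k)) + a k" .
        have ai: "\<bar>a i\<bar> \<le> (1/3) ^ i" for i by (auto simp: a_def b_def indicator_def)
        have sa': "summable (\<lambda>i. \<bar>a (i + Suc k)\<bar>)"
          by (rule summable_comparison_test'[OF geo[of "Suc k"], of 0]) (simp only: real_norm_def abs_idempotent ai)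
        have "\<bar>\<Sum>i. a (i + Suc k)\<bar> \<le> (\<Sum>i. \<bar>a (i + Suc k)\<bar>)" by (rule summable_rabs[OF sa'])
        also have "\<dots> \<le> (\<Sum>i. (1/3) ^ (i + Suc k))" by (intro suminf_le sa' geo ai)
        also have "\<dots> = (1/3) ^ k / 2" unfolding geoS by simp
        finally have tail: "\<bar>\<Sum>i. a (i + Suc k)\<bar> \<le> (1/3) ^ k / 2" .
        have "\<bar>a k\<bar> = (1/3) ^ k" using k by (auto simp: a_def b_def indicator_def)
        then have "\<bar>\<phi> x - \<phi> y\<bar> \<ge> (1/3) ^ k / 2" using split tail by linarith
        moreover have "(1/3::real) ^ J \<le> (1/3) ^ k" using kJ by (intro power_decreasing) auto
        ultimately show False using lt unfolding \<delta>_def by linarith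
      qed
      obtain p where p: "p \<in> Q m" "x \<in> ball p (1 / real (Suc m))" using Q(2)[of m] by blast
      define U where "U = ball p (1 / real (Suc m))"
      have U: "U \<in> Cm" using p by (auto simp: U_def Cm_def)
      then have "B (to_nat_on S U) = U" unfolding B_def using cS Cm by (intro from_nat_into_to_nat_on) auto
      moreover have "to_nat_on S U \<le> J" unfolding J_def using U Cm by (intro Max_ge) auto
      ultimately have "y \<in> U" using same[of "to_nat_on S U"] p by (simp add: U_def)
      then have "dist p x < 1 / real (Suc m)" "dist p y < 1 / real (Suc m)" using p by (auto simp: U_def)
      then have "dist x y < 2 / real (Suc m)" using dist_triangle3[of x y p] by simp
      then show ?thesis using me by linarith
    qed
    moreover have "\<delta> > 0" by (simp add: \<delta>_def)
    ultimately show "\<exists>\<delta>>0. \<forall>x y. \<bar>\<phi> x - \<phi> y\<bar> < \<delta> \<longrightarrow> dist x y < e" by blast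
  qed
qed

text \<open>The coding \<open>\<phi>\<close> moves the laws to the line, where tightness gives a
  weak limit \<open>M\<close>. It lives on the closure \<open>K\<close> of the range of
  \<open>\<phi>\<close>, the inverse of \<open>\<phi>\<close> extends continuously to
  \<open>K\<close>, and \<open>\<mu>\<close> is the image of \<open>M\<close> under the extension.
  Test functions go to the line by Tietze's theorem.\<close>

theorem weak_sequential_compactness:
  fixes \<rho> :: "nat \<Rightarrow> 'a::metric_space pmf"
  assumes comp: "compact (UNIV :: 'a set)"
  obtains r \<mu> where "strict_mono (r :: nat \<Rightarrow> nat)" "prob_space \<mu>" "sets \<mu> = sets (borel :: 'a measure)"
    "\<And>g :: 'a \<Rightarrow> real. continuous_on UNIV g \<Longrightarrow>
      (\<lambda>k. measure_pmf.expectation (\<rho> (r k)) g) \<longlonglongrightarrow> (\<integral>x. g x \<partial>\<mu>)"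
proof -
  obtain \<phi> :: "'a \<Rightarrow> real" where \<phi>: "\<And>x. 0 \<le> \<phi> x" "\<And>x. \<phi> x \<le> 3 / 2"
    and unif: "\<And>e. e > 0 \<Longrightarrow> \<exists>\<delta>>0. \<forall>x y. \<bar>\<phi> x - \<phi> y\<bar> < \<delta> \<longrightarrow> dist x y < e"
    using ternary_coding[OF comp] by blast
  define D where "D k = distr (measure_pmf (\<rho> k)) borel \<phi>" for k
  have rd: "real_distribution (D k)" for k
    unfolding D_def by (simp add: real_distribution_def real_distribution_axioms_def
        measure_pmf.prob_space_distr)
  have "tight D"
    unfolding tight_def
  proof (intro conjI allI impI rd)
    fix e :: real assume "e > 0"
    have "measure (D k) {-1<..2} = 1" for k
    proof -
      have "-1 < \<phi> x \<and> \<phi> x \<le> 2" for x using \<phi>(1)[of x] \<phi>(2)[of x] by linarith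
      then have *: "\<phi> -` {-1<..2} = UNIV" by auto
      show ?thesis unfolding D_def by (subst measure_distr) (simp_all add: * del: vimage_Collect_eq)
    qed
    then show "\<exists>a b. a < b \<and> (\<forall>n. measure (D n) {a<..b} > 1 - e)"
      using \<open>e > 0\<close> by (intro exI[of _ "-1"] exI[of _ 2]) auto
  qed
  from tight_imp_convergent_subsubsequence[OF this strict_mono_id]
  obtain r M where r: "strict_mono r" and M: "real_distribution M" and wc: "weak_conv_m (D \<circ> id \<circ> r) M" by blast
  interpret M: real_distribution M by fact
  have conv: "(\<lambda>k. measure_pmf.expectation (\<rho> (r k)) (\<lambda>x. G (\<phi> x))) \<longlonglongrightarrow> (\<integral>t. G t \<partial>M)"
    if G: "continuous_on UNIV G" "\<And>t. \<bar>G t\<bar> \<le> B" for G :: "real \<Rightarrow> real" and B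
  proof -
    have "(\<lambda>k. integral\<^sup>L ((D \<circ> id \<circ> r) k) G) \<longlonglongrightarrow> integral\<^sup>L M G"
      by (rule weak_conv_imp_integral_bdd_continuous_conv[OF _ M wc, where B = B])
        (use rd G in \<open>auto simp: continuous_on_eq_continuous_at\<close>)
    moreover have "integral\<^sup>L ((D \<circ> id \<circ> r) k) G = measure_pmf.expectation (\<rho> (r k)) (\<lambda>x. G (\<phi> x))" for k
      using borel_measurable_continuous_onI[OF G(1)] by (simp add: D_def integral_distr)
    ultimately show ?thesis by simp
  qed
  define K where "K = closure (range \<phi>)"
  have Kc: "closed K" "K \<noteq> {}" by (auto simp: K_def)
  have \<phi>K: "\<phi> x \<in> K" for x unfolding K_def by (rule subsetD[OF closure_subset rangeI])
  have aeK: "AE t in M. t \<in> K"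
  proof -
    \<comment> \<open>\<open>h\<close> vanishes on the range of \<open>\<phi>\<close>, so its
      integral is 0 under all the laws and, \<open>h\<close> being bounded and continuous, also
      under \<open>M\<close>.\<close>
    define h where "h t = min 1 (infdist t K)" for t
    have hc: "continuous_on UNIV h" unfolding h_def[abs_def] by (intro continuous_intros)
    have h0: "h t \<ge> 0" "\<bar>h t\<bar> \<le> 1" for t using infdist_nonneg[of t K] by (auto simp: h_def)
    have "h (\<phi> x) = 0" for x using \<phi>K by (simp add: h_def)
    then have "(\<lambda>k. 0) \<longlonglongrightarrow> (\<integral>t. h t \<partial>M)" using conv[OF hc h0(2)] by simp
    then have "(\<integral>t. h t \<partial>M) = 0" by (rule LIMSEQ_unique[OF _ tendsto_const])
    moreover have "integrable M h"
      using h0 borel_measurable_continuous_onI[OF hc] by (intro M.integrable_const_bound[where B = 1]) auto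
    ultimately have "AE t in M. h t = 0" using h0 by (subst (asm) integral_nonneg_eq_0_iff_AE) auto
    moreover have "h t = 0 \<longleftrightarrow> t \<in> K" for t
      using in_closed_iff_infdist_zero[OF Kc, of t] by (auto simp: h_def min_def)
    ultimately show ?thesis by simp
  qed
  \<comment> \<open>\<open>R t x\<close> says that points whose codes tend to \<open>t\<close> tend
    to \<open>x\<close>. Uniform continuity of the inverse and compactness of the space give such an
    \<open>x\<close> for each \<open>t\<close> in \<open>K\<close>.\<close>
  define R where "R t x \<longleftrightarrow> (\<forall>e>0. \<exists>\<delta>>0. \<forall>z. \<bar>\<phi> z - t\<bar> < \<delta> \<longrightarrow> dist z x < e)" for t x
  have "\<exists>x. R t x" if "t \<in> K" for t
  proof -
    obtain s where s: "\<forall>i. s i \<in> range \<phi>" "s \<longlonglongrightarrow> t"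
      using \<open>t \<in> K\<close>[unfolded K_def closure_sequential] by (elim exE conjE)
    have "\<exists>x. s i = \<phi> x" for i using s(1) by blast
    then obtain z where z: "\<And>i. s i = \<phi> (z i)" by metis
    obtain x l where l: "strict_mono (l :: nat \<Rightarrow> nat)" "(z \<circ> l) \<longlonglongrightarrow> x"
      using compact_imp_seq_compact[OF comp] unfolding seq_compact_def by blast
    have st: "(\<lambda>i. \<phi> (z (l i))) \<longlonglongrightarrow> t" using LIMSEQ_subseq_LIMSEQ[OF s(2) l(1)] by (simp add: comp_def z)
    have "R t x" unfolding R_def
    proof (intro allI impI)
      fix e :: real assume "e > 0"
      obtain \<delta> where \<delta>: "\<delta> > 0" "\<And>x y. \<bar>\<phi> x - \<phi> y\<bar> < \<delta> \<Longrightarrow> dist x y < e / 2"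
        using unif[of "e / 2"] \<open>e > 0\<close> by auto
      have "\<forall>\<^sub>F i in sequentially. dist (\<phi> (z (l i))) t < \<delta> / 2"
        using \<delta> by (intro tendstoD[OF st]) simp
      moreover have "\<forall>\<^sub>F i in sequentially. dist ((z \<circ> l) i) x < e / 2"
        using \<open>e > 0\<close> by (intro tendstoD[OF l(2)]) simp
      ultimately have "\<forall>\<^sub>F i in sequentially. dist (\<phi> (z (l i))) t < \<delta> / 2 \<and> dist (z (l i)) x < e / 2"
        by eventually_elim simp
      from eventually_happens'[OF sequentially_bot this]
      obtain i where i: "dist (\<phi> (z (l i))) t < \<delta> / 2" "dist (z (l i)) x < e / 2" by blast
      have "dist y x < e" if "\<bar>\<phi> y - t\<bar> < \<delta> / 2" for y
      proof -
        have "\<bar>\<phi> y - \<phi> (z (l i))\<bar> < \<delta>" using that i(1) unfolding dist_real_def by linarith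
        then show ?thesis using \<delta>(2)[of y "z (l i)"] i(2) dist_triangle[of y x "z (l i)"] by linarith
      qed
      then show "\<exists>\<delta>>0. \<forall>y. \<bar>\<phi> y - t\<bar> < \<delta> \<longrightarrow> dist y x < e" using \<delta>(1) by (intro exI[of _ "\<delta> / 2"]) auto
    qed
    then show ?thesis ..
  qed
  then obtain \<pi> where \<pi>: "\<And>t. t \<in> K \<Longrightarrow> R t (\<pi> t)" by metis
  have \<pi>\<phi>: "\<pi> (\<phi> x) = x" for x
  proof (rule ccontr)
    assume "\<pi> (\<phi> x) \<noteq> x"
    then have "dist x (\<pi> (\<phi> x)) > 0" by simp
    then obtain \<delta> where "\<delta> > 0" "\<And>z. \<bar>\<phi> z - \<phi> x\<bar> < \<delta> \<Longrightarrow> dist z (\<pi> (\<phi> x)) < dist x (\<pi> (\<phi> x))"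
      using \<pi>[OF \<phi>K[of x]] unfolding R_def by blast
    from this(2)[of x] this(1) show False by simp
  qed
  have \<pi>c: "continuous_on K \<pi>"
    unfolding continuous_on_iff
  proof (intro ballI allI impI)
    fix t e assume t: "t \<in> K" and "(e::real) > 0"
    obtain \<delta> where \<delta>: "\<delta> > 0" "\<And>x y. \<bar>\<phi> x - \<phi> y\<bar> < \<delta> \<Longrightarrow> dist x y < e / 3"
      using unif[of "e / 3"] \<open>e > 0\<close> by auto
    have near: "\<exists>z. \<bar>\<phi> z - u\<bar> < \<delta> / 3 \<and> dist z (\<pi> u) < e / 3" if u: "u \<in> K" for u
    proof -
      have "e / 3 > 0" using \<open>e > 0\<close> by simp
      then obtain \<delta>' where \<delta>': "\<delta>' > 0" "\<And>z. \<bar>\<phi> z - u\<bar> < \<delta>' \<Longrightarrow> dist z (\<pi> u) < e / 3"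
        using \<pi>[OF u] unfolding R_def by blast
      have "min (\<delta> / 3) \<delta>' > 0" using \<delta> \<delta>' by simp
      then obtain z where "dist (\<phi> z) u < min (\<delta> / 3) \<delta>'"
        using u unfolding K_def closure_approachable by blast
      then show ?thesis using \<delta>'(2)[of z] by (auto simp: dist_real_def)
    qed
    show "\<exists>\<delta>>0. \<forall>u\<in>K. dist u t < \<delta> \<longrightarrow> dist (\<pi> u) (\<pi> t) < e"
    proof (intro exI[of _ "\<delta> / 3"] conjI ballI impI)
      fix u assume u: "u \<in> K" "dist u t < \<delta> / 3"
      obtain z z' where z: "\<bar>\<phi> z - u\<bar> < \<delta> / 3" "dist z (\<pi> u) < e / 3"
        "\<bar>\<phi> z' - t\<bar> < \<delta> / 3" "dist z' (\<pi> t) < e / 3" using near[OF u(1)] near[OF t] by blast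
      have "\<bar>\<phi> z - \<phi> z'\<bar> < \<delta>" using z u(2) unfolding dist_real_def by linarith
      then have "dist z z' < e / 3" by (rule \<delta>(2))
      then show "dist (\<pi> u) (\<pi> t) < e"
        using z dist_triangle3[of "\<pi> u" "\<pi> t" z] dist_triangle[of z "\<pi> t" z'] by linarith
    qed (use \<delta> in simp)
  qed
  \<comment> \<open>An arbitrary value to be used off \<open>K\<close>, hence on a null set of
    \<open>M\<close>.\<close>
  obtain x0 :: 'a where True by blast
  define \<pi>' where "\<pi>' t = (if t \<in> K then \<pi> t else x0)" for t
  have \<pi>'m: "\<pi>' \<in> borel_measurable borel"
    unfolding \<pi>'_def[abs_def] using Kc \<pi>c by (intro borel_measurable_continuous_on_if) auto
  then have \<pi>'M: "\<pi>' \<in> measurable M borel" by simp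
  show ?thesis
  proof (rule that[of r "distr M borel \<pi>'"])
    show "prob_space (distr M borel \<pi>')" using \<pi>'M by (rule M.prob_space_distr)
    fix g :: "'a \<Rightarrow> real" assume g: "continuous_on UNIV g"
    obtain B where B: "B \<ge> 0" "\<And>x. \<bar>g x\<bar> \<le> B" using compact_bounded_function[OF comp g] by blast
    have "continuous_on K (\<lambda>t. g (\<pi> t))" by (rule continuous_on_compose2[OF g \<pi>c]) auto
    then obtain G where G: "continuous_on UNIV G" "\<And>t. t \<in> K \<Longrightarrow> G t = g (\<pi> t)" "\<And>t. \<bar>G t\<bar> \<le> B"
      using Tietze[of K "\<lambda>t. g (\<pi> t)" UNIV B] Kc B by auto
    have "(\<integral>x. g x \<partial>distr M borel \<pi>') = (\<integral>t. g (\<pi>' t) \<partial>M)"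
      using \<pi>'M borel_measurable_continuous_onI[OF g] by (simp add: integral_distr)
    also have "\<dots> = (\<integral>t. G t \<partial>M)"
    proof (rule integral_cong_AE)
      show "(\<lambda>t. g (\<pi>' t)) \<in> borel_measurable M"
        using measurable_compose[OF \<pi>'M borel_measurable_continuous_onI[OF g]] by simp
      show "G \<in> borel_measurable M" using borel_measurable_continuous_onI[OF G(1)] by simp
      show "AE t in M. g (\<pi>' t) = G t" using aeK by eventually_elim (simp add: \<pi>'_def G(2))
    qed
    finally show "(\<lambda>k. measure_pmf.expectation (\<rho> (r k)) g) \<longlonglongrightarrow> (\<integral>x. g x \<partial>distr M borel \<pi>')"
      using conv[OF G(1,3)] G(2)[OF \<phi>K] by (simp add: \<pi>\<phi>)
  qed (use r in auto)
qed

text \<open>Induction over the sigma-algebra generated by closed sets: a closed set is a decreasing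
  intersection of open neighbourhoods, and complementation exchanges inner and outer sets. For
  unions only the outer sets are joined countably; the inner union is cut at a finite stage to stay
  closed.\<close>

lemma closed_open_regularity:
  fixes N :: "'a::metric_space measure"
  assumes "prob_space N" and sets: "sets N = sets borel" and "A \<in> sets borel" "e > 0"
  shows "\<exists>C U. closed C \<and> open U \<and> C \<subseteq> A \<and> A \<subseteq> U \<and> measure N (U - C) < e"
proof -
  interpret prob_space N by fact
  have m: "X \<in> sets N" if "X \<in> sets borel" for X using that sets by simp
  have "A \<in> sigma_sets UNIV (Collect closed)" using assms(3) unfolding borel_eq_closed by simp
  then show ?thesis using \<open>e > 0\<close>
  proof (induction arbitrary: e rule: sigma_sets.induct)
    case (Basic A)
    then have A: "closed A" by simp
    show ?case
    proof (cases "A = {}")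
      case True
      then show ?thesis using Basic(2) by (intro exI[of _ "{}"]) auto
    next
      case False
      define U where "U m = {x. infdist x A < 1 / real (Suc m)}" for m
      have o: "open (U m)" for m unfolding U_def by (intro open_Collect_less continuous_intros)
      have "decseq U"
        unfolding decseq_Suc_iff U_def by (auto intro: less_le_trans simp: frac_le)
      then have "(\<lambda>m. measure N (U m)) \<longlonglongrightarrow> measure N (\<Inter>m. U m)"
        using o by (intro finite_Lim_measure_decseq) (auto intro: m)
      also have "(\<Inter>m. U m) = A"
      proof
        show "A \<subseteq> (\<Inter>m. U m)" by (auto simp: U_def)
        show "(\<Inter>m. U m) \<subseteq> A"
        proof
          fix x assume x: "x \<in> (\<Inter>m. U m)"
          have "infdist x A = 0"
          proof (rule ccontr)
            assume "infdist x A \<noteq> 0"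
            then have "infdist x A > 0" using infdist_nonneg[of x A] by linarith
            then obtain k where "inverse (real (Suc k)) < infdist x A" using reals_Archimedean by blast
            moreover have "infdist x A < 1 / real (Suc k)" using x by (auto simp: U_def)
            ultimately show False by (simp add: inverse_eq_divide)
          qed
          then show "x \<in> A" using in_closed_iff_infdist_zero[OF A False] by simp
        qed
      qed
      finally have "\<forall>\<^sub>F k in sequentially. measure N (U k) < measure N A + e"
        using Basic(2) by (intro order_tendstoD(2)) auto
      from eventually_happens'[OF sequentially_bot this]
      obtain k where k: "measure N (U k) < measure N A + e" ..
      have AU: "A \<subseteq> U k" by (auto simp: U_def)
      have "measure N (U k - A) = measure N (U k) - measure N A"
        using A o[of k] AU by (intro finite_measure_Diff) (auto intro: m)
      then show ?thesis using A o AU k by (intro exI[of _ A] exI[of _ "U k"]) auto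
    qed
  next
    case Empty
    then show ?case by (intro exI[of _ "{}"]) auto
  next
    case (Compl A)
    from Compl(2)[OF Compl(3)] obtain C U
      where *: "closed C" "open U" "C \<subseteq> A" "A \<subseteq> U" "measure N (U - C) < e" by blast
    have "(- C) - (- U) = U - C" by auto
    then show ?case using * by (intro exI[of _ "- U"] exI[of _ "- C"]) (simp add: Compl_eq_Diff_UNIV[symmetric] open_Compl closed_Compl)
  next
    case (Union a)
    \<comment> \<open>These tolerances sum to \<open>e / 2\<close>, which leaves room for cutting
      the union of the inner sets at a finite stage.\<close>
    have "\<exists>C U. closed C \<and> open U \<and> C \<subseteq> a i \<and> a i \<subseteq> U \<and> measure N (U - C) < e / 2 * (1/2) ^ Suc i" for i
      by (rule Union(2)) (use Union(3) in simp)
    then obtain C U where CU: "\<And>i. closed (C i)" "\<And>i. open (U i)" "\<And>i. C i \<subseteq> a i" "\<And>i. a i \<subseteq> U i"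
      "\<And>i. measure N (U i - C i) < e / 2 * (1/2) ^ Suc i" by metis
    define V where "V = (\<Union>i. U i)"
    have V: "open V" using CU by (auto simp: V_def)
    define D where "D n = V - (\<Union>i<n. C i)" for n
    have cl: "closed (\<Union>i<n. C i)" for n using CU by auto
    have "decseq D" unfolding decseq_Suc_iff D_def by (auto simp: lessThan_Suc)
    moreover have "range D \<subseteq> sets N" using V cl by (auto simp: D_def intro!: m)
    ultimately have "(\<lambda>n. measure N (D n)) \<longlonglongrightarrow> measure N (\<Inter>n. D n)"
      by (intro finite_Lim_measure_decseq)
    moreover have "measure N (\<Inter>n. D n) < e"
    proof -
      have sums: "(\<lambda>i. e / 2 * (1/2) ^ Suc i) sums (e / 2)"
        using power_half_series[THEN sums_mult, of "e / 2"] by simp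
      have meas: "range (\<lambda>i. U i - C i) \<subseteq> sets N" using CU by (auto intro!: m)
      have "summable (\<lambda>i. measure N (U i - C i))"
        by (rule summable_comparison_test'[OF sums_summable[OF sums], of 0])
          (use CU(5) in \<open>auto intro: less_imp_le\<close>)
      have "measure N (\<Inter>n. D n) \<le> measure N (\<Union>i. U i - C i)"
      proof (rule finite_measure_mono)
        show "(\<Inter>n. D n) \<subseteq> (\<Union>i. U i - C i)"
        proof
          fix x assume x: "x \<in> (\<Inter>n. D n)"
          then obtain i where "x \<in> U i" by (auto simp: D_def V_def)
          moreover have "x \<notin> C i" using x by (auto simp: D_def dest: spec[of _ "Suc i"])
          ultimately show "x \<in> (\<Union>i. U i - C i)" by blast
        qed
        show "(\<Union>i. U i - C i) \<in> sets N" using meas by blast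
      qed
      also have "\<dots> \<le> (\<Sum>i. measure N (U i - C i))"
        by (rule finite_measure_subadditive_countably[OF meas]) fact
      also have "\<dots> \<le> (\<Sum>i. e / 2 * (1/2) ^ Suc i)"
        using CU(5) sums by (intro suminf_le) (auto intro: less_imp_le sums_summable \<open>summable _\<close>)
      also have "\<dots> = e / 2" using sums by (rule sums_unique[symmetric])
      finally show ?thesis using Union(3) by simp
    qed
    ultimately have "\<forall>\<^sub>F n in sequentially. measure N (D n) < e" by (rule order_tendstoD(2))
    from eventually_happens'[OF sequentially_bot this] obtain n where n: "measure N (D n) < e" ..
    have "(\<Union>i<n. C i) \<subseteq> (\<Union>i. a i)" "(\<Union>i. a i) \<subseteq> V" using CU(3,4) unfolding V_def by blast+
    then show ?case using V cl n by (intro exI[of _ "\<Union>i<n. C i"] exI[of _ V]) (auto simp: D_def)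
  qed
qed

subsection \<open>Extracting separated sets\<close>

text \<open>Greedy choice: keep a heaviest point and discard all that it conflicts with, at most
  \<open>N\<close> points including itself and hence at most \<open>N\<close> times its weight. As
  \<open>R\<close> may fail to be symmetric, only the conflict seen from the point chosen earlier is
  excluded.\<close>

lemma weighted_independent_subset:
  fixes wt :: "'a \<Rightarrow> real"
  assumes "finite S" and refl: "\<And>x. R x x" and wt: "\<And>x. wt x \<ge> 0"
    and N: "\<And>x. x \<in> S \<Longrightarrow> real (card {y\<in>S. R x y}) \<le> N"
  shows "\<exists>E\<subseteq>S. (\<forall>x\<in>E. \<forall>y\<in>E. x \<noteq> y \<longrightarrow> \<not> R x y \<or> \<not> R y x) \<and> sum wt S \<le> N * sum wt E"
  using assms(1) N
proof (induction S rule: finite_psubset_induct)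
  case (psubset S)
  show ?case
  proof (cases "S = {}")
    case False
    obtain x where x: "x \<in> S" "\<And>y. y \<in> S \<Longrightarrow> wt y \<le> wt x"
    proof -
      have "Max (wt ` S) \<in> wt ` S" using psubset(1) False by (intro Max_in) auto
      then obtain x where "x \<in> S" "wt x = Max (wt ` S)" by auto
      then show ?thesis using that[of x] psubset(1) by simp
    qed
    define B where "B = {y\<in>S. R x y}"
    have B: "x \<in> B" "B \<subseteq> S" using x refl by (auto simp: B_def)
    have "real (card {y\<in>S - B. R z y}) \<le> N" if "z \<in> S - B" for z
    proof -
      have "card {y\<in>S - B. R z y} \<le> card {y\<in>S. R z y}" using psubset(1) by (intro card_mono) auto
      then show ?thesis using psubset(3)[of z] that by simp
    qed
    note card_le = this
    have "S - B \<subset> S" using B by auto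
    have "\<exists>E\<subseteq>S - B. (\<forall>x\<in>E. \<forall>y\<in>E. x \<noteq> y \<longrightarrow> \<not> R x y \<or> \<not> R y x) \<and> sum wt (S - B) \<le> N * sum wt E"
      by (rule psubset(2)[OF \<open>S - B \<subset> S\<close>]) (rule card_le)
    then obtain E where E: "E \<subseteq> S - B" "\<forall>x\<in>E. \<forall>y\<in>E. x \<noteq> y \<longrightarrow> \<not> R x y \<or> \<not> R y x"
      "sum wt (S - B) \<le> N * sum wt E" by (elim exE conjE)
    have "sum wt B \<le> (\<Sum>y\<in>B. wt x)" using x B by (intro sum_mono) auto
    also have "\<dots> \<le> N * wt x" using psubset(3)[OF x(1)] wt[of x] by (simp add: B_def mult_right_mono)
    finally have "sum wt S \<le> N * wt x + N * sum wt E"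
      using E(3) B psubset(1) sum.subset_diff[of B S wt] by simp
    also have "\<dots> = N * sum wt (insert x E)"
    proof -
      have "finite E" "x \<notin> E" using E(1) B psubset(1) by (auto intro: finite_subset)
      then show ?thesis by (simp add: algebra_simps)
    qed
    finally have "sum wt S \<le> N * sum wt (insert x E)" .
    moreover have "\<not> R x y" if "y \<in> E" for y using that E(1) by (auto simp: B_def)
    ultimately show ?thesis using E(1,2) x by (intro exI[of _ "insert x E"]) auto
  qed auto
qed

text \<open>Chernoff's counting argument: a word in the ball has \<open>t ^ distance\<close> at
  least \<open>t powr m\<close>, and the sum of \<open>t ^ distance\<close> over all words
  factorises into \<open>n\<close> factors of at most \<open>1 + card P * t\<close>. The exponent is
  small relative to \<open>n\<close> if first \<open>t\<close> and then \<open>m / n\<close> are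
  small.\<close>

lemma card_hamming_ball:
  fixes t m :: real
  assumes P: "finite P" and v: "v \<in> words n P" and t: "0 < t" "t \<le> 1"
  shows "real (card {w\<in>words n P. real (card {i. i < n \<and> w i \<noteq> v i}) \<le> m}) \<le> exp (real n * real (card P) * t - m * ln t)"
proof -
  define k where "k = card P"
  define dd where "dd w = card {i. i < n \<and> w i \<noteq> v i}" for w
  define B where "B = {w\<in>words n P. real (dd w) \<le> m}"
  have fw: "finite (words n P)" using P by (intro finite_PiE) auto
  have "real (card B) * t powr m = (\<Sum>w\<in>B. t powr m)" by simp
  also have "\<dots> \<le> (\<Sum>w\<in>B. t ^ dd w)"
  proof (rule sum_mono)
    fix w assume "w \<in> B"
    then have "t powr m \<le> t powr real (dd w)" using t by (intro powr_mono') (auto simp: B_def)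
    then show "t powr m \<le> t ^ dd w" using t by (simp add: powr_realpow)
  qed
  also have "\<dots> \<le> (\<Sum>w\<in>words n P. t ^ dd w)" using fw t by (intro sum_mono2) (auto simp: B_def)
  also have "\<dots> = (\<Sum>w\<in>words n P. \<Prod>i<n. if w i = v i then 1 else t)"
  proof (rule sum.cong[OF refl])
    fix w
    have "(\<Prod>i<n. if w i = v i then 1 else t) = (\<Prod>i\<in>{i. i < n \<and> w i \<noteq> v i}. t)"
      by (rule prod.mono_neutral_cong_right) auto
    then show "t ^ dd w = (\<Prod>i<n. if w i = v i then 1 else t)" by (simp add: dd_def)
  qed
  also have "\<dots> = (\<Prod>i<n. \<Sum>a\<in>P. if a = v i then 1 else t)"
    using P by (subst prod_sum_PiE) auto
  also have "\<dots> \<le> (\<Prod>i<n. exp (real k * t))"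
  proof (rule prod_mono)
    fix i assume i: "i \<in> {..<n}"
    have "v i \<in> P" using v i by auto
    have "(\<Sum>a\<in>P. if a = v i then 1 else t) = 1 + (\<Sum>a\<in>P - {v i}. if a = v i then 1 else t)"
      using P \<open>v i \<in> P\<close> by (subst sum.remove[of P "v i"]) auto
    also have "(\<Sum>a\<in>P - {v i}. if a = v i then 1 else t) = (\<Sum>a\<in>P - {v i}. t)" by (intro sum.cong) auto
    also have "\<dots> \<le> real k * t" using P t by (auto simp: k_def intro!: mult_right_mono card_mono)
    finally show "0 \<le> (\<Sum>a\<in>P. if a = v i then 1 else t) \<and> (\<Sum>a\<in>P. if a = v i then 1 else t) \<le> exp (real k * t)"
      using exp_ge_add_one_self[of "real k * t"] t by (auto intro!: sum_nonneg elim: order_trans)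
  qed
  also have "\<dots> = exp (real n * real k * t)" by (simp add: exp_of_nat_mult[symmetric] mult.assoc)
  finally have "real (card B) * t powr m \<le> exp (real n * real k * t)" .
  then have "real (card B) \<le> exp (real n * real k * t) / t powr m"
    using t by (simp add: field_simps)
  also have "\<dots> = exp (real n * real k * t - m * ln t)" using t by (simp add: powr_def exp_diff)
  finally show ?thesis by (simp add: B_def dd_def k_def)
qed

context invariant_potential
begin

text \<open>One point that nearly maximises \<open>f n\<close> is taken in each occurring cell of
  \<open>G\<close>, and the Gibbs inequality is applied to the part of \<mu> on \<open>G\<close>.
  The part off \<open>G\<close> is bounded crudely by the number of all words and by
  \<open>C\<close> per step. The summand 2 collects \<open>eta\<close> of the masses of
  \<open>G\<close> and of its complement; the 1 next to the logarithm is the slack in the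
  near-maximum.\<close>

lemma entropy_plus_mean_le:
  assumes P: "finite_borel_partition P" and n: "n \<ge> 1" and G: "G \<in> sets borel" "measure \<mu> G > 0"
    and C: "C \<ge> 0" "\<And>y. bF 1 y \<le> C"
  obtains S where "finite S" "S \<noteq> {}" "S \<subseteq> G" "inj_on (word (itinerary T P) 0 n) S"
    "word_entropy \<mu> P (itinerary T P) 0 n + If n \<le>
       measure \<mu> G * (1 + ln (\<Sum>x\<in>S. exp (f n x))) + (1 - measure \<mu> G) * real n * (ln (card P) + C) + 2"
proof -
  interpret symbolic_process \<mu> P "itinerary T P" by (rule symbolic_process_itinerary[OF P])
  let ?w = "word (itinerary T P) 0 n"
  define D where "D w = {x. ?w x = w}" for w
  have D: "D w \<in> sets \<mu>" if "w \<in> words n P" for w using measurable_word[OF that] by (simp add: D_def)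
  have G': "G \<in> sets \<mu>" "- G \<in> sets \<mu>" using G by (auto simp: Compl_eq_Diff_UNIV)
  define W where "W = {w\<in>words n P. G \<inter> D w \<noteq> {}}"
  have fW: "finite W" by (simp add: W_def)
  obtain Bd where Bd: "\<And>x. \<bar>f n x\<bar> \<le> Bd"
    using compact_bounded_function[OF tds_compact[OF tds] continuous_induced[OF n]] by blast
  \<comment> \<open>The supremum over a Borel set need not be attained, so a point within 1 of it is
    taken.\<close>
  have "\<exists>x. x \<in> G \<inter> D w \<and> (\<forall>y\<in>G \<inter> D w. f n y \<le> f n x + 1)" if w: "w \<in> W" for w
  proof -
    have ne: "f n ` (G \<inter> D w) \<noteq> {}" using w by (auto simp: W_def)
    have bdd: "bdd_above (f n ` (G \<inter> D w))" using Bd by (auto simp: bdd_above_def abs_le_iff)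
    obtain z where z: "z \<in> f n ` (G \<inter> D w)" "Sup (f n ` (G \<inter> D w)) - 1 < z"
      using less_cSupE[OF _ ne, of "Sup (f n ` (G \<inter> D w)) - 1"] by auto
    then obtain x where x: "x \<in> G \<inter> D w" "z = f n x" by blast
    have "f n y \<le> f n x + 1" if "y \<in> G \<inter> D w" for y
    proof -
      have "f n y \<le> Sup (f n ` (G \<inter> D w))" using that bdd by (intro cSup_upper) auto
      then show ?thesis using z(2) x(2) by linarith
    qed
    then show ?thesis using x(1) by blast
  qed
  then obtain X where X: "\<And>w. w \<in> W \<Longrightarrow> X w \<in> G \<inter> D w" "\<And>w y. w \<in> W \<Longrightarrow> y \<in> G \<inter> D w \<Longrightarrow> f n y \<le> f n (X w) + 1"
    by metis
  have wX: "?w (X w) = w" if "w \<in> W" for w using X(1)[OF that] by (simp add: D_def)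
  have injX: "inj_on X W" using wX by (metis inj_onI)
  define S where "S = X ` W"
  define pG where "pG w = measure \<mu> (G \<inter> D w)" for w
  define pB where "pB w = measure \<mu> (- G \<inter> D w)" for w
  define g where "g = measure \<mu> G"
  have range: "range ?w \<subseteq> words n P" by (rule word_range)
  have sG: "(\<Sum>w\<in>words n P. pG w) = g"
    unfolding pG_def g_def D_def using G' range measurable_word by (intro sum_fibres) auto
  have sB: "(\<Sum>w\<in>words n P. pB w) = 1 - g"
  proof -
    have "(\<Sum>w\<in>words n P. pB w) = measure \<mu> (- G)"
      unfolding pB_def D_def using G' range measurable_word by (intro sum_fibres) auto
    then show ?thesis using prob_compl[OF G'(1)] by (simp add: Compl_eq_Diff_UNIV g_def)
  qed
  \<comment> \<open>Words whose cell misses \<open>G\<close> carry no mass, so sums of terms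
    vanishing at mass 0 may run over \<open>W\<close> or over all words.\<close>
  have sGW: "(\<Sum>w\<in>W. h (pG w) w) = (\<Sum>w\<in>words n P. h (pG w) w)" if "\<And>w. h 0 w = 0" for h :: "real \<Rightarrow> _ \<Rightarrow> real"
    using that by (intro sum.mono_neutral_left) (auto simp: W_def pG_def)
  have "W \<noteq> {}"
  proof
    assume "W = {}"
    then have "(\<Sum>w\<in>words n P. pG w) = 0" using sGW[of "\<lambda>a _. a"] by simp
    then show False using sG G(2) by (simp add: g_def)
  qed
  have g1: "g \<le> 1" "g \<ge> 0" by (auto simp: g_def)
  have H: "word_entropy \<mu> P (itinerary T P) 0 n \<le> (\<Sum>w\<in>W. eta (pG w)) + 1 + (1 - g) * (real n * ln (card P))"
  proof -
    have "word_entropy \<mu> P (itinerary T P) 0 n = (\<Sum>w\<in>words n P. eta (pG w + pB w))"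
      unfolding word_entropy_def Hent_def
    proof (rule sum.cong[OF refl])
      fix w assume w: "w \<in> words n P"
      have "D w = (G \<inter> D w) \<union> (- G \<inter> D w)" by auto
      then have "measure \<mu> (D w) = pG w + pB w"
        unfolding pG_def pB_def using G' D[OF w] by (metis finite_measure_Union sets.Int Int_assoc Compl_disjoint inf_left_commute Int_empty_left)
      then show "eta (measure \<mu> {x. ?w x = w}) = eta (pG w + pB w)" by (simp add: D_def)
    qed
    also have "\<dots> \<le> (\<Sum>w\<in>words n P. eta (pG w) + eta (pB w))"
      by (intro sum_mono eta_add_le) (auto simp: pG_def pB_def)
    also have "\<dots> = (\<Sum>w\<in>W. eta (pG w)) + (\<Sum>w\<in>words n P. eta (pB w))"
      using sGW[of "\<lambda>a _. eta a"] by (simp add: sum.distrib)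
    also have "(\<Sum>w\<in>words n P. eta (pB w)) \<le> eta (1 - g) + (1 - g) * ln (card (words n P))"
      using gibbs_inequality[of "words n P" pB "\<lambda>_. 0"] sB by (simp add: pB_def)
    also have "ln (card (words n P)) = real n * ln (card P)"
      using S_nonempty finite_S by (simp add: card_PiE ln_realpow card_gt_0_iff)
    also have "eta (1 - g) \<le> 1" using eta_le_1[of "1 - g"] g1 by simp
    finally show ?thesis by simp
  qed
  have I: "If n \<le> (\<Sum>w\<in>W. pG w * (f n (X w) + 1)) + (1 - g) * (real n * C)"
  proof -
    have iG: "integrable \<mu> (\<lambda>x. (\<Sum>w\<in>W. (f n (X w) + 1) * indicator (G \<inter> D w) x))"
      using D G' by (intro Bochner_Integration.integrable_sum integrable_mult_right)
        (auto simp: W_def less_top[symmetric] intro!: integrable_real_indicator)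
    have iB: "integrable \<mu> (\<lambda>x. real n * C * indicator (- G) x)"
      using G' by (intro integrable_mult_right integrable_real_indicator) (auto simp: less_top[symmetric])
    have "If n \<le> (\<integral>x. (\<Sum>w\<in>W. (f n (X w) + 1) * indicator (G \<inter> D w) x) + real n * C * indicator (- G) x \<partial>\<mu>)"
      unfolding If_def
    proof (rule integral_mono)
      fix x
      show "f n x \<le> (\<Sum>w\<in>W. (f n (X w) + 1) * indicator (G \<inter> D w) x) + real n * C * indicator (- G) x"
      proof (cases "x \<in> G")
        case True
        define w where "w = ?w x"
        have w: "w \<in> W" using True range by (auto simp: w_def W_def D_def)
        have "(\<Sum>v\<in>W. (f n (X v) + 1) * indicator (G \<inter> D v) x) = (\<Sum>v\<in>{w}. (f n (X v) + 1) * indicator (G \<inter> D v) x)"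
          using w fW by (intro sum.mono_neutral_right) (auto simp: D_def w_def)
        also have "\<dots> = f n (X w) + 1" using True by (simp add: D_def w_def)
        also have "\<dots> \<ge> f n x" using X(2)[OF w, of x] True by (simp add: D_def w_def)
        finally show ?thesis using True by simp
      next
        case False
        then show ?thesis using bF_le[OF C(2) n, of "orbit T x"] by (simp add: induced_eq)
      qed
    qed (use iG iB integrable_f[OF n] in auto)
    also have "\<dots> = (\<Sum>w\<in>W. (f n (X w) + 1) * pG w) + real n * C * measure \<mu> (- G)"
      using iG iB D G'
      by (subst Bochner_Integration.integral_add, simp, simp, subst Bochner_Integration.integral_sum)
        (auto simp: W_def pG_def less_top[symmetric] intro!: integrable_real_indicator)
    also have "measure \<mu> (- G) = 1 - g" using prob_compl[OF G'(1)] by (simp add: Compl_eq_Diff_UNIV g_def)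
    finally show ?thesis by (simp add: mult.commute mult.left_commute)
  qed
  have gib: "(\<Sum>w\<in>W. eta (pG w) + pG w * (f n (X w) + 1)) \<le> eta g + g * ln (\<Sum>w\<in>W. exp (f n (X w) + 1))"
    using gibbs_inequality[OF fW, of pG "\<lambda>w. f n (X w) + 1"] sGW[of "\<lambda>a _. a"] sG by (simp add: pG_def)
  have Z: "(\<Sum>w\<in>W. exp (f n (X w) + 1)) = exp 1 * (\<Sum>x\<in>S. exp (f n x))"
    unfolding S_def using injX by (simp add: sum.reindex exp_add sum_distrib_left mult.commute)
  have S: "finite S" "S \<noteq> {}" using fW \<open>W \<noteq> {}\<close> by (auto simp: S_def)
  have "(\<Sum>x\<in>S. exp (f n x)) > 0" using S by (intro sum_pos) auto
  then have "ln (\<Sum>w\<in>W. exp (f n (X w) + 1)) = 1 + ln (\<Sum>x\<in>S. exp (f n x))"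
    unfolding Z by (simp add: ln_mult)
  then have "word_entropy \<mu> P (itinerary T P) 0 n + If n \<le>
       g * (1 + ln (\<Sum>x\<in>S. exp (f n x))) + (1 - g) * real n * (ln (card P) + C) + 2"
    using H I gib eta_le_1[OF g1(2)] g1 by (simp add: sum.distrib algebra_simps)
  moreover have "S \<subseteq> G" using X(1) by (auto simp: S_def)
  moreover have "inj_on ?w S" unfolding S_def using wX by (auto intro!: inj_onI)
  ultimately show ?thesis using that[of S] S by (simp add: g_def)
qed

end

section \<open>Separation of orbits and closed cores of cells\<close>

lemma separated_iff:
  assumes "n \<ge> 1"
  shows "separated T n \<epsilon> E \<longleftrightarrow> (\<forall>x\<in>E. \<forall>y\<in>E. x \<noteq> y \<longrightarrow> (\<exists>i<n. dist ((T ^^ i) x) ((T ^^ i) y) > \<epsilon>))"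
proof -
  have "(MAX i\<in>{..<n}. dist ((T ^^ i) x) ((T ^^ i) y)) > \<epsilon> \<longleftrightarrow> (\<exists>i<n. dist ((T ^^ i) x) ((T ^^ i) y) > \<epsilon>)" for x y
  proof -
    have "{..<n} \<noteq> {}" using assms by (auto simp: lessThan_empty_iff)
    then show ?thesis by (subst Max_gr_iff) auto
  qed
  then show ?thesis by (simp add: separated_def)
qed

lemma pairwise_separated_closed_sets:
  fixes Kc :: "'i \<Rightarrow> 'a::metric_space set"
  assumes comp: "compact (UNIV :: 'a set)" and "finite P" and cl: "\<And>A. A \<in> P \<Longrightarrow> closed (Kc A)"
    and disj: "\<And>A B. A \<in> P \<Longrightarrow> B \<in> P \<Longrightarrow> A \<noteq> B \<Longrightarrow> Kc A \<inter> Kc B = {}"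
  obtains \<epsilon> where "\<epsilon> > 0"
    "\<And>A B x y. A \<in> P \<Longrightarrow> B \<in> P \<Longrightarrow> x \<in> Kc A \<Longrightarrow> y \<in> Kc B \<Longrightarrow> dist x y \<le> \<epsilon> \<Longrightarrow> A = B"
proof -
  have "\<exists>d>0. \<forall>x\<in>Kc A. \<forall>y\<in>Kc B. d \<le> dist x y" if "A \<in> P" "B \<in> P" "A \<noteq> B" for A B
  proof (cases "Kc A = {} \<or> Kc B = {}")
    case True
    then show ?thesis by (intro exI[of _ 1]) auto
  next
    case False
    have "compact (Kc A)" using compact_Int_closed[OF comp cl[OF that(1)]] by simp
    moreover have "continuous_on (Kc A) (\<lambda>x. infdist x (Kc B))" by (intro continuous_intros)
    ultimately obtain z where z: "z \<in> Kc A" "\<And>x. x \<in> Kc A \<Longrightarrow> infdist z (Kc B) \<le> infdist x (Kc B)"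
      using continuous_attains_inf[of "Kc A" "\<lambda>x. infdist x (Kc B)"] False by blast
    have "infdist z (Kc B) \<noteq> 0"
      using z(1) disj[OF that] in_closed_iff_infdist_zero[OF cl[OF that(2)]] False by blast
    then have "infdist z (Kc B) > 0" using infdist_nonneg[of z "Kc B"] by linarith
    moreover have "infdist z (Kc B) \<le> dist x y" if "x \<in> Kc A" "y \<in> Kc B" for x y
      using z(2)[OF that(1)] infdist_le[OF that(2), of x] by linarith
    ultimately show ?thesis by blast
  qed
  then obtain d where d: "\<And>A B. A \<in> P \<Longrightarrow> B \<in> P \<Longrightarrow> A \<noteq> B \<Longrightarrow> d A B > 0 \<and> (\<forall>x\<in>Kc A. \<forall>y\<in>Kc B. d A B \<le> dist x y)"
    by metis
  \<comment> \<open>The entry 1 keeps the set nonempty when there is no pair of distinct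
    indices.\<close>
  define V where "V = insert 1 ((\<lambda>(A, B). d A B) ` {(A, B). A \<in> P \<and> B \<in> P \<and> A \<noteq> B})"
  have "finite {(A, B). A \<in> P \<and> B \<in> P \<and> A \<noteq> B}"
    by (rule finite_subset[of _ "P \<times> P"]) (use \<open>finite P\<close> in auto)
  then have V: "finite V" "V \<noteq> {}" by (auto simp: V_def)
  have "Min V > 0" using V d by (subst Min_gr_iff) (auto simp: V_def)
  show ?thesis
  proof (rule that[of "Min V / 2"])
    fix A B x y assume AB: "A \<in> P" "B \<in> P" "x \<in> Kc A" "y \<in> Kc B" "dist x y \<le> Min V / 2"
    show "A = B"
    proof (rule ccontr)
      assume "A \<noteq> B"
      then have "d A B \<in> V" using AB by (force simp: V_def)
      then have "Min V \<le> d A B" using V by simp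
      then show False using d[OF AB(1,2) \<open>A \<noteq> B\<close>] AB(3,4,5) \<open>Min V > 0\<close> by fastforce
    qed
  qed (use \<open>Min V > 0\<close> in simp)
qed

context invariant_measure
begin

text \<open>Markov's inequality: by invariance the expected number of visits to \<open>B\<close>
  before time \<open>n\<close> is \<open>n * measure \<mu> B\<close>.\<close>

lemma visits_markov:
  assumes B: "B \<in> sets borel" and "\<theta> > 0" and n: "n \<ge> 1"
  shows "{x. real (card {i. i < n \<and> (T ^^ i) x \<in> B}) \<le> \<theta> * real n} \<in> sets borel"
    and "measure \<mu> {x. \<not> real (card {i. i < n \<and> (T ^^ i) x \<in> B}) \<le> \<theta> * real n} \<le> measure \<mu> B / \<theta>"
proof -
  define V where "V x = (\<Sum>i<n. indicator B ((T ^^ i) x) :: real)" for x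
  have V: "V x = real (card {i. i < n \<and> (T ^^ i) x \<in> B})" for x
  proof -
    have "V x = (\<Sum>i\<in>{i. i < n \<and> (T ^^ i) x \<in> B}. 1)"
      unfolding V_def by (rule sum.mono_neutral_cong_right) auto
    then show ?thesis by simp
  qed
  have mB: "(T ^^ i) -` B \<in> sets borel" for i
    using measurable_sets[OF measurable_Tn B, of i] by simp
  have ind: "(indicator B ((T ^^ i) x) :: real) = indicator ((T ^^ i) -` B) x" for i x
    by (simp add: indicator_def)
  have Vm: "V \<in> borel_measurable borel" unfolding V_def[abs_def] ind
    using mB by (intro borel_measurable_sum borel_measurable_indicator) auto
  then show "{x. real (card {i. i < n \<and> (T ^^ i) x \<in> B}) \<le> \<theta> * real n} \<in> sets borel"
    unfolding V[symmetric] using borel_measurable_le[of V borel "\<lambda>_. \<theta> * real n"] by simp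
  define A where "A = {x. \<not> V x \<le> \<theta> * real n}"
  have A: "A \<in> sets \<mu>" unfolding A_def
    using borel_measurable_less[of "\<lambda>_. \<theta> * real n" borel V] Vm by (simp add: not_le)
  have iI: "integrable \<mu> (\<lambda>x. indicator ((T ^^ i) -` B) x :: real)" for i
    using mB by (intro integrable_real_indicator) (auto simp: less_top[symmetric])
  have "\<theta> * real n * measure \<mu> A = (\<integral>x. \<theta> * real n * indicator A x \<partial>\<mu>)" using A by simp
  also have "\<dots> \<le> (\<integral>x. V x \<partial>\<mu>)"
  proof (rule integral_mono)
    show "integrable \<mu> (\<lambda>x. \<theta> * real n * indicator A x)"
      using A by (intro integrable_mult_right integrable_real_indicator) (auto simp: less_top[symmetric])
    show "integrable \<mu> V" unfolding V_def[abs_def] ind using iI by (intro Bochner_Integration.integrable_sum)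
    show "\<theta> * real n * indicator A x \<le> V x" for x by (auto simp: A_def indicator_def V)
  qed
  also have "\<dots> = (\<Sum>i<n. measure \<mu> ((T ^^ i) -` B))"
    unfolding V_def[abs_def] ind using mB iI by (subst Bochner_Integration.integral_sum) auto
  also have "\<dots> = real n * measure \<mu> B" using measure_Tn[OF B] by simp
  finally have "\<theta> * measure \<mu> A \<le> measure \<mu> B" using n by (simp add: mult.commute mult.left_commute)
  then show "measure \<mu> {x. \<not> real (card {i. i < n \<and> (T ^^ i) x \<in> B}) \<le> \<theta> * real n} \<le> measure \<mu> B / \<theta>"
    unfolding V[symmetric] A_def using \<open>\<theta> > 0\<close> by (simp add: field_simps)
qed

lemma closed_subpartition:
  assumes P: "finite_borel_partition P" and "\<gamma> > 0"
  obtains Kc where "\<And>A. A \<in> P \<Longrightarrow> closed (Kc A) \<and> Kc A \<subseteq> A" "measure \<mu> (- (\<Union>A\<in>P. Kc A)) < \<gamma>"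
proof -
  note partition = partition_P[OF P]
  define k where "k = card P"
  have "P \<noteq> {}" using partition(2) by (auto simp: partition_on_def)
  then have k: "real k > 0" using partition(1) by (simp add: k_def card_gt_0_iff)
  have "\<exists>C. closed C \<and> C \<subseteq> A \<and> measure \<mu> (A - C) < \<gamma> / real k" if "A \<in> P" for A
  proof -
    have "\<gamma> / real k > 0" using \<open>\<gamma> > 0\<close> k by simp
    from closed_open_regularity[OF prob_space_mu sets_mu partition(3)[OF that] this]
    obtain C U where CU: "closed C" "open U" "C \<subseteq> A" "A \<subseteq> U" "measure \<mu> (U - C) < \<gamma> / real k" by blast
    have "measure \<mu> (A - C) \<le> measure \<mu> (U - C)"
      using CU by (intro finite_measure_mono) auto
    then show ?thesis using CU by (intro exI[of _ C]) auto
  qed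
  then obtain Kc where Kc: "\<And>A. A \<in> P \<Longrightarrow> closed (Kc A) \<and> Kc A \<subseteq> A \<and> measure \<mu> (A - Kc A) < \<gamma> / real k"
    by metis
  have "- (\<Union>A\<in>P. Kc A) \<subseteq> (\<Union>A\<in>P. A - Kc A)" using partition(2) unfolding partition_on_def by blast
  then have "measure \<mu> (- (\<Union>A\<in>P. Kc A)) \<le> measure \<mu> (\<Union>A\<in>P. A - Kc A)"
    using partition Kc by (intro finite_measure_mono sets.finite_UN) auto
  also have "\<dots> \<le> (\<Sum>A\<in>P. measure \<mu> (A - Kc A))"
    using partition Kc by (intro finite_measure_subadditive_finite) auto
  also have "\<dots> < (\<Sum>A\<in>P. \<gamma> / real k)"
    using Kc partition(1) \<open>P \<noteq> {}\<close> by (intro sum_strict_mono) auto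
  also have "\<dots> = \<gamma>" using k by (simp add: k_def)
  finally show ?thesis using that[of Kc] Kc by blast
qed

end

context invariant_potential
begin

text \<open>
  Orbits in \<open>G n\<close> that rarely meet the complement of the closed cores of the cells still carry almost
  all entropy. For such orbits, failure of \<open>(n, \<epsilon>)\<close>-separation forces the itineraries to be close in
  Hamming distance, which leaves only exponentially few (with small rate) conflicts for each point.
\<close>

lemma separated_lower_bound:
  assumes P: "finite_borel_partition P" and r: "asymptotic_mean f \<mu> = ereal r"
    and b: "b < real_of_ereal (entropy_wrt T \<mu> P) + r"
  obtains \<epsilon> where "\<epsilon> > 0"
    "\<And>G. (\<And>n. G n \<in> sets borel) \<Longrightarrow> (\<lambda>n. measure \<mu> (G n)) \<longlonglongrightarrow> 1 \<Longrightarrow>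
      \<forall>\<^sub>F n in sequentially. \<exists>E\<subseteq>G n. finite E \<and> separated T n \<epsilon> E \<and> exp (b * real n) \<le> (\<Sum>x\<in>E. exp (f n x))"
proof -
  note partition = partition_P[OF P]
  define h where "h = real_of_ereal (entropy_wrt T \<mu> P)"
  define R where "R = h + r"
  \<comment> \<open>The gap is spent as follows: \<tau>/4 on passing from entropy to the exponential
    sum over \<open>S\<close>, \<tau>/4 on the greedy choice; the remaining \<tau>/2 pays an
    additive constant for large \<open>n\<close>.\<close>
  define \<tau> where "\<tau> = R - b"
  have \<tau>: "\<tau> > 0" using b by (simp add: \<tau>_def R_def h_def)
  obtain C where C: "C \<ge> 0" "\<And>y. bF 1 y \<le> C" using bF_1_bounded by blast
  define k where "k = card P"
  have "P \<noteq> {}" using partition(2) by (auto simp: partition_on_def)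
  then have k: "real k \<ge> 1" using partition(1) by (simp add: k_def card_gt_0_iff Suc_le_eq)
  define K1 where "K1 = ln (real k) + C"
  have K1: "K1 \<ge> 0" using C k by (simp add: K1_def)
  \<comment> \<open>\<kappa> bounds the mass that is given up. It is at most 1/2, and the loss of
    rate that it causes, at most \<open>\<kappa> * (\<bar>R\<bar> + K1)\<close>, is at most
    \<tau>/16.\<close>
  define \<kappa> where "\<kappa> = min (1/2) (\<tau> / (16 * (\<bar>R\<bar> + K1 + 1)))"
  have den: "\<bar>R\<bar> + K1 + 1 > 0" using K1 by linarith
  have \<kappa>: "\<kappa> > 0" "\<kappa> \<le> 1/2" using \<tau> den unfolding \<kappa>_def by (simp, intro min.cobounded1)
  have "\<kappa> * (\<bar>R\<bar> + K1) \<le> \<kappa> * (\<bar>R\<bar> + K1 + 1)" using \<kappa> by simp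
  also have "\<dots> \<le> \<tau> / (16 * (\<bar>R\<bar> + K1 + 1)) * (\<bar>R\<bar> + K1 + 1)"
    using den by (intro mult_right_mono) (auto simp: \<kappa>_def)
  also have "\<dots> = \<tau> / 16"
  proof -
    have "\<tau> / (16 * a) * a = \<tau> / 16" if "a > 0" for a :: real using that by simp
    then show ?thesis using den by blast
  qed
  finally have \<kappa>2: "\<kappa> * (\<bar>R\<bar> + K1) \<le> \<tau> / 16" .
  \<comment> \<open>The conflicts of a point will be counted by a Hamming ball of radius
    \<open>2 * \<theta> * n\<close>; \<open>t\<close> and \<theta> give each of the two terms of its
    exponent the rate \<tau>/8.\<close>
  define t where "t = min 1 (\<tau> / (8 * real k))"
  have t: "0 < t" "t \<le> 1" using \<tau> k by (auto simp: t_def)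
  have kt: "real k * t \<le> \<tau> / 8"
  proof -
    have "real k * t \<le> real k * (\<tau> / (8 * real k))" by (intro mult_left_mono) (auto simp: t_def)
    then show ?thesis using k by simp
  qed
  have lnt: "ln t \<le> 0" using t by simp
  \<comment> \<open>The denominator has \<open>1 - ln t\<close> in place of \<open>- ln t\<close>,
    because \<open>t\<close> may be 1.\<close>
  define \<theta> where "\<theta> = \<tau> / (16 * (1 - ln t))"
  have \<theta>: "\<theta> > 0" using \<tau> lnt by (auto simp: \<theta>_def)
  have \<theta>2: "- (2 * \<theta> * ln t) \<le> \<tau> / 8"
  proof -
    have "2 * \<theta> * (- ln t) \<le> 2 * \<theta> * (1 - ln t)" using \<theta> by (intro mult_left_mono) auto
    also have "\<dots> = \<tau> / 8"
    proof -
      have "2 * (\<tau> / (16 * a)) * a = \<tau> / 8" if "a > 0" for a :: real using that by simp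
      moreover have "1 - ln t > 0" using lnt by simp
      ultimately show ?thesis unfolding \<theta>_def by blast
    qed
    finally show ?thesis by simp
  qed
  \<comment> \<open>With this bound Markov's inequality leaves mass at most \<kappa>/2 outside
    \<open>Good n\<close>; the other half of \<kappa> is reserved for the complement of
    \<open>G n\<close>.\<close>
  obtain Kc where Kc: "\<And>A. A \<in> P \<Longrightarrow> closed (Kc A) \<and> Kc A \<subseteq> A"
    and small: "measure \<mu> (- (\<Union>A\<in>P. Kc A)) < \<kappa> * \<theta> / 2"
  proof -
    have "\<kappa> * \<theta> / 2 > 0" using \<kappa>(1) \<theta> by simp
    from closed_subpartition[OF P this] that show thesis by blast
  qed
  have disj: "Kc A \<inter> Kc B = {}" if "A \<in> P" "B \<in> P" "A \<noteq> B" for A B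
    using partition(2) Kc that unfolding partition_on_def disjoint_def by blast
  obtain \<epsilon> where \<epsilon>: "\<epsilon> > 0"
    "\<And>A B x y. A \<in> P \<Longrightarrow> B \<in> P \<Longrightarrow> x \<in> Kc A \<Longrightarrow> y \<in> Kc B \<Longrightarrow> dist x y \<le> \<epsilon> \<Longrightarrow> A = B"
  proof -
    have cl: "closed (Kc A)" if "A \<in> P" for A using Kc[OF that] by blast
    from pairwise_separated_closed_sets[where Kc = Kc, OF tds_compact[OF tds] partition(1) cl disj] that
    show thesis by blast
  qed
  define B0 where "B0 = - (\<Union>A\<in>P. Kc A)"
  have "closed (\<Union>A\<in>P. Kc A)" using Kc partition(1) by auto
  then have B0: "B0 \<in> sets borel" unfolding B0_def by (intro borel_open open_Compl)
  define Good where "Good n = {x. real (card {i. i < n \<and> (T ^^ i) x \<in> B0}) \<le> \<theta> * real n}" for n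
  interpret symbolic_process \<mu> P "itinerary T P" by (rule symbolic_process_itinerary[OF P])
  show ?thesis
  proof (rule that[OF \<epsilon>(1)])
    fix G assume G: "\<And>n. G n \<in> sets borel" and lim: "(\<lambda>n. measure \<mu> (G n)) \<longlonglongrightarrow> 1"
    \<comment> \<open>Any constant above 32 works: the contradiction for \<open>lnZ\<close> needs
      \<open>n * \<tau> / 16\<close> to exceed 2.\<close>
    obtain n0 :: nat where n0: "real n0 \<ge> 33 / \<tau>" using real_arch_simple by blast
    have "\<forall>\<^sub>F n in sequentially. measure \<mu> (G n) > 1 - \<kappa> / 2"
      using \<kappa> by (intro order_tendstoD(1)[OF lim]) simp
    then show "\<forall>\<^sub>F n in sequentially. \<exists>E\<subseteq>G n. finite E \<and> separated T n \<epsilon> E \<and> exp (b * real n) \<le> (\<Sum>x\<in>E. exp (f n x))"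
      using eventually_ge_at_top[of "max 1 n0"]
    proof eventually_elim
      case (elim n)
      then have n: "n \<ge> 1" "real n \<ge> 33 / \<tau>" using n0 by auto
      then have n\<tau>: "real n * \<tau> \<ge> 33" using \<tau> by (simp add: field_simps)
      define H where "H = G n \<inter> Good n"
      define g where "g = measure \<mu> H"
      have mGood: "Good n \<in> sets borel" unfolding Good_def by (rule visits_markov(1)[OF B0 \<theta> n(1)])
      have H: "H \<in> sets borel" using mGood G by (auto simp: H_def)
      have g: "g \<ge> 1 - \<kappa>" "g \<le> 1"
      proof -
        have "measure \<mu> (- Good n) \<le> measure \<mu> B0 / \<theta>"
          using visits_markov(2)[OF B0 \<theta> n(1)] by (simp add: Good_def Collect_neg_eq)
        also have "\<dots> \<le> \<kappa> / 2" using small \<theta> by (simp add: B0_def field_simps)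
        finally have 1: "measure \<mu> (- Good n) \<le> \<kappa> / 2" .
        have "measure \<mu> (G n) \<le> measure \<mu> (H \<union> - Good n)"
          using H mGood by (intro finite_measure_mono) (auto simp: H_def)
        also have "\<dots> \<le> g + measure \<mu> (- Good n)"
          unfolding g_def using H mGood by (intro measure_Un_le) auto
        finally show "g \<ge> 1 - \<kappa>" using 1 elim(1) by linarith
      qed (simp add: g_def)
      have g0: "measure \<mu> H > 0" using g \<kappa> by (simp add: g_def)
      obtain S where S: "finite S" "S \<noteq> {}" "S \<subseteq> H" "inj_on (word (itinerary T P) 0 n) S"
        and ent: "word_entropy \<mu> P (itinerary T P) 0 n + If n \<le>
          g * (1 + ln (\<Sum>x\<in>S. exp (f n x))) + (1 - g) * real n * K1 + 2"
        using entropy_plus_mean_le[OF P n(1) H g0 C] unfolding g_def K1_def k_def by blast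
      define Z where "Z = (\<Sum>x\<in>S. exp (f n x))"
      have Z: "Z > 0" using S by (auto simp: Z_def intro!: sum_pos)
      have lnZ: "1 + ln Z \<ge> real n * (R - \<tau> / 4)"
      proof (rule ccontr)
        assume "\<not> ?thesis"
        then have "g * (1 + ln Z) \<le> g * (real n * (R - \<tau> / 4))" using g \<kappa> by (intro mult_left_mono) auto
        moreover have "real n * R \<le> g * (1 + ln Z) + (1 - g) * real n * K1 + 2"
          using ent wH_ge[OF P n(1)] If_ge[OF r n(1)] by (simp add: Z_def R_def h_def algebra_simps)
        moreover have "(1 - g) * real n * K1 \<le> \<kappa> * real n * K1"
          using g K1 by (intro mult_right_mono) auto
        ultimately have "real n * R \<le> g * (real n * (R - \<tau> / 4)) + \<kappa> * real n * K1 + 2" by linarith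
        moreover have "g * (real n * (R - \<tau> / 4)) = real n * R - (1 - g) * (real n * R) - g * (real n * \<tau> / 4)"
          by (simp add: algebra_simps)
        moreover have "- ((1 - g) * (real n * R)) \<le> \<kappa> * (real n * \<bar>R\<bar>)"
        proof -
          have "real n * (- R) \<le> real n * \<bar>R\<bar>" by (intro mult_left_mono) auto
          then have "(1 - g) * (real n * (- R)) \<le> (1 - g) * (real n * \<bar>R\<bar>)"
            using g by (intro mult_left_mono) auto
          then have "- ((1 - g) * (real n * R)) \<le> (1 - g) * (real n * \<bar>R\<bar>)" by simp
          also have "\<dots> \<le> \<kappa> * (real n * \<bar>R\<bar>)" using g by (intro mult_right_mono) auto
          finally show ?thesis .
        qed
        moreover have "- (g * (real n * \<tau> / 4)) \<le> - (1/2 * (real n * \<tau> / 4))"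
          using g \<kappa> \<tau> by (intro le_imp_neg_le mult_right_mono) auto
        moreover have "real n * (\<kappa> * (\<bar>R\<bar> + K1)) = \<kappa> * (real n * \<bar>R\<bar>) + \<kappa> * real n * K1"
          by (simp add: algebra_simps)
        ultimately have "real n * \<tau> / 8 \<le> real n * (\<kappa> * (\<bar>R\<bar> + K1)) + 2" by linarith
        also have "\<dots> \<le> real n * (\<tau> / 16) + 2" using \<kappa>2 by (intro add_right_mono mult_left_mono) auto
        finally show False using n\<tau> by (simp add: algebra_simps)
      qed
      define conf where "conf x y \<longleftrightarrow> (\<forall>i<n. dist ((T ^^ i) x) ((T ^^ i) y) \<le> \<epsilon>)" for x y
      have "real (card {y\<in>S. conf x y}) \<le> exp (real n * (\<tau> / 4))" if x: "x \<in> S" for x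
      proof -
        let ?w = "word (itinerary T P) 0 n"
        have ww: "?w y \<in> words n P" for y using word_range[of 0 n] by blast
        define BB where "BB = {w\<in>words n P. real (card {i. i < n \<and> w i \<noteq> ?w x i}) \<le> 2 * \<theta> * real n}"
        have "?w ` {y\<in>S. conf x y} \<subseteq> BB"
        proof (clarsimp simp: BB_def ww)
          fix y assume y: "y \<in> S" "conf x y"
          \<comment> \<open>Points of cores at distance at most \<epsilon> lie in the same core. So
            the itineraries differ only at times when one of the two orbits is outside all cores,
            which happens at most \<open>\<theta> * n\<close> times for each.\<close>
          have "itinerary T P i y = itinerary T P i x"
            if i: "i < n" "(T ^^ i) x \<notin> B0" "(T ^^ i) y \<notin> B0" for i
          proof -
            obtain A B where AB: "A \<in> P" "B \<in> P" "(T ^^ i) x \<in> Kc A" "(T ^^ i) y \<in> Kc B"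
              using i by (auto simp: B0_def)
            have "A = B" using \<epsilon>(2)[OF AB] y(2) i(1) by (auto simp: conf_def)
            then show ?thesis using AB Kc cell_eq[OF partition(2)] unfolding itinerary_def by blast
          qed
          then have "{i. i < n \<and> ?w y i \<noteq> ?w x i} \<subseteq> {i. i < n \<and> (T ^^ i) x \<in> B0} \<union> {i. i < n \<and> (T ^^ i) y \<in> B0}"
            by (auto simp: word_def)
          then have "card {i. i < n \<and> ?w y i \<noteq> ?w x i} \<le> card {i. i < n \<and> (T ^^ i) x \<in> B0} + card {i. i < n \<and> (T ^^ i) y \<in> B0}"
            by (intro order_trans[OF card_mono card_Un_le]) auto
          then have "real (card {i. i < n \<and> ?w y i \<noteq> ?w x i}) \<le> real (card {i. i < n \<and> (T ^^ i) x \<in> B0}) + real (card {i. i < n \<and> (T ^^ i) y \<in> B0})"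
            by linarith
          also have "\<dots> \<le> \<theta> * real n + \<theta> * real n"
            using x y(1) S(3) by (intro add_mono) (auto simp: H_def Good_def)
          finally show "real (card {i. i < n \<and> ?w y i \<noteq> ?w x i}) \<le> 2 * \<theta> * real n" by simp
        qed
        moreover have "finite BB" by (simp add: BB_def)
        moreover have "inj_on ?w {y\<in>S. conf x y}" using S(4) by (rule inj_on_subset) auto
        ultimately have "card {y\<in>S. conf x y} \<le> card BB" using card_inj_on_le by blast
        then have "real (card {y\<in>S. conf x y}) \<le> real (card BB)" by simp
        also have "\<dots> \<le> exp (real n * real k * t - 2 * \<theta> * real n * ln t)"
          unfolding BB_def k_def by (rule card_hamming_ball[OF partition(1) ww t])
        also have "\<dots> \<le> exp (real n * (\<tau> / 4))"
        proof -
          have "real n * real k * t - 2 * \<theta> * real n * ln t = real n * (real k * t + - (2 * \<theta> * ln t))"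
            by (simp add: algebra_simps)
          also have "\<dots> \<le> real n * (\<tau> / 8 + \<tau> / 8)" using kt \<theta>2 by (intro mult_left_mono add_mono) auto
          finally show ?thesis by simp
        qed
        finally show ?thesis .
      qed
      then obtain E where E: "E \<subseteq> S" "\<forall>x\<in>E. \<forall>y\<in>E. x \<noteq> y \<longrightarrow> \<not> conf x y \<or> \<not> conf y x"
        "(\<Sum>x\<in>S. exp (f n x)) \<le> exp (real n * (\<tau> / 4)) * (\<Sum>x\<in>E. exp (f n x))"
        using weighted_independent_subset[OF S(1), of conf "\<lambda>x. exp (f n x)" "exp (real n * (\<tau> / 4))"] \<epsilon>(1)
        by (auto simp: conf_def)
      have "exp (b * real n) \<le> exp (ln Z - real n * (\<tau> / 4))"
      proof -
        have "b * real n = real n * (R - \<tau>)" by (simp add: \<tau>_def)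
        also have "\<dots> \<le> ln Z - real n * (\<tau> / 4)" using lnZ n\<tau> by (simp add: algebra_simps)
        finally show ?thesis by simp
      qed
      also have "\<dots> = Z * exp (- (real n * (\<tau> / 4)))" using Z by (simp only: exp_diff exp_minus divide_inverse exp_ln)
      also have "\<dots> \<le> (exp (real n * (\<tau> / 4)) * (\<Sum>x\<in>E. exp (f n x))) * exp (- (real n * (\<tau> / 4)))"
        using E(3) by (intro mult_right_mono) (auto simp: Z_def)
      also have "\<dots> = (\<Sum>x\<in>E. exp (f n x))" by (simp add: exp_minus field_simps)
      finally have big: "exp (b * real n) \<le> (\<Sum>x\<in>E. exp (f n x))" .
      have "separated T n \<epsilon> E"
        unfolding separated_iff[OF n(1)] using E(2) by (auto simp: conf_def not_le dist_commute)
      moreover have "E \<subseteq> G n" "finite E" using E(1) S(1,3) by (auto simp: H_def intro: finite_subset)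
      ultimately show ?case using big by blast
    qed
  qed
qed

end

subsection \<open>The ergodic theorem\<close>

context invariant_measure
begin

definition bsum :: "('a \<Rightarrow> real) \<Rightarrow> nat \<Rightarrow> 'a \<Rightarrow> real" where
  "bsum g n x = (\<Sum>i<n. g ((T ^^ i) x))"

lemma bsum_Suc: "bsum g (Suc n) x = g x + bsum g n (T x)"
  by (simp add: bsum_def sum.lessThan_Suc_shift funpow_swap1 del: sum.lessThan_Suc)

lemma bsum_measurable [measurable]:
  assumes [measurable]: "g \<in> borel_measurable borel" shows "bsum g n \<in> borel_measurable borel"
  unfolding bsum_def[abs_def] by measurable

text \<open>Garsia: \<open>M\<^sub>N = max\<^bsub>n\<le>N\<^esub> S\<^sub>n g\<close> satisfies \<open>g \<ge> M\<^sub>N - M\<^sub>N \<circ> T\<close> wherever \<open>M\<^sub>N > 0\<close>.\<close>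

lemma maximal_ergodic_inequality:
  assumes g[measurable]: "g \<in> borel_measurable borel" and B: "\<And>x. \<bar>g x\<bar> \<le> B"
  shows "0 \<le> (\<integral>x. indicator {x. \<exists>n. bsum g n x > 0} x * g x \<partial>\<mu>)"
proof -
  define M where "M N x = (MAX n\<in>{..N}. bsum g n x)" for N x
  \<comment> \<open>The empty sum takes part in the maximum. Nonnegativity settles the pointwise
    inequality off \<open>E N\<close>, where \<open>M N\<close> is 0.\<close>
  have M0: "M N x \<ge> 0" for N x
    unfolding M_def by (rule Max_ge) (auto simp: bsum_def intro: image_eqI[of _ _ 0])
  have Mb: "M N x \<le> real N * B" for N x
    unfolding M_def
  proof (rule Max.boundedI)
    fix a assume "a \<in> (\<lambda>n. bsum g n x) ` {..N}"
    then obtain n where n: "n \<le> N" "a = bsum g n x" by auto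
    have "a \<le> (\<Sum>i<n. B)" unfolding n(2) bsum_def using B by (intro sum_mono) (auto dest: abs_le_D1)
    also have "\<dots> \<le> real N * B" using n B[of x] by (auto intro!: mult_right_mono)
    finally show "a \<le> real N * B" .
  qed auto
  have Mm[measurable]: "M N \<in> borel_measurable borel" for N
    unfolding M_def[abs_def] by (rule borel_measurable_Max) auto
  define E where "E N = {x. M N x > 0}" for N
  have Em[measurable]: "E N \<in> sets borel" for N unfolding E_def by measurable
  have pos: "0 \<le> (\<integral>x. indicator (E N) x * g x \<partial>\<mu>)" for N
  proof -
    have le: "M N x - M N (T x) \<le> indicator (E N) x * g x" for x
    proof (cases "x \<in> E N")
      case True
      have "M N x \<in> (\<lambda>n. bsum g n x) ` {..N}" unfolding M_def by (rule Max_in) auto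
      then obtain n where n: "n \<le> N" "M N x = bsum g n x" by auto
      have "n \<noteq> 0"
      proof
        assume "n = 0"
        then have "M N x = 0" using n by (simp add: bsum_def)
        then show False using True by (simp add: E_def)
      qed
      then obtain m where m: "n = Suc m" using not0_implies_Suc by blast
      have "bsum g m (T x) \<le> M N (T x)" unfolding M_def using n m by (intro Max_ge) auto
      then show ?thesis using n True by (simp add: m bsum_Suc)
    next
      case False
      then show ?thesis using M0[of N x] M0[of N "T x"] by (simp add: E_def)
    qed
    have iM: "integrable \<mu> (M N)"
      using M0 Mb by (intro integrable_const_bound[where B = "real N * B"]) auto
    have iMT: "integrable \<mu> (\<lambda>x. M N (T x))"
      using M0 Mb by (intro integrable_const_bound[where B = "real N * B"]) auto
    have "0 = (\<integral>x. M N x \<partial>\<mu>) - (\<integral>x. M N (T x) \<partial>\<mu>)" using integral_Tn[OF Mm, of N 1] by simp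
    also have "\<dots> = (\<integral>x. M N x - M N (T x) \<partial>\<mu>)" using iM iMT by simp
    also have "\<dots> \<le> (\<integral>x. indicator (E N) x * g x \<partial>\<mu>)"
    proof (rule integral_mono)
      show "integrable \<mu> (\<lambda>x. indicator (E N) x * g x)"
        using B by (intro integrable_const_bound[where B = B]) (auto simp: indicator_def intro: order_trans[OF abs_ge_zero])
    qed (use iM iMT le in auto)
    finally show ?thesis .
  qed
  have "(\<lambda>N. \<integral>x. indicator (E N) x * g x \<partial>\<mu>) \<longlonglongrightarrow> (\<integral>x. indicator {x. \<exists>n. bsum g n x > 0} x * g x \<partial>\<mu>)"
  proof (rule integral_dominated_convergence[where w = "\<lambda>_. B"])
    show "(\<lambda>x. indicator {x. \<exists>n. bsum g n x > 0} x * g x) \<in> borel_measurable \<mu>" by measurable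
    show "AE x in \<mu>. norm (indicator (E N) x * g x) \<le> B" for N
      using B by (auto simp: indicator_def intro: order_trans[OF abs_ge_zero])
    show "AE x in \<mu>. (\<lambda>N. indicator (E N) x * g x) \<longlonglongrightarrow> indicator {x. \<exists>n. bsum g n x > 0} x * g x"
    proof (rule AE_I2)
      fix x
      show "(\<lambda>N. indicator (E N) x * g x) \<longlonglongrightarrow> indicator {x. \<exists>n. bsum g n x > 0} x * g x"
      proof (cases "\<exists>n. bsum g n x > 0")
        case True
        then obtain n where n: "bsum g n x > 0" by blast
        have "x \<in> E N" if "N \<ge> n" for N
        proof -
          have "bsum g n x \<le> M N x" unfolding M_def using that by (intro Max_ge) auto
          then show ?thesis using n by (simp add: E_def)
        qed
        then show ?thesis using True by (auto intro!: tendsto_eventually eventually_sequentiallyI[of n])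
      next
        case False
        then have "x \<notin> E N" for N unfolding E_def M_def by (subst mem_Collect_eq, subst Max_gr_iff) auto
        then show ?thesis using False by simp
      qed
    qed
  qed auto
  then show ?thesis using pos by (intro LIMSEQ_le_const) auto
qed

text \<open>The limsup is invariant at every point, so the set where it exceeds \<open>c\<close> is
  strictly invariant, as the definition of ergodicity demands. If this set had full measure, the
  maximal inequality for \<open>g - c\<close> would force the integral of \<open>g\<close> to be at
  least \<open>c\<close>.\<close>

lemma ergodic_limsup_le:
  assumes erg: "ergodic T \<mu>" and g: "continuous_on UNIV g" and c: "(\<integral>x. g x \<partial>\<mu>) < c"
  shows "AE x in \<mu>. limsup (\<lambda>n. ereal (bsum g n x / real n)) \<le> ereal c"
proof -
  obtain B where B: "B \<ge> 0" "\<And>x. \<bar>g x\<bar> \<le> B"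
    using compact_bounded_function[OF tds_compact[OF tds] g] by blast
  have gm[measurable]: "g \<in> borel_measurable borel" using g by (rule borel_measurable_continuous_onI)
  define L where "L x = limsup (\<lambda>n. ereal (bsum g n x / real n))" for x
  have Lm[measurable]: "L \<in> borel_measurable borel" unfolding L_def[abs_def] by measurable
  have LT: "L (T x) = L x" for x
  proof -
    have "(\<lambda>n. bsum g n (T x) / real n - bsum g n x / real n) \<longlonglongrightarrow> 0"
    proof (rule Lim_null_comparison)
      show "\<forall>\<^sub>F n in sequentially. norm (bsum g n (T x) / real n - bsum g n x / real n) \<le> 2 * B / real n"
      proof (rule always_eventually, rule allI)
        fix n
        have "bsum g n (T x) - bsum g n x = g ((T ^^ n) x) - g x"
          using bsum_Suc[of g n x] by (simp add: bsum_def)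
        then have "\<bar>bsum g n (T x) - bsum g n x\<bar> \<le> 2 * B"
          using B(2)[of "(T ^^ n) x"] B(2)[of x] by linarith
        then show "norm (bsum g n (T x) / real n - bsum g n x / real n) \<le> 2 * B / real n"
          by (simp add: diff_divide_distrib[symmetric] divide_right_mono)
      qed
    qed (rule lim_const_over_n)
    then have "(\<lambda>n. ereal (bsum g n (T x) / real n - bsum g n x / real n)) \<longlonglongrightarrow> ereal 0" by simp
    from ereal_limsup_lim_add[OF this, of "\<lambda>n. ereal (bsum g n x / real n)"]
    show ?thesis by (simp add: L_def)
  qed
  define A where "A = {x. L x > ereal c}"
  have A: "A \<in> sets \<mu>" unfolding A_def by simp
  have "T -` A = A" using LT by (auto simp: A_def)
  then have "measure \<mu> A = 0 \<or> measure \<mu> A = 1" using erg A by (auto simp: ergodic_def)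
  moreover have "measure \<mu> A \<noteq> 1"
  proof
    assume 1: "measure \<mu> A = 1"
    define g0 where "g0 x = g x - c" for x
    have g0m: "g0 \<in> borel_measurable borel" unfolding g0_def[abs_def] by measurable
    have "x \<in> A \<Longrightarrow> \<exists>n. bsum g0 n x > 0" for x
    proof -
      assume "x \<in> A"
      then have "\<not> L x \<le> ereal c" by (simp add: A_def)
      have "\<exists>n\<ge>1. bsum g n x / real n > c"
      proof (rule ccontr)
        assume "\<not> ?thesis"
        then have "\<forall>\<^sub>F n in sequentially. ereal (bsum g n x / real n) \<le> ereal c"
          by (intro eventually_sequentiallyI[of 1]) auto
        then have "L x \<le> ereal c" unfolding L_def by (rule Limsup_bounded)
        then show False using \<open>\<not> L x \<le> ereal c\<close> by simp
      qed
      then obtain n where "n \<ge> 1" "bsum g n x > c * real n" by (auto simp: field_simps)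
      then have "bsum g0 n x > 0" by (simp add: bsum_def g0_def sum_subtractf mult.commute)
      then show ?thesis ..
    qed
    moreover have "AE x in \<mu>. x \<in> A" using A 1 by (simp add: prob_eq_1)
    ultimately have ae: "AE x in \<mu>. indicator {x. \<exists>n. bsum g0 n x > 0} x * g0 x = g0 x" by auto
    have "0 \<le> (\<integral>x. indicator {x. \<exists>n. bsum g0 n x > 0} x * g0 x \<partial>\<mu>)"
    proof (rule maximal_ergodic_inequality[OF g0m])
      show "\<bar>g0 x\<bar> \<le> B + \<bar>c\<bar>" for x using B(2)[of x] by (simp add: g0_def)
    qed
    also have "\<dots> = (\<integral>x. g0 x \<partial>\<mu>)"
    proof (rule integral_cong_AE)
      have [measurable]: "bsum g0 n \<in> borel_measurable borel" for n using g0m by (rule bsum_measurable)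
      show "(\<lambda>x. indicator {x. \<exists>n. bsum g0 n x > 0} x * g0 x) \<in> borel_measurable \<mu>" using g0m by measurable
    qed (use ae g0m in auto)
    also have "\<dots> = (\<integral>x. g x \<partial>\<mu>) - c"
      unfolding g0_def using integrable_continuous[OF g] prob_space
      by (subst Bochner_Integration.integral_diff) (auto simp: prob_space[simplified])
    finally show False using c by simp
  qed
  ultimately have "measure \<mu> A = 0" by blast
  then have "A \<in> null_sets \<mu>" using A by (simp add: null_sets_def emeasure_eq_measure)
  then have "AE x in \<mu>. x \<notin> A" by (rule AE_not_in)
  then show ?thesis by (simp add: A_def L_def not_less)
qed

lemma ergodic_averages:
  assumes erg: "ergodic T \<mu>" and g: "continuous_on UNIV g" and "\<delta> > 0"
  shows "AE x in \<mu>. \<forall>\<^sub>F n in sequentially. \<bar>bsum g n x / real n - (\<integral>x. g x \<partial>\<mu>)\<bar> \<le> \<delta>"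
proof -
  define I where "I = (\<integral>x. g x \<partial>\<mu>)"
  have up: "AE x in \<mu>. \<forall>\<^sub>F n in sequentially. bsum k n x / real n < c + \<delta>"
    if k: "continuous_on UNIV k" and c: "(\<integral>x. k x \<partial>\<mu>) = c" for k c
  proof -
    have "AE x in \<mu>. limsup (\<lambda>n. ereal (bsum k n x / real n)) \<le> ereal (c + \<delta> / 2)"
      using c \<open>\<delta> > 0\<close> by (intro ergodic_limsup_le[OF erg k]) auto
    then show ?thesis
    proof eventually_elim
      case (elim x)
      have "ereal (c + \<delta> / 2) < ereal (c + \<delta>)" using \<open>\<delta> > 0\<close> by simp
      then have "limsup (\<lambda>n. ereal (bsum k n x / real n)) < ereal (c + \<delta>)" using elim by (rule le_less_trans[rotated])
      then have "\<forall>\<^sub>F n in sequentially. ereal (bsum k n x / real n) < ereal (c + \<delta>)" by (rule Limsup_lessD)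
      then show ?case by simp
    qed
  qed
  have "AE x in \<mu>. \<forall>\<^sub>F n in sequentially. bsum (\<lambda>x. - g x) n x / real n < - I + \<delta>"
    by (rule up) (use g in \<open>auto simp: I_def intro: continuous_intros\<close>)
  moreover have "AE x in \<mu>. \<forall>\<^sub>F n in sequentially. bsum g n x / real n < I + \<delta>"
    by (rule up) (use g in \<open>auto simp: I_def\<close>)
  ultimately show ?thesis
  proof eventually_elim
    case (elim x)
    from elim show ?case
    proof eventually_elim
      case (elim n)
      have "bsum (\<lambda>x. - g x) n x = - bsum g n x" by (simp add: bsum_def sum_negf)
      then show ?case using elim by (simp add: I_def abs_le_iff)
    qed
  qed
qed

text \<open>Almost every point belongs to \<open>G n\<close> for all large \<open>n\<close>;
  dominated convergence of the indicators gives convergence of the measures.\<close>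

lemma ergodic_generic_sets:
  assumes erg: "ergodic T \<mu>" and L: "finite L" "\<And>g. g \<in> L \<Longrightarrow> continuous_on UNIV g" and "\<delta> > 0"
  defines "G \<equiv> \<lambda>n. {x. \<forall>g\<in>L. \<bar>bsum g n x / real n - (\<integral>x. g x \<partial>\<mu>)\<bar> \<le> \<delta>}"
  shows "G n \<in> sets borel" and "(\<lambda>n. measure \<mu> (G n)) \<longlonglongrightarrow> 1"
proof -
  have Gm: "G n \<in> sets borel" for n
  proof -
    have "G n = (\<Inter>g\<in>L. {x. \<bar>bsum g n x / real n - (\<integral>x. g x \<partial>\<mu>)\<bar> \<le> \<delta>}) \<inter> UNIV" by (auto simp: G_def)
    moreover have "{x. \<bar>bsum g n x / real n - (\<integral>x. g x \<partial>\<mu>)\<bar> \<le> \<delta>} \<in> sets borel" if "g \<in> L" for g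
    proof -
      have [measurable]: "g \<in> borel_measurable borel" using L(2)[OF that] by (rule borel_measurable_continuous_onI)
      show ?thesis by measurable
    qed
    ultimately show ?thesis using L(1) by (cases "L = {}") (auto intro!: sets.finite_INT)
  qed
  then show "G n \<in> sets borel" .
  have "AE x in \<mu>. \<forall>g\<in>L. \<forall>\<^sub>F n in sequentially. \<bar>bsum g n x / real n - (\<integral>x. g x \<partial>\<mu>)\<bar> \<le> \<delta>"
    using ergodic_averages[OF erg L(2) \<open>\<delta> > 0\<close>] L(1) by (simp add: AE_finite_all)
  then have ae: "AE x in \<mu>. (\<lambda>n. indicator (G n) x :: real) \<longlonglongrightarrow> 1"
  proof eventually_elim
    case (elim x)
    then have "\<forall>\<^sub>F n in sequentially. x \<in> G n"
      using L(1) by (simp add: G_def eventually_ball_finite)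
    then show ?case by (intro tendsto_eventually) (auto elim: eventually_mono)
  qed
  have "(\<lambda>n. \<integral>x. indicator (G n) x \<partial>\<mu>) \<longlonglongrightarrow> (\<integral>x. (1::real) \<partial>\<mu>)"
    by (rule integral_dominated_convergence[where w = "\<lambda>_. 1"]) (use ae Gm in auto)
  then show "(\<lambda>n. measure \<mu> (G n)) \<longlonglongrightarrow> 1" using Gm prob_space by simp
qed

end

subsection \<open>Exponential growth rates\<close>

lemma ext_ln_mono: "x \<le> y \<Longrightarrow> ext_ln x \<le> ext_ln y"
  unfolding ext_ln_def by (cases x; cases y) auto

lemma ext_ln_exp: "ext_ln (ereal (exp b)) = ereal b"
  by (simp add: ext_ln_def)

lemma exp_growth_mono:
  assumes "\<And>n. n \<ge> 1 \<Longrightarrow> a n \<le> b n" shows "exp_growth a \<le> exp_growth b"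
  unfolding exp_growth_def
proof (rule Limsup_mono)
  show "\<forall>\<^sub>F n in sequentially. ext_ln (a n) / ereal (real n) \<le> ext_ln (b n) / ereal (real n)"
    using eventually_ge_at_top[of 1]
  proof eventually_elim
    case (elim n)
    then show ?case using assms[of n] by (intro ereal_divide_right_mono ext_ln_mono) auto
  qed
qed

lemma exp_growth_ge:
  assumes "\<forall>\<^sub>F n in sequentially. ereal (exp (b * real n)) \<le> a n"
  shows "ereal b \<le> exp_growth a"
  unfolding exp_growth_def
proof (rule le_Limsup)
  show "\<forall>\<^sub>F n in sequentially. ereal b \<le> ext_ln (a n) / ereal (real n)"
    using assms eventually_ge_at_top[of 1]
  proof eventually_elim
    case (elim n)
    have "ereal (b * real n) / ereal (real n) \<le> ext_ln (a n) / ereal (real n)"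
      using elim ext_ln_mono[OF elim(1)] by (intro ereal_divide_right_mono) (auto simp: ext_ln_exp)
    then show ?case using elim by simp
  qed
qed simp

text \<open>A large limsup yields good lengths only infinitely often, which suffices because each
  index of a net selects its own \<open>n\<close>; the free bound \<open>N\<close> drives the
  selected lengths to infinity.\<close>

lemma exp_growth_less:
  assumes "ereal b < exp_growth a" obtains n where "n \<ge> N" "ereal (exp (b * real n)) < a n"
proof -
  have "\<exists>n\<ge>N. ereal (exp (b * real n)) < a n"
  proof (rule ccontr)
    assume "\<not> ?thesis"
    then have *: "a n \<le> ereal (exp (b * real n))" if "n \<ge> N" for n using that by (meson not_le)
    have "exp_growth a \<le> ereal b"
      unfolding exp_growth_def
    proof (rule Limsup_bounded)
      show "\<forall>\<^sub>F n in sequentially. ext_ln (a n) / ereal (real n) \<le> ereal b"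
        using eventually_ge_at_top[of "max 1 N"]
      proof eventually_elim
        case (elim n)
        then have "ext_ln (a n) / ereal (real n) \<le> ereal (b * real n) / ereal (real n)"
          using ext_ln_mono[OF *[of n]] by (intro ereal_divide_right_mono) (auto simp: ext_ln_exp)
        then show ?case using elim by simp
      qed
    qed
    then show False using assms by simp
  qed
  then show ?thesis using that by blast
qed

text \<open>Makes the limit \<epsilon> to 0 in all three pressures a supremum, so that a strict
  lower bound on a pressure is witnessed at a single scale.\<close>

lemma Lim_at_right_antimono:
  fixes p :: "real \<Rightarrow> ereal"
  assumes "\<And>x y. 0 < x \<Longrightarrow> x \<le> y \<Longrightarrow> p y \<le> p x"
  shows "Lim (at_right 0) p = (SUP e\<in>{0<..}. p e)"
proof (rule tendsto_Lim)
  show "(p \<longlongrightarrow> (SUP e\<in>{0<..}. p e)) (at_right 0)"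
  proof (rule order_tendstoI)
    fix a assume "a < (SUP e\<in>{0<..}. p e)"
    then obtain e where e: "e > 0" "a < p e" by (auto simp: less_SUP_iff)
    then have "a < p x" if "0 < x" "x < e" for x using assms[of x e] that by (meson less_le_trans less_imp_le)
    then show "\<forall>\<^sub>F x in at_right 0. a < p x" using e(1) by (auto simp: eventually_at_right_field)
  next
    fix a assume a: "(SUP e\<in>{0<..}. p e) < a"
    have "p x < a" if "0 < x" for x using a that by (meson SUP_upper greaterThan_iff le_less_trans)
    then show "\<forall>\<^sub>F x in at_right 0. p x < a" by (auto simp: eventually_at_right_field intro: exI[of _ 1])
  qed
qed simp

lemma pressure_eq_SUP: "pressure T f = (SUP e\<in>{0<..}. P_eps T f e)"
  unfolding pressure_def
proof (rule Lim_at_right_antimono)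
  fix x y :: real assume "0 < x" "x \<le> y"
  then show "P_eps T f y \<le> P_eps T f x"
    unfolding P_eps_def P_n_def
    by (intro exp_growth_mono SUP_subset_mono) (auto simp: separated_def intro: le_less_trans)
qed

lemma separated_tuples_antimono: "x \<le> y \<Longrightarrow> separated_tuples n y E \<Longrightarrow> separated_tuples n x E"
  unfolding separated_tuples_def by (meson le_less_trans)

lemma sup_exp_sum_antimono: "x \<le> y \<Longrightarrow> sup_exp_sum F y n Y \<le> sup_exp_sum F x n Y"
  unfolding sup_exp_sum_def by (intro SUP_subset_mono) (auto intro: separated_tuples_antimono)

lemma GP_eq_SUP: "GP T F = (SUP e\<in>{0<..}. GP_eps T F e)"
  unfolding GP_def GP_eps_def
  by (intro Lim_at_right_antimono INF_mono' exp_growth_mono sup_exp_sum_antimono)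

lemma GP_at_eq_SUP: "GP_at T F \<mu> = (SUP e\<in>{0<..}. GP_at_eps T F \<mu> e)"
  unfolding GP_at_def GP_at_eps_def
  by (intro Lim_at_right_antimono INF_mono' exp_growth_mono sup_exp_sum_antimono)

lemma sup_exp_sum_less:
  assumes "ereal (exp c) < sup_exp_sum F e n Y"
  obtains E where "finite E" "E \<noteq> {}" "E \<subseteq> Y" "separated_tuples n e E" "exp c < (\<Sum>x\<in>E. exp (F n x))"
proof -
  obtain E where E: "finite E" "E \<subseteq> Y" "separated_tuples n e E" "exp c < (\<Sum>x\<in>E. exp (F n x))"
    using assms unfolding sup_exp_sum_def less_SUP_iff by auto
  moreover have "E \<noteq> {}" using E(4) by (metis exp_gt_zero less_asym sum.empty)
  ultimately show ?thesis using that by blast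
qed

subsection \<open>Orbits as pseudo-orbits\<close>

definition orbit_block :: "('a \<Rightarrow> 'a) \<Rightarrow> nat \<Rightarrow> 'a \<Rightarrow> nat \<Rightarrow> 'a" where
  "orbit_block T n x = (\<lambda>i\<in>{..<n}. (T ^^ i) x)"

lemma orbit_block_pseudo_orbit:
  assumes "\<delta> > 0" shows "orbit_block T n x \<in> pseudo_orbits T \<delta> n"
proof -
  have "(\<Sum>i<n - 1. dist (T (orbit_block T n x i)) (orbit_block T n x (i + 1))) = 0"
    by (intro sum.neutral) (auto simp: orbit_block_def)
  moreover have "orbit_block T n x \<in> tuples n" by (simp add: orbit_block_def)
  ultimately show ?thesis using assms unfolding pseudo_orbits_def by simp
qed

text \<open>A point goes to its orbit segment: coordinate 0 recovers the point, and separation along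
  orbits is separation of segments.\<close>

lemma sup_exp_sum_orbits:
  assumes n: "n \<ge> 1" and E: "finite E" "separated T n e E" and Y: "\<And>x. x \<in> E \<Longrightarrow> orbit_block T n x \<in> Y"
  shows "ereal (\<Sum>x\<in>E. exp (induced_potential T F n x)) \<le> sup_exp_sum F e n Y"
proof -
  have inj: "inj_on (orbit_block T n) E"
  proof (rule inj_onI)
    fix x y assume "orbit_block T n x = orbit_block T n y"
    then have "orbit_block T n x 0 = orbit_block T n y 0" by simp
    then show "x = y" using n by (simp add: orbit_block_def)
  qed
  have sep: "separated_tuples n e (orbit_block T n ` E)"
    unfolding separated_tuples_def
  proof (intro ballI impI)
    fix u v assume "u \<in> orbit_block T n ` E" "v \<in> orbit_block T n ` E" "u \<noteq> v"
    then obtain x y where xy: "x \<in> E" "y \<in> E" "x \<noteq> y" "u = orbit_block T n x" "v = orbit_block T n y" by auto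
    then obtain i where "i < n" "dist ((T ^^ i) x) ((T ^^ i) y) > e" using E(2) unfolding separated_iff[OF n] by blast
    then show "\<exists>i<n. dist (u i) (v i) > e" using xy by (auto simp: orbit_block_def)
  qed
  have "(\<Sum>x\<in>E. exp (induced_potential T F n x)) = (\<Sum>u\<in>orbit_block T n ` E. exp (F n u))"
    using inj by (simp add: sum.reindex induced_potential_def orbit_block_def[symmetric])
  then show ?thesis
    unfolding sup_exp_sum_def using E(1) sep Y by (intro SUP_upper2[of "orbit_block T n ` E"]) auto
qed

lemma pressure_le_GP: "pressure T (induced_potential T F) \<le> GP T F"
  unfolding pressure_eq_SUP GP_eq_SUP
proof (rule SUP_mono')
  fix e
  show "P_eps T (induced_potential T F) e \<le> GP_eps T F e"
    unfolding GP_eps_def P_eps_def P_n_def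
    by (intro INF_greatest exp_growth_mono SUP_least) (auto intro!: sup_exp_sum_orbits orbit_block_pseudo_orbit)
qed

subsection \<open>Gibbs distributions on separated sets\<close>

lemma gibbs_pmf:
  fixes s :: "'b \<Rightarrow> real"
  assumes E: "finite E" "E \<noteq> {}"
  obtains \<nu> where "set_pmf \<nu> = E" "\<And>x. x \<in> E \<Longrightarrow> pmf \<nu> x = exp (s x) / (\<Sum>y\<in>E. exp (s y))"
proof -
  define Z where "Z = (\<Sum>y\<in>E. exp (s y))"
  have Z: "Z > 0" unfolding Z_def using E by (intro sum_pos) auto
  define p where "p x = (if x \<in> E then exp (s x) / Z else 0)" for x
  have p0: "0 \<le> p x" for x using Z by (simp add: p_def)
  have "(\<integral>\<^sup>+x. ennreal (p x) \<partial>count_space UNIV) = (\<Sum>x\<in>E. ennreal (p x))"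
    using E(1) by (intro nn_integral_count_space') (auto simp: p_def)
  also have "\<dots> = ennreal (\<Sum>x\<in>E. p x)" using p0 by (rule sum_ennreal)
  also have "(\<Sum>x\<in>E. p x) = (\<Sum>x\<in>E. exp (s x) / Z)" by (intro sum.cong) (auto simp: p_def)
  also have "\<dots> = 1" using Z by (simp add: sum_divide_distrib[symmetric] Z_def)
  finally have p1: "(\<integral>\<^sup>+x. ennreal (p x) \<partial>count_space UNIV) = 1" by simp
  have "pmf (embed_pmf p) x = p x" for x by (rule pmf_embed_pmf[OF p0 p1])
  moreover from this have "set_pmf (embed_pmf p) = E"
    using Z by (auto simp: set_pmf_iff p_def split: if_splits)
  ultimately show ?thesis using that[of "embed_pmf p"] by (simp add: p_def Z_def)
qed

text \<open>A separated set has at most one point per cell of the product partition.\<close>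

lemma gibbs_entropy:
  fixes F :: "nat \<Rightarrow> (nat \<Rightarrow> 'a::metric_space) \<Rightarrow> real"
  assumes P: "finite P" "partition_on UNIV P"
    and small: "\<And>A x y. A \<in> P \<Longrightarrow> x \<in> A \<Longrightarrow> y \<in> A \<Longrightarrow> dist x y \<le> e"
    and E: "finite E" "E \<noteq> {}" "separated_tuples n e E"
    and \<nu>: "set_pmf \<nu> = E" "\<And>x. x \<in> E \<Longrightarrow> pmf \<nu> x = exp (F n x) / (\<Sum>y\<in>E. exp (F n y))"
  shows "ln (\<Sum>x\<in>E. exp (F n x)) =
    word_entropy (measure_pmf \<nu>) P (\<lambda>i x. cell P (x i)) 0 n + measure_pmf.expectation \<nu> (F n)"
proof -
  define Z where "Z = (\<Sum>x\<in>E. exp (F n x))"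
  have Z: "Z > 0" unfolding Z_def using E by (intro sum_pos) auto
  let ?w = "word (\<lambda>i x. cell P (x i)) 0 n :: (nat \<Rightarrow> 'a) \<Rightarrow> _"
  have inj: "inj_on ?w E"
  proof (rule inj_onI, rule ccontr)
    fix x y assume xy: "x \<in> E" "y \<in> E" "?w x = ?w y" "x \<noteq> y"
    then obtain i where i: "i < n" "dist (x i) (y i) > e" using E(3) by (auto simp: separated_tuples_def)
    have "?w x i = ?w y i" using xy(3) by simp
    then have "cell P (x i) = cell P (y i)" using i(1) by (simp add: word_def)
    then have "y i \<in> cell P (x i)" using cell_in(2)[OF P(2), of "y i"] by simp
    then have "dist (x i) (y i) \<le> e" by (rule small[OF cell_in[OF P(2)]])
    then show False using i by simp
  qed
  have meas: "measure \<nu> {x. ?w x = w} = (\<Sum>x\<in>{x\<in>E. ?w x = w}. pmf \<nu> x)" for w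
  proof -
    have "measure \<nu> {x. ?w x = w} = measure \<nu> {x\<in>E. ?w x = w}"
      using \<nu>(1) by (intro measure_eq_AE) (auto simp: AE_measure_pmf_iff)
    then show ?thesis using E(1) by (simp add: measure_measure_pmf_finite)
  qed
  have "word_entropy (measure_pmf \<nu>) P (\<lambda>i x. cell P (x i)) 0 n = (\<Sum>w\<in>words n P. eta (\<Sum>x\<in>{x\<in>E. ?w x = w}. pmf \<nu> x))"
    by (simp add: word_entropy_def Hent_def meas)
  also have "\<dots> = (\<Sum>w\<in>?w ` E. eta (\<Sum>x\<in>{x\<in>E. ?w x = w}. pmf \<nu> x))"
  proof (rule sum.mono_neutral_right)
    show "finite (words n P)" using P by (intro finite_PiE) auto
    show "?w ` E \<subseteq> words n P" using cell_in(1)[OF P(2)] by (intro image_subsetI word_in_words) auto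
    show "\<forall>w\<in>words n P - ?w ` E. eta (\<Sum>x\<in>{x\<in>E. ?w x = w}. pmf \<nu> x) = 0"
    proof
      fix w assume "w \<in> words n P - ?w ` E"
      then have "{x\<in>E. ?w x = w} = {}" by auto
      then show "eta (\<Sum>x\<in>{x\<in>E. ?w x = w}. pmf \<nu> x) = 0" by (metis sum.empty eta_0)
    qed
  qed
  also have "\<dots> = (\<Sum>x\<in>E. eta (\<Sum>y\<in>{y\<in>E. ?w y = ?w x}. pmf \<nu> y))"
    using inj by (simp add: sum.reindex)
  also have "\<dots> = (\<Sum>x\<in>E. eta (pmf \<nu> x))"
  proof (rule sum.cong[OF refl])
    fix x assume "x \<in> E"
    then have "{y\<in>E. ?w y = ?w x} = {x}" using inj by (auto dest: inj_onD)
    then show "eta (\<Sum>y\<in>{y\<in>E. ?w y = ?w x}. pmf \<nu> y) = eta (pmf \<nu> x)" by simp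
  qed
  finally have H: "word_entropy (measure_pmf \<nu>) P (\<lambda>i x. cell P (x i)) 0 n = (\<Sum>x\<in>E. eta (pmf \<nu> x))" .
  have I: "measure_pmf.expectation \<nu> (F n) = (\<Sum>x\<in>E. pmf \<nu> x * F n x)"
    using E(1) \<nu>(1) by (subst integral_measure_pmf_real[of E]) (auto simp: mult.commute)
  have "(\<Sum>x\<in>E. eta (pmf \<nu> x)) + (\<Sum>x\<in>E. pmf \<nu> x * F n x) = (\<Sum>x\<in>E. pmf \<nu> x * ln Z)"
    unfolding sum.distrib[symmetric]
  proof (rule sum.cong[OF refl])
    fix x assume x: "x \<in> E"
    have *: "F n x = ln (pmf \<nu> x) + ln Z" using \<nu>(2)[OF x] Z by (simp add: Z_def[symmetric] ln_div)
    show "eta (pmf \<nu> x) + pmf \<nu> x * F n x = pmf \<nu> x * ln Z"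
      unfolding eta_def * by (simp add: algebra_simps)
  qed
  also have "\<dots> = ln Z" using sum_pmf_eq_1[OF E(1)] \<nu>(1) by (simp add: sum_distrib_right[symmetric])
  finally show ?thesis by (simp add: H I Z_def)
qed

text \<open>For \<open>n\<close> at most 1 the defining quotient is a division by 0 and carries no
  information, but then the sum is empty.\<close>

lemma pseudo_orbit_sum_le:
  assumes "x \<in> pseudo_orbits T \<delta> n" "\<delta> \<ge> 0"
  shows "(\<Sum>i<n - 1. dist (T (x i)) (x (i + 1))) \<le> real n * \<delta>"
proof (cases "n - 1 = 0")
  case False
  then have "(\<Sum>i<n - 1. dist (T (x i)) (x (i + 1))) \<le> real (n - 1) * \<delta>"
    using assms(1) by (auto simp: pseudo_orbits_def field_simps)
  also have "\<dots> \<le> real n * \<delta>" using assms(2) by (intro mult_right_mono) auto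
  finally show ?thesis .
next
  case True
  then show ?thesis using assms(2) by simp
qed

subsection \<open>The variational principle\<close>

text \<open>Fixes one partition whose entropy is close enough to the supremum; the mean is finite,
  so it can be subtracted from both sides.\<close>

lemma (in invariant_potential) separated_lower_bound':
  assumes fin: "asymptotic_mean f \<mu> > - \<infinity>" and b: "ereal b < ks_entropy T \<mu> + asymptotic_mean f \<mu>"
  obtains \<epsilon> where "\<epsilon> > 0"
    "\<And>G. (\<And>n. G n \<in> sets borel) \<Longrightarrow> (\<lambda>n. measure \<mu> (G n)) \<longlonglongrightarrow> 1 \<Longrightarrow>
      \<forall>\<^sub>F n in sequentially. \<exists>E\<subseteq>G n. finite E \<and> separated T n \<epsilon> E \<and> exp (b * real n) \<le> (\<Sum>x\<in>E. exp (f n x))"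
proof -
  obtain r where r: "asymptotic_mean f \<mu> = ereal r"
    using fin asymptotic_mean_less_infinity by (cases "asymptotic_mean f \<mu>") auto
  have "ereal (b - r) < ks_entropy T \<mu>"
    using b r by (cases "ks_entropy T \<mu>") auto
  then obtain P where P: "finite_borel_partition P" "ereal (b - r) < entropy_wrt T \<mu> P"
    unfolding ks_entropy_def less_SUP_iff by auto
  have "b < real_of_ereal (entropy_wrt T \<mu> P) + r"
    using P(2) entropy_wrt_finite[OF P(1)] by (cases "entropy_wrt T \<mu> P") auto
  from separated_lower_bound[OF P(1) r this] that show ?thesis by blast
qed

lemma (in invariant_potential) variational_lower_bound:
  assumes fin: "asymptotic_mean f \<mu> > - \<infinity>"
  shows "ks_entropy T \<mu> + asymptotic_mean f \<mu> \<le> pressure T f"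
proof (rule ccontr)
  assume "\<not> ?thesis"
  then obtain b where b: "pressure T f < ereal b" "ereal b < ks_entropy T \<mu> + asymptotic_mean f \<mu>"
    using ereal_dense2 by (metis not_le)
  obtain \<epsilon> where \<epsilon>: "\<epsilon> > 0" "\<And>G. (\<And>n. G n \<in> sets borel) \<Longrightarrow> (\<lambda>n. measure \<mu> (G n)) \<longlonglongrightarrow> 1 \<Longrightarrow>
      \<forall>\<^sub>F n in sequentially. \<exists>E\<subseteq>G n. finite E \<and> separated T n \<epsilon> E \<and> exp (b * real n) \<le> (\<Sum>x\<in>E. exp (f n x))"
    using separated_lower_bound'[OF fin b(2)] by blast
  have "\<forall>\<^sub>F n in sequentially. \<exists>E\<subseteq>UNIV. finite E \<and> separated T n \<epsilon> E \<and> exp (b * real n) \<le> (\<Sum>x\<in>E. exp (f n x))"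
    using \<epsilon>(2)[of "\<lambda>_. UNIV"] prob_space by simp
  then have "\<forall>\<^sub>F n in sequentially. ereal (exp (b * real n)) \<le> P_n T f \<epsilon> n"
  proof eventually_elim
    case (elim n)
    then obtain E where "finite E" "separated T n \<epsilon> E" "exp (b * real n) \<le> (\<Sum>x\<in>E. exp (f n x))" by blast
    then show ?case unfolding P_n_def by (intro SUP_upper2[of E]) auto
  qed
  then have "ereal b \<le> P_eps T f \<epsilon>" unfolding P_eps_def by (rule exp_growth_ge)
  also have "\<dots> \<le> pressure T f" unfolding pressure_eq_SUP using \<epsilon>(1) by (intro SUP_upper) auto
  finally show False using b(1) by simp
qed

lemma (in invariant_potential) ergodic_lower_bound:
  assumes fin: "asymptotic_mean f \<mu> > - \<infinity>" and erg: "ergodic T \<mu>"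
  shows "ks_entropy T \<mu> + asymptotic_mean f \<mu> \<le> GP_at T F \<mu>"
proof (rule ccontr)
  assume "\<not> ?thesis"
  then obtain b where b: "GP_at T F \<mu> < ereal b" "ereal b < ks_entropy T \<mu> + asymptotic_mean f \<mu>"
    using ereal_dense2 by (metis not_le)
  obtain \<epsilon> where \<epsilon>: "\<epsilon> > 0" "\<And>G. (\<And>n. G n \<in> sets borel) \<Longrightarrow> (\<lambda>n. measure \<mu> (G n)) \<longlonglongrightarrow> 1 \<Longrightarrow>
      \<forall>\<^sub>F n in sequentially. \<exists>E\<subseteq>G n. finite E \<and> separated T n \<epsilon> E \<and> exp (b * real n) \<le> (\<Sum>x\<in>E. exp (f n x))"
    using separated_lower_bound'[OF fin b(2)] by blast
  have "ereal b \<le> exp_growth (\<lambda>n. sup_exp_sum F \<epsilon> n (pseudo_orbits_at T \<delta> \<mu> L n))"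
    if L: "finite L" "\<forall>g\<in>L. continuous_on UNIV g" and \<delta>: "\<delta> > 0" for L and \<delta> :: real
  proof (rule exp_growth_ge)
    define G where "G n = {x. \<forall>g\<in>L. \<bar>bsum g n x / real n - (\<integral>x. g x \<partial>\<mu>)\<bar> \<le> \<delta>}" for n
    have L': "continuous_on UNIV g" if "g \<in> L" for g using L(2) that by blast
    have "\<forall>\<^sub>F n in sequentially. \<exists>E\<subseteq>G n. finite E \<and> separated T n \<epsilon> E \<and> exp (b * real n) \<le> (\<Sum>x\<in>E. exp (f n x))"
      unfolding G_def by (intro \<epsilon>(2) ergodic_generic_sets[OF erg L(1) L' \<delta>])
    then show "\<forall>\<^sub>F n in sequentially. ereal (exp (b * real n)) \<le> sup_exp_sum F \<epsilon> n (pseudo_orbits_at T \<delta> \<mu> L n)"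
      using eventually_ge_at_top[of 1]
    proof eventually_elim
      case (elim n)
      then obtain E where E: "E \<subseteq> G n" "finite E" "separated T n \<epsilon> E" "exp (b * real n) \<le> (\<Sum>x\<in>E. exp (f n x))" by blast
      have "orbit_block T n x \<in> pseudo_orbits_at T \<delta> \<mu> L n" if "x \<in> E" for x
      proof -
        have "(\<Sum>i<n. g (orbit_block T n x i)) = bsum g n x" for g :: "'a \<Rightarrow> real" by (simp add: orbit_block_def bsum_def)
        then show ?thesis using that E(1) orbit_block_pseudo_orbit[OF \<delta>]
          by (auto simp: pseudo_orbits_at_def G_def)
      qed
      then have "ereal (\<Sum>x\<in>E. exp (f n x)) \<le> sup_exp_sum F \<epsilon> n (pseudo_orbits_at T \<delta> \<mu> L n)"
        using E elim(2) by (intro sup_exp_sum_orbits)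
      then show ?case using E(4) by (meson ereal_less_eq(3) order_trans)
    qed
  qed
  then have "ereal b \<le> GP_at_eps T F \<mu> \<epsilon>" unfolding GP_at_eps_def by (auto intro!: INF_greatest)
  also have "\<dots> \<le> GP_at T F \<mu>" unfolding GP_at_eq_SUP using \<epsilon>(1) by (intro SUP_upper) auto
  finally show False using b(1) by simp
qed

section \<open>Upper bounds for the pressures of average pseudo-orbits\<close>

lemma (in potential_net) separated_upper_bound:
  assumes e: "e > 0"
    and E: "\<forall>\<^sub>F k in K. finite (E k) \<and> E k \<noteq> {} \<and> E k \<subseteq> tuples (n k) \<and> separated_tuples (n k) e (E k) \<and>
      exp (a * real (n k)) \<le> (\<Sum>x\<in>E k. exp (F (n k) x)) \<and>
      set_pmf (\<nu> k) = E k \<and> (\<forall>x\<in>E k. pmf (\<nu> k) x = exp (F (n k) x) / (\<Sum>y\<in>E k. exp (F (n k) y)))"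
    and fin: "asymptotic_mean f \<mu> > - \<infinity>"
  shows "ereal a \<le> ks_entropy T \<mu> + asymptotic_mean f \<mu>"
proof -
  \<comment> \<open>The bound on the diameters is the separation constant itself, so no product cell
    contains two points of \<open>E k\<close>.\<close>
  obtain P where P: "finite_borel_partition P" "\<And>A. A \<in> P \<Longrightarrow> jordan \<mu> A"
    "\<And>A x y. A \<in> P \<Longrightarrow> x \<in> A \<Longrightarrow> y \<in> A \<Longrightarrow> dist x y \<le> e"
    using small_jordan_partition[OF e] by blast
  show ?thesis
  proof (rule entropy_bound[OF P(1,2) _ fin])
    show "\<forall>\<^sub>F k in K. a * real (n k) \<le>
      word_entropy (measure_pmf (\<nu> k)) P (\<lambda>i x. cell P (x i)) 0 (n k) + ex k (bF (n k))"
      using E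
    proof eventually_elim
      case (elim k)
      have "a * real (n k) \<le> ln (\<Sum>x\<in>E k. exp (F (n k) x))"
        using elim by (metis exp_gt_zero ln_exp ln_le_cancel_iff less_le_trans)
      also have "\<dots> = word_entropy (measure_pmf (\<nu> k)) P (\<lambda>i x. cell P (x i)) 0 (n k) + ex k (F (n k))"
        using elim by (intro gibbs_entropy[where e = e] partition_P(1,2)[OF P(1)] P(3)) auto
      also have "ex k (F (n k)) = ex k (bF (n k))"
        using elim bF_eq by (intro integral_cong_AE) (auto simp: AE_measure_pmf_iff subset_iff)
      finally show ?case .
    qed
  qed
qed

lemma (in invariant_potential) GP_at_upper_bound:
  assumes fin: "asymptotic_mean f \<mu> > - \<infinity>"
  shows "GP_at T F \<mu> \<le> ks_entropy T \<mu> + asymptotic_mean f \<mu>"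
proof (rule ccontr)
  assume "\<not> ?thesis"
  then obtain a where a: "ks_entropy T \<mu> + asymptotic_mean f \<mu> < ereal a" "ereal a < GP_at T F \<mu>"
    using ereal_dense2 by (metis not_le)
  obtain e where e: "e > 0" "ereal a < GP_at_eps T F \<mu> e" using a(2) unfolding GP_at_eq_SUP less_SUP_iff by auto
  define CF where "CF = {g :: 'a \<Rightarrow> real. continuous_on UNIV g}"
  \<comment> \<open>Indices are pairs of a finite set of test functions, growing under inclusion,
    and a tolerance that tends to 0 from above.\<close>
  define K where "K = finite_subsets_at_top CF \<times>\<^sub>F at_right (0::real)"
  define good where "good k \<longleftrightarrow> finite (fst k) \<and> fst k \<subseteq> CF \<and> snd k > 0" for k :: "('a \<Rightarrow> real) set \<times> real"
  \<comment> \<open>The first condition forces the lengths to infinity as the tolerance tends to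
    0.\<close>
  define spec where "spec k n E \<nu> \<longleftrightarrow> real n \<ge> 1 / snd k \<and> finite E \<and> E \<noteq> {} \<and>
      E \<subseteq> pseudo_orbits_at T (snd k) \<mu> (fst k) n \<and> separated_tuples n e E \<and>
      exp (a * real n) \<le> (\<Sum>x\<in>E. exp (F n x)) \<and>
      set_pmf \<nu> = E \<and> (\<forall>x\<in>E. pmf \<nu> x = exp (F n x) / (\<Sum>y\<in>E. exp (F n y)))"
    for k :: "('a \<Rightarrow> real) set \<times> real" and n E \<nu>
  have "\<exists>n E \<nu>. finite (set_pmf \<nu>) \<and> (good k \<longrightarrow> spec k n E \<nu>)" for k
  proof (cases "good k")
    case True
    have "GP_at_eps T F \<mu> e \<le> exp_growth (\<lambda>n. sup_exp_sum F e n (pseudo_orbits_at T (snd k) \<mu> (fst k) n))"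
      unfolding GP_at_eps_def using True
      by (intro INF_lower2[of "fst k"] INF_lower2[of "snd k"]) (auto simp: good_def CF_def)
    then have "ereal a < exp_growth (\<lambda>n. sup_exp_sum F e n (pseudo_orbits_at T (snd k) \<mu> (fst k) n))"
      using e(2) by (rule less_le_trans[rotated])
    then obtain n where n: "n \<ge> nat \<lceil>1 / snd k\<rceil>"
      "ereal (exp (a * real n)) < sup_exp_sum F e n (pseudo_orbits_at T (snd k) \<mu> (fst k) n)"
      by (rule exp_growth_less)
    obtain E where E: "finite E" "E \<noteq> {}" "E \<subseteq> pseudo_orbits_at T (snd k) \<mu> (fst k) n" "separated_tuples n e E"
      "exp (a * real n) < (\<Sum>x\<in>E. exp (F n x))" using sup_exp_sum_less[OF n(2)] by blast
    obtain \<nu> where "set_pmf \<nu> = E" "\<And>x. x \<in> E \<Longrightarrow> pmf \<nu> x = exp (F n x) / (\<Sum>y\<in>E. exp (F n y))"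
      using gibbs_pmf[OF E(1,2)] by blast
    moreover have "real n \<ge> 1 / snd k" using n(1) by linarith
    ultimately have "spec k n E \<nu>" using E by (simp add: spec_def)
    moreover have "finite (set_pmf \<nu>)" using E \<open>set_pmf \<nu> = E\<close> by simp
    ultimately show ?thesis by blast
  next
    case False
    \<comment> \<open>Dummy data for indices that the filter eventually avoids; finite support is
      demanded at every index.\<close>
    then show ?thesis by (intro exI[of _ 0] exI[of _ "{}"] exI[of _ "return_pmf undefined"]) auto
  qed
  then obtain n E \<nu> where fs: "\<And>k. finite (set_pmf (\<nu> k))" and sp: "\<And>k. good k \<Longrightarrow> spec k (n k) (E k) (\<nu> k)" by metis
  have ev_fst: "\<forall>\<^sub>F k in K. L0 \<subseteq> fst k" if "finite L0" "L0 \<subseteq> CF" for L0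
  proof -
    have "\<forall>\<^sub>F L in finite_subsets_at_top CF. L0 \<subseteq> L"
      using that by (auto simp: eventually_finite_subsets_at_top)
    then show ?thesis unfolding K_def by (rule eventually_compose_filterlim[OF _ filterlim_fst])
  qed
  have ev_snd: "\<forall>\<^sub>F k in K. Q (snd k)" if "\<forall>\<^sub>F d in at_right 0. Q d" for Q
    unfolding K_def using that by (rule eventually_compose_filterlim[OF _ filterlim_snd])
  have good: "\<forall>\<^sub>F k in K. good k"
  proof -
    have "\<forall>\<^sub>F L in finite_subsets_at_top CF. finite L \<and> L \<subseteq> CF"
      by (auto simp: eventually_finite_subsets_at_top)
    then have "\<forall>\<^sub>F k in K. finite (fst k) \<and> fst k \<subseteq> CF"
      unfolding K_def by (rule eventually_compose_filterlim[OF _ filterlim_fst])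
    moreover have "\<forall>\<^sub>F k in K. snd k > 0" by (intro ev_snd eventually_at_right_less)
    ultimately show ?thesis by eventually_elim (simp add: good_def)
  qed
  have d_lim: "(snd \<longlongrightarrow> 0) K"
  proof (rule tendstoI)
    fix r :: real assume "r > 0"
    then have "\<forall>\<^sub>F d in at_right (0::real). dist d 0 < r"
      by (auto simp: eventually_at_right_field intro: exI[of _ r])
    then show "\<forall>\<^sub>F k in K. dist (snd k) 0 < r" by (rule ev_snd)
  qed
  have ps: "\<forall>\<^sub>F k in K. \<forall>x\<in>set_pmf (\<nu> k). x \<in> pseudo_orbits_at T (snd k) \<mu> (fst k) (n k)"
    using good
  proof eventually_elim
    case (elim k)
    then show ?case using sp[OF elim] unfolding spec_def by blast
  qed
  interpret net: pseudo_orbit_net T K n snd \<nu>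
  proof
    show "tds T" by (rule tds)
    show "(snd \<longlongrightarrow> 0) K" by (rule d_lim)
    show "finite (set_pmf (\<nu> k))" for k by (rule fs)
    show "filterlim n at_top K"
      unfolding filterlim_at_top
    proof
      fix N :: nat
      have "\<forall>\<^sub>F d in at_right 0. d < 1 / (real N + 1)"
        by (auto simp: eventually_at_right_field intro!: exI[of _ "1 / (real N + 1)"])
      then have "\<forall>\<^sub>F k in K. snd k < 1 / (real N + 1)" by (rule ev_snd)
      then show "\<forall>\<^sub>F k in K. N \<le> n k" using good
      proof eventually_elim
        case (elim k)
        have "real N + 1 < 1 / snd k" using elim by (simp add: good_def field_simps)
        then have "real N < real (n k)" using sp[OF elim(2)] by (simp add: spec_def)
        then show ?case by simp
      qed
    qed
    show "\<forall>\<^sub>F k in K. \<forall>x\<in>set_pmf (\<nu> k). (\<Sum>i<n k - 1. dist (T (x i)) (x (i + 1))) \<le> real (n k) * snd k"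
      using ps good
    proof eventually_elim
      case (elim k)
      show ?case
      proof (intro ballI pseudo_orbit_sum_le)
        fix x assume "x \<in> set_pmf (\<nu> k)"
        then show "x \<in> pseudo_orbits T (snd k) (n k)" using elim(1) by (auto simp: pseudo_orbits_at_def)
        show "0 \<le> snd k" using elim(2) by (simp add: good_def)
      qed
    qed
  qed
  interpret net: potential_net T K n snd \<nu> \<mu> F
  proof
    show "K \<noteq> bot" unfolding K_def by (simp add: prod_filter_eq_bot trivial_limit_at_right_real)
    fix g :: "'a \<Rightarrow> real" assume g: "continuous_on UNIV g"
    \<comment> \<open>Eventually \<open>g\<close> is one of the test functions, and from then on the
      tolerance bounds the deviation of its averages from the integral.\<close>
    have "\<forall>\<^sub>F k in K. {g} \<subseteq> fst k" by (rule ev_fst) (use g in \<open>auto simp: CF_def\<close>)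
    then have "\<forall>\<^sub>F k in K. norm (net.emp k g - (\<integral>x. g x \<partial>\<mu>)) \<le> snd k"
      using ps
    proof eventually_elim
      case (elim k)
      have "\<bar>net.ex k (\<lambda>x. (\<Sum>i<n k. g (x i)) / real (n k) - (\<integral>x. g x \<partial>\<mu>))\<bar> \<le> snd k"
        using elim by (intro net.ex_abs_le) (auto simp: pseudo_orbits_at_def)
      then show ?case by (simp add: net.emp_def)
    qed
    then have "((\<lambda>k. net.emp k g - (\<integral>x. g x \<partial>\<mu>)) \<longlongrightarrow> 0) K" by (rule Lim_null_comparison[OF _ d_lim])
    then show "((\<lambda>k. net.emp k g) \<longlongrightarrow> (\<integral>x. g x \<partial>\<mu>)) K" by (rule Lim_null[THEN iffD2])
  qed
  have "ereal a \<le> ks_entropy T \<mu> + asymptotic_mean f \<mu>"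
  proof (rule net.separated_upper_bound[OF e(1) _ fin, of E])
    show "\<forall>\<^sub>F k in K. finite (E k) \<and> E k \<noteq> {} \<and> E k \<subseteq> tuples (n k) \<and> separated_tuples (n k) e (E k) \<and>
      exp (a * real (n k)) \<le> (\<Sum>x\<in>E k. exp (F (n k) x)) \<and>
      set_pmf (\<nu> k) = E k \<and> (\<forall>x\<in>E k. pmf (\<nu> k) x = exp (F (n k) x) / (\<Sum>y\<in>E k. exp (F (n k) y)))"
      using good
    proof eventually_elim
      case (elim k)
      have "pseudo_orbits_at T (snd k) \<mu> (fst k) (n k) \<subseteq> tuples (n k)"
        by (auto simp: pseudo_orbits_at_def pseudo_orbits_def)
      then show ?case using sp[OF elim] unfolding spec_def by blast
    qed
  qed
  then show False using a(1) by simp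
qed

lemma (in block_potential) GP_upper_bound:
  assumes fin: "\<And>\<mu>. \<mu> \<in> invariant_measures T \<Longrightarrow> asymptotic_mean (induced_potential T F) \<mu> > - \<infinity>"
  shows "GP T F \<le> (SUP \<mu>\<in>invariant_measures T. ks_entropy T \<mu> + asymptotic_mean (induced_potential T F) \<mu>)"
proof (rule ccontr)
  assume "\<not> ?thesis"
  then obtain a where a: "(SUP \<mu>\<in>invariant_measures T. ks_entropy T \<mu> + asymptotic_mean (induced_potential T F) \<mu>) < ereal a"
      "ereal a < GP T F"
    using ereal_dense2 by (metis not_le)
  obtain e where e: "e > 0" "ereal a < GP_eps T F e" using a(2) unfolding GP_eq_SUP less_SUP_iff by auto
  define spec where "spec k n E \<nu> \<longleftrightarrow> n \<ge> Suc k \<and> finite E \<and> E \<noteq> {} \<and>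
      E \<subseteq> pseudo_orbits T (1 / real (Suc k)) n \<and> separated_tuples n e E \<and>
      exp (a * real n) \<le> (\<Sum>x\<in>E. exp (F n x)) \<and>
      set_pmf \<nu> = E \<and> (\<forall>x\<in>E. pmf \<nu> x = exp (F n x) / (\<Sum>y\<in>E. exp (F n y)))" for k n E \<nu>
  have "\<exists>n E \<nu>. spec k n E \<nu>" for k
  proof -
    have "GP_eps T F e \<le> exp_growth (\<lambda>n. sup_exp_sum F e n (pseudo_orbits T (1 / real (Suc k)) n))"
      unfolding GP_eps_def by (intro INF_lower) auto
    then have "ereal a < exp_growth (\<lambda>n. sup_exp_sum F e n (pseudo_orbits T (1 / real (Suc k)) n))"
      using e(2) by (rule less_le_trans[rotated])
    then obtain n where n: "n \<ge> Suc k" "ereal (exp (a * real n)) < sup_exp_sum F e n (pseudo_orbits T (1 / real (Suc k)) n)"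
      by (rule exp_growth_less)
    obtain E where E: "finite E" "E \<noteq> {}" "E \<subseteq> pseudo_orbits T (1 / real (Suc k)) n" "separated_tuples n e E"
      "exp (a * real n) < (\<Sum>x\<in>E. exp (F n x))" using sup_exp_sum_less[OF n(2)] by blast
    obtain \<nu> where "set_pmf \<nu> = E" "\<And>x. x \<in> E \<Longrightarrow> pmf \<nu> x = exp (F n x) / (\<Sum>y\<in>E. exp (F n y))"
      using gibbs_pmf[OF E(1,2)] by blast
    then have "spec k n E \<nu>" using E n by (simp add: spec_def)
    then show ?thesis by blast
  qed
  then obtain n E \<nu> where sp: "\<And>k. spec k (n k) (E k) (\<nu> k)" by metis
  have fs: "finite (set_pmf (\<nu> k))" for k using sp[of k] by (simp add: spec_def)
  \<comment> \<open>The expected empirical measure as a distribution: a uniform coordinate of an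
    independently drawn tuple.\<close>
  define \<rho> where "\<rho> k = bind_pmf (pmf_of_set {..<n k}) (\<lambda>i. map_pmf (\<lambda>x. x i) (\<nu> k))" for k
  have n1: "n k \<ge> Suc k" for k using sp[of k] by (simp add: spec_def)
  have \<rho>: "measure_pmf.expectation (\<rho> k) g = measure_pmf.expectation (\<nu> k) (\<lambda>x. (\<Sum>i<n k. g (x i)) / real (n k))"
    for k and g :: "'a \<Rightarrow> real"
  proof -
    have "{..<n k} \<noteq> {}" using n1[of k] by (auto simp: lessThan_empty_iff)
    then have "measure_pmf.expectation (\<rho> k) g = (\<Sum>i<n k. measure_pmf.expectation (\<nu> k) (\<lambda>x. g (x i)) / real (n k))"
      unfolding \<rho>_def using fs by (subst pmf_expectation_bind_pmf_of_set) (auto simp: divide_inverse mult.commute)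
    also have "\<dots> = measure_pmf.expectation (\<nu> k) (\<lambda>x. (\<Sum>i<n k. g (x i)) / real (n k))"
      using fs[of k] by (simp add: Bochner_Integration.integral_sum integrable_measure_pmf_finite sum_divide_distrib)
    finally show ?thesis .
  qed
  obtain r \<mu> where r: "strict_mono (r :: nat \<Rightarrow> nat)" "prob_space \<mu>" "sets \<mu> = sets (borel :: 'a measure)"
    and lim: "\<And>g :: 'a \<Rightarrow> real. continuous_on UNIV g \<Longrightarrow>
      (\<lambda>k. measure_pmf.expectation (\<rho> (r k)) g) \<longlonglongrightarrow> (\<integral>x. g x \<partial>\<mu>)"
    using weak_sequential_compactness[OF tds_compact[OF tds_T], of \<rho>] by blast
  define d where "d k = 1 / real (Suc (r k))" for k
  have rk: "r k \<ge> k" for k by (rule seq_suble[OF r(1)])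
  interpret net: pseudo_orbit_net T sequentially "\<lambda>k. n (r k)" d "\<lambda>k. \<nu> (r k)"
  proof
    show "tds T" by (rule tds_T)
    show "finite (set_pmf (\<nu> (r k)))" for k by (rule fs)
    show "filterlim (\<lambda>k. n (r k)) sequentially sequentially"
    proof (rule filterlim_at_top_mono[OF filterlim_ident])
      show "\<forall>\<^sub>F k in sequentially. k \<le> n (r k)"
      proof (rule always_eventually, rule allI)
        fix k show "k \<le> n (r k)" using rk[of k] n1[of "r k"] by simp
      qed
    qed
    have "(\<lambda>k. 1 / real (Suc k)) \<longlonglongrightarrow> 0" using LIMSEQ_Suc[OF lim_const_over_n[of 1]] by simp
    from LIMSEQ_subseq_LIMSEQ[OF this r(1)] show "d \<longlonglongrightarrow> 0" by (simp add: d_def[abs_def] comp_def)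
    show "\<forall>\<^sub>F k in sequentially. \<forall>x\<in>set_pmf (\<nu> (r k)). (\<Sum>i<n (r k) - 1. dist (T (x i)) (x (i + 1))) \<le> real (n (r k)) * d k"
    proof (rule always_eventually, intro allI ballI pseudo_orbit_sum_le)
      fix k x assume "x \<in> set_pmf (\<nu> (r k))"
      then show "x \<in> pseudo_orbits T (d k) (n (r k))" using sp[of "r k"] by (auto simp: spec_def d_def)
      show "0 \<le> d k" by (simp add: d_def)
    qed
  qed
  have emp: "(\<lambda>k. net.emp k g) \<longlonglongrightarrow> (\<integral>x. g x \<partial>\<mu>)" if "continuous_on UNIV g" for g
    using lim[OF that] by (simp add: net.emp_def \<rho>)
  have inv: "\<mu> \<in> invariant_measures T"
  proof (rule invariant_measure_I[OF tds_T r(2,3)])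
    fix g :: "'a \<Rightarrow> real" assume g: "continuous_on UNIV g"
    have "continuous_on UNIV (\<lambda>x. g (T x))" by (rule continuous_on_compose2[OF g tds_continuous[OF tds_T]]) auto
    from tendsto_diff[OF emp[OF this] emp[OF g]] net.emp_shift[OF g]
    have "(\<integral>x. g (T x) \<partial>\<mu>) - (\<integral>x. g x \<partial>\<mu>) = 0" by (rule LIMSEQ_unique)
    then show "(\<integral>x. g (T x) \<partial>\<mu>) = (\<integral>x. g x \<partial>\<mu>)" by simp
  qed
  interpret net: potential_net T sequentially "\<lambda>k. n (r k)" d "\<lambda>k. \<nu> (r k)" \<mu> F
    by unfold_locales (use inv tds_T emp in auto)
  have "ereal a \<le> ks_entropy T \<mu> + asymptotic_mean (induced_potential T F) \<mu>"
  proof (rule net.separated_upper_bound[OF e(1) _ fin[OF inv], of "\<lambda>k. E (r k)"])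
    show "\<forall>\<^sub>F k in sequentially. finite (E (r k)) \<and> E (r k) \<noteq> {} \<and> E (r k) \<subseteq> tuples (n (r k)) \<and>
      separated_tuples (n (r k)) e (E (r k)) \<and>
      exp (a * real (n (r k))) \<le> (\<Sum>x\<in>E (r k). exp (F (n (r k)) x)) \<and>
      set_pmf (\<nu> (r k)) = E (r k) \<and>
      (\<forall>x\<in>E (r k). pmf (\<nu> (r k)) x = exp (F (n (r k)) x) / (\<Sum>y\<in>E (r k). exp (F (n (r k)) y)))"
    proof (rule always_eventually, rule allI)
      fix k
      have "pseudo_orbits T (1 / real (Suc (r k))) (n (r k)) \<subseteq> tuples (n (r k))"
        by (auto simp: pseudo_orbits_def)
      then show "finite (E (r k)) \<and> E (r k) \<noteq> {} \<and> E (r k) \<subseteq> tuples (n (r k)) \<and>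
      separated_tuples (n (r k)) e (E (r k)) \<and>
      exp (a * real (n (r k))) \<le> (\<Sum>x\<in>E (r k). exp (F (n (r k)) x)) \<and>
      set_pmf (\<nu> (r k)) = E (r k) \<and>
      (\<forall>x\<in>E (r k). pmf (\<nu> (r k)) x = exp (F (n (r k)) x) / (\<Sum>y\<in>E (r k). exp (F (n (r k)) y)))"
        using sp[of "r k"] unfolding spec_def by blast
    qed
  qed
  also have "\<dots> \<le> (SUP \<mu>\<in>invariant_measures T. ks_entropy T \<mu> + asymptotic_mean (induced_potential T F) \<mu>)"
    using inv by (rule SUP_upper)
  finally show False using a(1) by simp
qed

theorem corollary1p5:
  fixes T :: "'a::metric_space \<Rightarrow> 'a"
    and F :: "nat \<Rightarrow> (nat \<Rightarrow> 'a) \<Rightarrow> real"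
    and f :: "nat \<Rightarrow> 'a \<Rightarrow> real"
  defines "f \<equiv> induced_potential T F"
  assumes "tds T"
    and "block_subadditive F"
    and "\<forall>\<mu> \<in> invariant_measures T. asymptotic_mean f \<mu> > - \<infinity>"
  shows "GP T F = pressure T f
      \<and> pressure T f = (SUP \<mu> \<in> invariant_measures T. ks_entropy T \<mu> + asymptotic_mean f \<mu>)
      \<and> (\<forall>\<mu> \<in> invariant_measures T.
           GP_at T F \<mu> \<le> ks_entropy T \<mu> + asymptotic_mean f \<mu>
           \<and> (ergodic T \<mu> \<longrightarrow> GP_at T F \<mu> = ks_entropy T \<mu> + asymptotic_mean f \<mu>))"
proof -
  interpret block_potential T F using assms by unfold_locales
  have pot: "invariant_potential T F \<mu>" if "\<mu> \<in> invariant_measures T" for \<mu>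
    using assms(2) that by unfold_locales
  have fin: "asymptotic_mean (induced_potential T F) \<mu> > - \<infinity>" if "\<mu> \<in> invariant_measures T" for \<mu>
    using assms(4) that by (simp add: f_def)
  have "(SUP \<mu>\<in>invariant_measures T. ks_entropy T \<mu> + asymptotic_mean f \<mu>) \<le> pressure T f"
    unfolding f_def by (intro SUP_least invariant_potential.variational_lower_bound pot fin)
  moreover have "pressure T f \<le> GP T F" unfolding f_def by (rule pressure_le_GP)
  moreover have "GP T F \<le> (SUP \<mu>\<in>invariant_measures T. ks_entropy T \<mu> + asymptotic_mean f \<mu>)"
    unfolding f_def by (rule GP_upper_bound[OF fin])
  moreover have "GP_at T F \<mu> \<le> ks_entropy T \<mu> + asymptotic_mean f \<mu>" if "\<mu> \<in> invariant_measures T" for \<mu>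
    unfolding f_def using that by (intro invariant_potential.GP_at_upper_bound pot fin)
  moreover have "ks_entropy T \<mu> + asymptotic_mean f \<mu> \<le> GP_at T F \<mu>"
    if "\<mu> \<in> invariant_measures T" "ergodic T \<mu>" for \<mu>
    unfolding f_def using that by (intro invariant_potential.ergodic_lower_bound pot fin)
  ultimately show ?thesis by (auto intro: antisym)
qed

end
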